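(* Let $\nu$ be a symmetric probability measure on $[0,1]$ with associated integer $\ell=\ell(\nu)\ge1$ (assumed finite), let $\frac{1}{2\ell+1}<\alpha<1$, and let $0<\beta\le\frac12$ with $\alpha\le 2\beta$. Let $X=\{X_t\}_{t\ge0}$, $X_0=0$, be a centered Gaussian process with continuous paths on $(\Omega,\mathcal F,\mathbb P)$ which is self-similar with exponent $\beta$. Put $\phi(x)=\mathbb E[X_1X_x]$ for $x\ge1$. Assume that $\phi$ is continuous on $[1,\infty)$ and twice continuously differentiable on $(1,\infty)$, that there is $\lambda>0$ such that $\psi(x)=\phi(x)+\lambda(x-1)^\alpha$ has a bounded derivative on $(1,2]$, and that there are constants $C_1,C_2>0$ and $1<\theta\le2$ with $$|\phi''(x)|\le C_1\mathbf 1_{(1,2]}(x)(x-1)^{\alpha-2}+C_2\mathbf 1_{(2,\infty)}(x)x^{-\theta-1},\qquad x>1.$$ Let $f\in\mathcal C^{8\ell+2}(\mathbb R)$ and let $$S_n^\nu(f',t)=\sum_{j=0}^{\lfloor nt\rfloor-1}\int_0^1 f'\!\left(X_{\frac jn}+y\,\Delta X_{\frac jn}\right)\Delta X_{\frac jn}\,\nu(dy),\qquad \Delta X_{\frac jn}=X_{\frac{j+1}n}-X_{\frac jn}.$$ Then for every $t\ge0$ the sums $S_n^\nu(f',t)$ converge in probability as $n\to\infty$; denoting the limit (the $\nu$-symmetric integral) by $\int_0^tf'(X_s)\,d^\nu X_s$, one has for all $t\ge0$ $$f(X_t)=f(0)+\int_0^tf'(X_s)\,d^\nu X_s .$$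
   Context: Self-similar with exponent $\beta$: for every $c>0$, the process $\{c^{-\beta}X_{ct}\}_{t\ge0}$ has the same law as $X$. Consequently $\mathbb E[X_sX_t]=s^{2\beta}\phi(t/s)$ for $0<s\le t$. A probability measure $\nu$ on $[0,1]$ is symmetric if $\nu(A)=\nu(1-A)$ for every Borel set $A\subset[0,1]$. Its associated integer $\ell(\nu)\ge1$ is the largest integer $\ell$ such that $\int_0^1x^{2j}\nu(dx)=\frac1{2j+1}$ for $j=1,\dots,\ell-1$ (the condition is void for $\ell=1$). *)

theory Defs
  imports "HOL-Probability.Probability"
begin

text \<open>Processes indexed by \<open>t \<ge> 0\<close> are functions \<open>X :: real \<Rightarrow> 'a \<Rightarrow> real\<close>
  of which only the values at nonnegative times are used.\<close>

text \<open>Gaussian variables may be degenerate (this is needed, e.g., for \<open>X 0 = 0\<close>), whereas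
  \<^const>\<open>normal_density\<close> requires positive variance.\<close>

definition gaussian_variable :: "'a measure \<Rightarrow> ('a \<Rightarrow> real) \<Rightarrow> bool" where
  "gaussian_variable M Y \<longleftrightarrow> Y \<in> borel_measurable M \<and>
     (\<exists>\<mu> \<sigma>. (\<sigma> > 0 \<and> distributed M lborel Y (\<lambda>x. ennreal (normal_density \<mu> \<sigma> x)))
          \<or> (\<sigma> = 0 \<and> (AE \<omega> in M. Y \<omega> = \<mu>)))"

definition centered_gaussian_process :: "'a measure \<Rightarrow> (real \<Rightarrow> 'a \<Rightarrow> real) \<Rightarrow> bool" where
  "centered_gaussian_process M X \<longleftrightarrow>
     (\<forall>I a. finite I \<and> I \<subseteq> {0..} \<longrightarrow> gaussian_variable M (\<lambda>\<omega>. \<Sum>t\<in>I. a t * X t \<omega>)) \<and>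
     (\<forall>t\<ge>0. (\<integral>\<omega>. X t \<omega> \<partial>M) = 0)"

text \<open>The law of a process on the product space of real functions on \<open>[0,\<infinity>)\<close>.\<close>

definition process_law :: "'a measure \<Rightarrow> (real \<Rightarrow> 'a \<Rightarrow> real) \<Rightarrow> (real \<Rightarrow> real) measure" where
  "process_law M X =
     distr M (\<Pi>\<^sub>M t\<in>{0::real..}. (borel :: real measure)) (\<lambda>\<omega>. \<lambda>t\<in>{0..}. X t \<omega>)"

definition self_similar :: "'a measure \<Rightarrow> real \<Rightarrow> (real \<Rightarrow> 'a \<Rightarrow> real) \<Rightarrow> bool" where
  "self_similar M \<beta> X \<longleftrightarrow>
     (\<forall>c>0. process_law M (\<lambda>t \<omega>. c powr (- \<beta>) * X (c * t) \<omega>) = process_law M X)"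

definition prob_measure_unit_interval :: "real measure \<Rightarrow> bool" where
  "prob_measure_unit_interval \<nu> \<longleftrightarrow>
     prob_space \<nu> \<and> sets \<nu> = sets (restrict_space borel {0..1})"

definition symmetric_measure :: "real measure \<Rightarrow> bool" where
  "symmetric_measure \<nu> \<longleftrightarrow>
     (\<forall>A\<in>sets borel. A \<subseteq> {0..1} \<longrightarrow> emeasure \<nu> A = emeasure \<nu> ((\<lambda>x. 1 - x) ` A))"

definition moment_condition :: "real measure \<Rightarrow> nat \<Rightarrow> bool" where
  "moment_condition \<nu> l \<longleftrightarrow>
     (\<forall>j\<in>{1..<l}. (\<integral>x. x ^ (2 * j) \<partial>\<nu>) = 1 / (2 * real j + 1))"

text \<open>\<open>l\<close> is the associated integer of \<open>\<nu>\<close>; that such an \<open>l\<close> exists is exactly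
  the finiteness of the associated integer.\<close>

definition associated_integer :: "real measure \<Rightarrow> nat \<Rightarrow> bool" where
  "associated_integer \<nu> l \<longleftrightarrow>
     1 \<le> l \<and> moment_condition \<nu> l \<and> (\<forall>m\<ge>1. moment_condition \<nu> m \<longrightarrow> m \<le> l)"

text \<open>\<open>k\<close> times continuously differentiable on an open set \<open>S\<close>.\<close>

definition Ck_on :: "nat \<Rightarrow> real set \<Rightarrow> (real \<Rightarrow> real) \<Rightarrow> bool" where
  "Ck_on k S f \<longleftrightarrow>
     (\<forall>i<k. \<forall>x\<in>S. (deriv ^^ i) f differentiable at x) \<and> continuous_on S ((deriv ^^ k) f)"

text \<open>Measurability is part of the definition because the events below must be measurable
  for their \<^const>\<open>measure\<close> to be meaningful.\<close>

definition converges_in_probability ::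
  "'a measure \<Rightarrow> (nat \<Rightarrow> 'a \<Rightarrow> real) \<Rightarrow> ('a \<Rightarrow> real) \<Rightarrow> bool" where
  "converges_in_probability M Y Z \<longleftrightarrow>
     (\<forall>n. Y n \<in> borel_measurable M) \<and> Z \<in> borel_measurable M \<and>
     (\<forall>\<epsilon>>0. (\<lambda>n. measure M {\<omega> \<in> space M. \<bar>Y n \<omega> - Z \<omega>\<bar> > \<epsilon>}) \<longlonglongrightarrow> 0)"

definition increment :: "(real \<Rightarrow> 'a \<Rightarrow> real) \<Rightarrow> nat \<Rightarrow> nat \<Rightarrow> 'a \<Rightarrow> real" where
  "increment X n j \<omega> = X (real (j + 1) / real n) \<omega> - X (real j / real n) \<omega>"

definition nu_sum ::
  "real measure \<Rightarrow> (real \<Rightarrow> real) \<Rightarrow> (real \<Rightarrow> 'a \<Rightarrow> real) \<Rightarrow> real \<Rightarrow> nat \<Rightarrow> 'a \<Rightarrow> real" where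
  "nu_sum \<nu> g X t n \<omega> =
     (\<Sum>j<nat \<lfloor>real n * t\<rfloor>.
        \<integral>y. g (X (real j / real n) \<omega> + y * increment X n j \<omega>) * increment X n j \<omega> \<partial>\<nu>)"

text \<open>\<open>J\<close> is a version of the \<open>\<nu>\<close>-symmetric integral of \<open>g (X s)\<close> against \<open>X\<close>
  over \<open>[0,t]\<close>; as a limit in probability it is determined up to null sets only.\<close>

definition has_nu_symmetric_integral ::
  "'a measure \<Rightarrow> real measure \<Rightarrow> (real \<Rightarrow> real) \<Rightarrow> (real \<Rightarrow> 'a \<Rightarrow> real) \<Rightarrow> real
     \<Rightarrow> ('a \<Rightarrow> real) \<Rightarrow> bool" where
  "has_nu_symmetric_integral M \<nu> g X t J \<longleftrightarrow> converges_in_probability M (nu_sum \<nu> g X t) J"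

end

theory Submission
  imports Defs
begin

text \<open>
  If \<open>V\<close> is uniform on \<open>[0,1]\<close> and \<open>Y\<close> has law \<open>\<nu>\<close>, then
  \<open>f b - f a - (b - a) E f'(a + Y (b - a)) = (b - a) E [f'(a + V (b - a)) - f'(a + Y (b - a))]\<close>,
  so up to a boundary term \<open>f (X t) - f 0 - S\<^sub>n\<close> is a sum of such quadrature errors. After a truncation
  \<open>f'\<close> is a superposition of exponentials \<open>exp (\<i> u x)\<close> with a weight of order \<open>(1 + u\<^sup>2)\<close> to the power
  \<open>- (2 l + 2)\<close>, and for an exponential the second moment of the sum is explicit: the covariance of the errors
  on two intervals is obtained by applying \<open>F \<mapsto> E [F(V) - F(Y)]\<close> in both variables to the mixed derivative of
  a Gaussian exponential. In centered coordinates this functional annihilates the odd powers and the powers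
  below \<open>2 l\<close>. If \<open>B\<close> bounds the row sums of \<open>\<bar>E \<Delta>\<^sub>i \<Delta>\<^sub>j\<bar>\<close>, the covariance is therefore at most of order
  \<open>(u\<^sup>2 B) ^ (2 l)\<close> times \<open>\<bar>E \<Delta>\<^sub>i \<Delta>\<^sub>j\<bar>\<close> plus \<open>u\<^sup>2\<close> times products of covariances of increments with values of
  the process. Self-similarity and the bound on \<open>\<phi>''\<close> give \<open>B = O(n powr - \<alpha>)\<close> and bounded variation of the
  covariance in each variable, so the second moment is \<open>O(n powr (1 - \<alpha> (2 l + 1)))\<close>.
\<close>

section \<open>Power series of Gaussian exponentials\<close>

text \<open>The obstacle is that all pairs of intervals contribute to the second moment, so bounding
  each pair by a power of B alone is useless: every pair must carry a factor that is summable over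
  the pairs. Expanding the interaction \<open>exp (\<rho> x y)\<close> in powers of \<rho> provides
  it. The terms with r \<ge> 1 contain \<rho>, and each further \<rho> pays for the order of
  cancellation lost on either side when x^r and y^r use up vanishing moments. The term r = 0
  decouples the intervals and has no such factor. Parity rescues it: only odd Taylor coefficients of
  \<open>exp (- a x\<^sup>2 / 2 - c x)\<close> survive there, and they vanish with c, the covariance
  of an increment with a difference of midpoints, whose absolute sums are controlled by bounded
  variation. Altogether N rows times B times B^(2l) remain, which is small because \<alpha> (2l + 1)
  > 1. The expansion helps only while u^2 B is at most of order one. For larger u the number of
  intervals is itself bounded by the power 2l + 1 of u^2, up to constants; this fixes the order 2l +
  2 of the Fourier weight, one more for integrability.\<close>

fun gcoef :: "real \<Rightarrow> real \<Rightarrow> nat \<Rightarrow> real" where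
  "gcoef a c 0 = 1"
| "gcoef a c (Suc 0) = - c"
| "gcoef a c (Suc (Suc m)) = (- c * gcoef a c (Suc m) - a * gcoef a c m) / real (m + 2)"

text \<open>The recurrence is the equation P' = (- a x - c) P for P =
  \<open>exp (- a x\<^sup>2 / 2 - c x)\<close>, read on Taylor coefficients. In powers of q, a
  raises the order by two, as the index does, and c has at least the order it needs; the divisor m +
  2 \<ge> 2 absorbs the sum of the two terms.\<close>

lemma gcoef_bound:
  assumes q: "0 \<le> q" "q \<le> 1" and a: "\<bar>a\<bar> \<le> q\<^sup>2" and c: "\<bar>c\<bar> \<le> q\<^sup>2"
  shows "\<bar>gcoef a c m\<bar> \<le> q ^ m"
proof (induction m rule: induct_nat_012)
  case 0
  show ?case by simp
next
  case 1
  have "q\<^sup>2 \<le> q" using q by (simp add: power2_eq_square mult_left_le)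
  then show ?case using c by simp
next
  case (ge2 m)
  have "\<bar>c\<bar> * \<bar>gcoef a c (Suc m)\<bar> \<le> q\<^sup>2 * q ^ Suc m"
    by (intro mult_mono c ge2) (use q in auto)
  also have "\<dots> \<le> q\<^sup>2 * q ^ m"
    using q by (intro mult_left_mono power_decreasing) auto
  finally have 1: "\<bar>c\<bar> * \<bar>gcoef a c (Suc m)\<bar> \<le> q\<^sup>2 * q ^ m" .
  have 2: "\<bar>a\<bar> * \<bar>gcoef a c m\<bar> \<le> q\<^sup>2 * q ^ m"
    by (intro mult_mono a ge2) (use q in auto)
  have "\<bar>- c * gcoef a c (Suc m) - a * gcoef a c m\<bar>
      \<le> \<bar>c\<bar> * \<bar>gcoef a c (Suc m)\<bar> + \<bar>a\<bar> * \<bar>gcoef a c m\<bar>"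
    unfolding abs_mult[symmetric] by linarith
  also have "\<dots> \<le> 2 * q ^ Suc (Suc m)"
    using 1 2 by (simp add: power2_eq_square)
  also have "\<dots> \<le> real (m + 2) * q ^ Suc (Suc m)"
    using q by (intro mult_right_mono) auto
  finally show ?case by (simp add: abs_divide divide_le_eq mult.commute)
qed

text \<open>For c = 0 the function is even, so every odd coefficient keeps a factor c: the
  recurrence reaches an odd index either from an even one with an explicit c or from the preceding
  odd one.\<close>

lemma gcoef_odd_bound:
  assumes q: "0 \<le> q" "q \<le> 1" and a: "\<bar>a\<bar> \<le> q\<^sup>2" and c: "\<bar>c\<bar> \<le> q\<^sup>2"
  shows "\<bar>gcoef a c (Suc (2 * m))\<bar> \<le> \<bar>c\<bar> * q ^ (2 * m)"
proof (induction m)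
  case 0
  show ?case by simp
next
  case (Suc m)
  have 1: "\<bar>c\<bar> * \<bar>gcoef a c (Suc (Suc (2 * m)))\<bar> \<le> \<bar>c\<bar> * q ^ Suc (Suc (2 * m))"
    by (intro mult_left_mono gcoef_bound assms) auto
  have "\<bar>a\<bar> * \<bar>gcoef a c (Suc (2 * m))\<bar> \<le> q\<^sup>2 * (\<bar>c\<bar> * q ^ (2 * m))"
    by (intro mult_mono a Suc) (use q in auto)
  then have 2: "\<bar>a\<bar> * \<bar>gcoef a c (Suc (2 * m))\<bar> \<le> \<bar>c\<bar> * q ^ Suc (Suc (2 * m))"
    by (simp add: power2_eq_square mult_ac)
  have "\<bar>- c * gcoef a c (Suc (Suc (2 * m))) - a * gcoef a c (Suc (2 * m))\<bar>
      \<le> \<bar>c\<bar> * \<bar>gcoef a c (Suc (Suc (2 * m)))\<bar> + \<bar>a\<bar> * \<bar>gcoef a c (Suc (2 * m))\<bar>"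
    unfolding abs_mult[symmetric] by linarith
  also have "\<dots> \<le> 2 * (\<bar>c\<bar> * q ^ Suc (Suc (2 * m)))"
    using 1 2 by linarith
  also have "\<dots> \<le> real (Suc (2 * m) + 2) * (\<bar>c\<bar> * q ^ Suc (Suc (2 * m)))"
    using q by (intro mult_right_mono) auto
  finally show ?case by (simp add: abs_divide divide_le_eq mult.commute)
qed

text \<open>Uniqueness for a linear differential equation: the sum F of the series satisfies F' = (-
  c - a z) F on (-1, 1), so F times the reciprocal exponential is constant and equals 1 at the
  origin.\<close>

lemma gcoef_sums:
  assumes a: "\<bar>a\<bar> \<le> 1" and c: "\<bar>c\<bar> \<le> 1" and x: "\<bar>x\<bar> < 1"
  shows "(\<lambda>m. gcoef a c m * x ^ m) sums exp (- a * x\<^sup>2 / 2 - c * x)"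
proof -
  have bd: "\<bar>gcoef a c m\<bar> \<le> 1" for m
    using gcoef_bound[of 1 a c m] a c by simp
  have sm: "summable (\<lambda>m. gcoef a c m * z ^ m)" if "norm z < 1" for z :: real
  proof (rule summable_comparison_test')
    show "summable (\<lambda>m. \<bar>z\<bar> ^ m)" using that by simp
    show "norm (gcoef a c m * z ^ m) \<le> \<bar>z\<bar> ^ m" for m
      using bd[of m] by (simp add: abs_mult power_abs mult_left_le_one_le)
  qed
  define F where "F = (\<lambda>z. \<Sum>m. gcoef a c m * z ^ m)"
  have F: "(\<lambda>m. gcoef a c m * z ^ m) sums F z" if "\<bar>z\<bar> < 1" for z
    using sm[of z] that unfolding F_def by (simp add: summable_sums)
  have dF: "(F has_real_derivative (- c - a * z) * F z) (at z)" if z: "\<bar>z\<bar> < 1" for z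
  proof -
    have "(F has_real_derivative (\<Sum>n. diffs (gcoef a c) n * z ^ n)) (at z)"
      unfolding F_def using z by (intro termdiffs_strong'[of 1]) (auto intro: sm)
    moreover have "(\<lambda>n. diffs (gcoef a c) n * z ^ n) sums (- c * F z + (- a) * (z * F z))"
    proof -
      define h where "h n = (case n of 0 \<Rightarrow> 0 | Suc m \<Rightarrow> gcoef a c m * z ^ Suc m)" for n
      have "(\<lambda>n. h (Suc n)) sums (z * F z)"
        using sums_mult[OF F[OF z], of z] by (simp add: h_def mult_ac)
      then have "h sums (z * F z)"
        by (subst (asm) sums_Suc_iff) (simp add: h_def)
      then have "(\<lambda>n. - c * (gcoef a c n * z ^ n) + (- a) * h n) sums (- c * F z + (- a) * (z * F z))"
        by (intro sums_add sums_mult F z)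
      moreover have "- c * (gcoef a c n * z ^ n) + (- a) * h n = diffs (gcoef a c) n * z ^ n" for n
      proof (cases n)
        case (Suc m)
        have "real (m + 2) * gcoef a c (Suc (Suc m)) = - c * gcoef a c (Suc m) - a * gcoef a c m"
          by simp
        then have "z ^ Suc m * (real (m + 2) * gcoef a c (Suc (Suc m)))
            = z ^ Suc m * (- c * gcoef a c (Suc m) - a * gcoef a c m)" by simp
        then show ?thesis unfolding Suc h_def diffs_def
          by (simp del: gcoef.simps(3) add: algebra_simps)
      qed (simp add: h_def diffs_def)
      ultimately show ?thesis by simp
    qed
    moreover have "- c * F z + (- a) * (z * F z) = (- c - a * z) * F z"
      by (simp add: algebra_simps)
    ultimately show ?thesis using sums_unique by metis
  qed
  define G where "G = (\<lambda>z. F z * exp (a * z\<^sup>2 / 2 + c * z))"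
  have "G x = G 0"
  proof -
    have "\<exists>c. \<forall>z\<in>{-1<..<1}. G z = c"
    proof (rule has_field_derivative_zero_constant)
      fix z :: real assume "z \<in> {-1<..<1}"
      then have z: "\<bar>z\<bar> < 1" by auto
      show "(G has_real_derivative 0) (at z within {-1<..<1})"
        unfolding G_def
        by (auto intro!: derivative_eq_intros has_field_derivative_at_within[OF dF[OF z]]
            simp: algebra_simps power2_eq_square)
    qed simp
    moreover have "x \<in> {-1<..<1}" "(0::real) \<in> {-1<..<1}"
      using x by (auto simp: abs_less_iff)
    ultimately show ?thesis by metis
  qed
  moreover have "F 0 = 1"
    using F[of 0] by (simp add: powser_sums_zero_iff)
  ultimately have "F x = exp (- (a * x\<^sup>2 / 2 + c * x))"
    by (simp add: G_def exp_minus field_simps)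
  also have "- (a * x\<^sup>2 / 2 + c * x) = - a * x\<^sup>2 / 2 - c * x" by simp
  finally show ?thesis using F[OF x] by simp
qed

text \<open>Termwise derivative of x^r P. The truncated exponent m + r - 1 is harmless at m = r = 0,
  where the factor \<open>real (m + r)\<close> is 0.\<close>

lemma gcoef_deriv_sums:
  assumes a: "\<bar>a\<bar> \<le> 1" and c: "\<bar>c\<bar> \<le> 1" and x: "\<bar>x\<bar> < 1"
  defines "P \<equiv> exp (- a * x\<^sup>2 / 2 - c * x)"
  shows "(\<lambda>m. real (m + r) * gcoef a c m * x ^ (m + r - 1)) sums
    (real r * x ^ (r - 1) * P + x ^ r * ((- a * x - c) * P))"
proof -
  have "(\<lambda>n. diffs (gcoef a c) n * x ^ n) sums ((- a * x - c) * P)"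
    using x gcoef_sums[OF a c] unfolding P_def
    by (intro termdiffs_sums_strong[of 1 _ "\<lambda>x. exp (- a * x\<^sup>2 / 2 - c * x)"])
      (auto intro!: derivative_eq_intros simp: field_simps)
  then have "(\<lambda>m. real m * gcoef a c m * x ^ (m - 1)) sums ((- a * x - c) * P)"
    unfolding diffs_def
    using sums_Suc_iff[of "\<lambda>m. real m * gcoef a c m * x ^ (m - 1)" "(- a * x - c) * P"] by simp
  then have "(\<lambda>m. real r * x ^ (r - 1) * (gcoef a c m * x ^ m) + x ^ r * (real m * gcoef a c m * x ^ (m - 1)))
      sums (real r * x ^ (r - 1) * P + x ^ r * ((- a * x - c) * P))"
    unfolding P_def by (intro sums_add sums_mult gcoef_sums a c x)
  moreover have "real r * x ^ (r - 1) * (gcoef a c m * x ^ m) + x ^ r * (real m * gcoef a c m * x ^ (m - 1))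
    = real (m + r) * gcoef a c m * x ^ (m + r - 1)" for m
    by (cases r; cases m) (simp_all add: algebra_simps power_add)
  ultimately show ?thesis by simp
qed

text \<open>These are the series of \<open>exp (\<rho> * x * y)\<close> and of its derivatives in x,
  in y and in both, divided into the pieces that the product rule produces in
  \<open>gauss_kernel_sums\<close>.\<close>

lemma exp_weighted_sums:
  fixes \<rho> x y :: real
  shows "(\<lambda>r. \<rho> ^ r / fact r * (x ^ r * y ^ r)) sums exp (\<rho> * x * y)"
    and "(\<lambda>r. \<rho> ^ r / fact r * (real r * x ^ (r - 1) * y ^ r)) sums (\<rho> * y * exp (\<rho> * x * y))"
    and "(\<lambda>r. \<rho> ^ r / fact r * (real r * x ^ r * y ^ (r - 1))) sums (\<rho> * x * exp (\<rho> * x * y))"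
    and "(\<lambda>r. \<rho> ^ r / fact r * (real r * x ^ (r - 1) * (real r * y ^ (r - 1)))) sums
      (\<rho> * (1 + \<rho> * x * y) * exp (\<rho> * x * y))"
proof -
  show e: "(\<lambda>r. \<rho> ^ r / fact r * (x ^ r * y ^ r)) sums exp (\<rho> * x * y)"
    using exp_converges[of "\<rho> * x * y"] by (simp add: field_simps power_mult_distrib)
  have 0: "\<rho> ^ Suc r / fact (Suc r) * (real (Suc r) * z) = \<rho> * (\<rho> ^ r / fact r * z)" for r z
    by (simp only: fact_Suc power_Suc of_nat_mult) (simp del: of_nat_Suc)
  have 1: "\<rho> ^ Suc r / fact (Suc r) * (real (Suc r) * x ^ r * y ^ Suc r)
     = \<rho> * y * (\<rho> ^ r / fact r * (x ^ r * y ^ r))" for r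
    using 0[of r "x ^ r * y ^ Suc r"] by (simp add: mult_ac del: fact_Suc of_nat_Suc)
  show s: "(\<lambda>r. \<rho> ^ r / fact r * (real r * x ^ (r - 1) * y ^ r)) sums (\<rho> * y * exp (\<rho> * x * y))"
    by (rule sums_Suc_imp, simp, unfold diff_Suc_1 1, rule sums_mult[OF e])
  have 2: "\<rho> ^ Suc r / fact (Suc r) * (real (Suc r) * x ^ Suc r * y ^ r)
     = \<rho> * x * (\<rho> ^ r / fact r * (x ^ r * y ^ r))" for r
    using 0[of r "x ^ Suc r * y ^ r"] by (simp add: mult_ac del: fact_Suc of_nat_Suc)
  show "(\<lambda>r. \<rho> ^ r / fact r * (real r * x ^ r * y ^ (r - 1))) sums (\<rho> * x * exp (\<rho> * x * y))"
    by (rule sums_Suc_imp, simp, unfold diff_Suc_1 2, rule sums_mult[OF e])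
  have 3: "\<rho> ^ Suc r / fact (Suc r) * (real (Suc r) * x ^ r * (real (Suc r) * y ^ r))
     = \<rho> * (\<rho> ^ r / fact r * (x ^ r * y ^ r)) + \<rho> * x * (\<rho> ^ r / fact r * (real r * x ^ (r - 1) * y ^ r))" for r
    using 0[of r "x ^ r * (real (Suc r) * y ^ r)"]
    by (cases r) (simp_all add: algebra_simps del: fact_Suc)
  have "(\<lambda>r. \<rho> * (\<rho> ^ r / fact r * (x ^ r * y ^ r)) + \<rho> * x * (\<rho> ^ r / fact r * (real r * x ^ (r - 1) * y ^ r)))
    sums (\<rho> * exp (\<rho> * x * y) + \<rho> * x * (\<rho> * y * exp (\<rho> * x * y)))"
    by (intro sums_add sums_mult e s)
  also have "\<rho> * exp (\<rho> * x * y) + \<rho> * x * (\<rho> * y * exp (\<rho> * x * y)) = \<rho> * (1 + \<rho> * x * y) * exp (\<rho> * x * y)"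
    by (simp add: algebra_simps)
  finally show "(\<lambda>r. \<rho> ^ r / fact r * (real r * x ^ (r - 1) * (real r * y ^ (r - 1)))) sums
      (\<rho> * (1 + \<rho> * x * y) * exp (\<rho> * x * y))"
    by - (rule sums_Suc_imp, simp, unfold diff_Suc_1 3)
qed

section \<open>Measures with matching moments\<close>

text \<open>\<open>gderiv a c r\<close> is the derivative of \<open>x ^ r * exp (- a x\<^sup>2 / 2 - c x)\<close>, and \<open>gauss_kernel\<close> is the mixed
  derivative of \<open>exp (- a x\<^sup>2 / 2 - c x) * exp (- b y\<^sup>2 / 2 - d y) * exp (\<rho> x y)\<close>; expanding the last
  factor in powers of \<open>\<rho>\<close> decouples \<open>x\<close> from \<open>y\<close>.\<close>

definition gderiv :: "real \<Rightarrow> real \<Rightarrow> nat \<Rightarrow> real \<Rightarrow> real" where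
  "gderiv a c r x = real r * x ^ (r - 1) * exp (- a * x\<^sup>2 / 2 - c * x)
     + x ^ r * ((- a * x - c) * exp (- a * x\<^sup>2 / 2 - c * x))"

definition gauss_kernel :: "real \<Rightarrow> real \<Rightarrow> real \<Rightarrow> real \<Rightarrow> real \<Rightarrow> real \<Rightarrow> real \<Rightarrow> real" where
  "gauss_kernel a b c d \<rho> x y =
     (\<rho> + (- a * x - c + \<rho> * y) * (- b * y - d + \<rho> * x)) *
     (exp (- a * x\<^sup>2 / 2 - c * x) * exp (- b * y\<^sup>2 / 2 - d * y) * exp (\<rho> * x * y))"

lemma gauss_kernel_sums:
  "(\<lambda>r. \<rho> ^ r / fact r * (gderiv a c r x * gderiv b d r y)) sums gauss_kernel a b c d \<rho> x y"
proof -
  define P where "P = exp (- a * x\<^sup>2 / 2 - c * x)"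
  define Q where "Q = exp (- b * y\<^sup>2 / 2 - d * y)"
  define P' where "P' = (- a * x - c) * P"
  define Q' where "Q' = (- b * y - d) * Q"
  have "(\<lambda>r. P * Q * (\<rho> ^ r / fact r * (real r * x ^ (r - 1) * (real r * y ^ (r - 1))))
      + P * Q' * (\<rho> ^ r / fact r * (real r * x ^ (r - 1) * y ^ r))
      + P' * Q * (\<rho> ^ r / fact r * (real r * x ^ r * y ^ (r - 1)))
      + P' * Q' * (\<rho> ^ r / fact r * (x ^ r * y ^ r)))
    sums (P * Q * (\<rho> * (1 + \<rho> * x * y) * exp (\<rho> * x * y)) + P * Q' * (\<rho> * y * exp (\<rho> * x * y))
      + P' * Q * (\<rho> * x * exp (\<rho> * x * y)) + P' * Q' * exp (\<rho> * x * y))"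
    by (intro sums_add sums_mult exp_weighted_sums)
  moreover have "P * Q * (\<rho> ^ r / fact r * (real r * x ^ (r - 1) * (real r * y ^ (r - 1))))
      + P * Q' * (\<rho> ^ r / fact r * (real r * x ^ (r - 1) * y ^ r))
      + P' * Q * (\<rho> ^ r / fact r * (real r * x ^ r * y ^ (r - 1)))
      + P' * Q' * (\<rho> ^ r / fact r * (x ^ r * y ^ r))
    = \<rho> ^ r / fact r * (gderiv a c r x * gderiv b d r y)" for r
    unfolding gderiv_def P_def[symmetric] Q_def[symmetric] P'_def[symmetric] Q'_def[symmetric]
    by (simp add: algebra_simps)
  moreover have "P * Q * (\<rho> * (1 + \<rho> * x * y) * exp (\<rho> * x * y)) + P * Q' * (\<rho> * y * exp (\<rho> * x * y))
      + P' * Q * (\<rho> * x * exp (\<rho> * x * y)) + P' * Q' * exp (\<rho> * x * y)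
    = gauss_kernel a b c d \<rho> x y"
    unfolding gauss_kernel_def P_def[symmetric] Q_def[symmetric] P'_def Q'_def
    by (simp add: algebra_simps)
  ultimately show ?thesis by simp
qed

text \<open>The value is 8. The factor 2 (1/2)^(j - 1) is the largest possible quadrature error of
  x^(j - 1) on [-1/2, 1/2], and j comes from differentiating x^j.\<close>

definition geo_const :: real where
  "geo_const = (\<Sum>j. real j * 2 * (1/2) ^ (j - 1))"

lemma geo_summable: "summable (\<lambda>j. real j * 2 * (1/2) ^ (j - 1) :: real)"
proof -
  have "summable (\<lambda>n. diffs (\<lambda>_. 1) n * (1/2) ^ n :: real)"
    by (rule termdiff_converges[of _ 1]) auto
  then have "summable (\<lambda>n. 2 * (real (Suc n) * (1/2) ^ n))"
    by (intro summable_mult) (simp add: diffs_def)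
  also have "(\<lambda>n. 2 * (real (Suc n) * (1/2) ^ n)) = (\<lambda>n. real (Suc n) * 2 * (1/2) ^ (Suc n - 1) :: real)"
    by auto
  finally show ?thesis by (rule summable_Suc_iff[THEN iffD1])
qed

lemma geo_shift_summable: "summable (\<lambda>m. real (m + r) * 2 * (1/2) ^ (m + r - 1) :: real)"
  using summable_ignore_initial_segment[OF geo_summable, of r] .

lemma geo_shift_le: "(\<Sum>m. real (m + r) * 2 * (1/2) ^ (m + r - 1)) \<le> geo_const"
  unfolding geo_const_def
  using suminf_split_initial_segment[OF geo_summable, of r]
  by (simp add: sum_nonneg)

lemma geo_const_nonneg: "0 \<le> geo_const"
  unfolding geo_const_def by (intro suminf_nonneg geo_summable) auto

lemma gderiv_sums:
  assumes "\<bar>a\<bar> \<le> 1" "\<bar>c\<bar> \<le> 1" "\<bar>x\<bar> < 1"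
  shows "(\<lambda>m. real (m + r) * gcoef a c m * x ^ (m + r - 1)) sums gderiv a c r x"
  unfolding gderiv_def by (rule gcoef_deriv_sums[OF assms])

lemma gderiv_term_bound:
  assumes a: "\<bar>a\<bar> \<le> 1" and c: "\<bar>c\<bar> \<le> 1" and x: "\<bar>x\<bar> \<le> 1/2"
  shows "\<bar>real (m + r) * gcoef a c m * x ^ (m + r - 1)\<bar> \<le> real (m + r) * (1/2) ^ (m + r - 1)"
proof -
  have "\<bar>gcoef a c m\<bar> \<le> 1" using gcoef_bound[of 1 a c m] a c by simp
  moreover have "\<bar>x\<bar> ^ (m + r - 1) \<le> (1/2) ^ (m + r - 1)" using x by (intro power_mono) auto
  ultimately have "\<bar>gcoef a c m\<bar> * \<bar>x\<bar> ^ (m + r - 1) \<le> 1 * (1/2) ^ (m + r - 1)"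
    by (intro mult_mono) auto
  then have "real (m + r) * (\<bar>gcoef a c m\<bar> * \<bar>x\<bar> ^ (m + r - 1)) \<le> real (m + r) * (1/2) ^ (m + r - 1)"
    by (intro mult_left_mono) auto
  then show ?thesis by (simp add: abs_mult power_abs mult_ac)
qed

lemma gderiv_bound:
  assumes a: "\<bar>a\<bar> \<le> 1" and c: "\<bar>c\<bar> \<le> 1" and x: "\<bar>x\<bar> \<le> 1/2"
  shows "\<bar>gderiv a c r x\<bar> \<le> geo_const"
proof -
  have s: "(\<lambda>m. real (m + r) * gcoef a c m * x ^ (m + r - 1)) sums gderiv a c r x"
    using x by (intro gderiv_sums a c) auto
  have "norm (\<Sum>m. real (m + r) * gcoef a c m * x ^ (m + r - 1))
      \<le> (\<Sum>m. real (m + r) * 2 * (1/2) ^ (m + r - 1))"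
  proof (intro norm_suminf_le geo_shift_summable)
    fix m
    have "real (m + r) * (1/2) ^ (m + r - 1) \<le> real (m + r) * 2 * (1/2) ^ (m + r - 1)"
      by (intro mult_right_mono) auto
    with gderiv_term_bound[OF a c x, of m r]
    show "norm (real (m + r) * gcoef a c m * x ^ (m + r - 1)) \<le> real (m + r) * 2 * (1/2) ^ (m + r - 1)"
      unfolding real_norm_def by linarith
  qed
  then show ?thesis using geo_shift_le[of r] sums_unique[OF s] by simp
qed

text \<open>In the application \<open>V\<close> is uniform on \<open>[-1/2,1/2]\<close> and \<open>Y\<close> is \<open>y - 1/2\<close> with \<open>y\<close> distributed
  according to \<open>\<nu>\<close>; the odd moments vanish because both laws are symmetric.\<close>

locale moment_matching = prob_space P for P :: "'b measure" +
  fixes V Y :: "'b \<Rightarrow> real" and l :: nat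
  assumes V_meas [measurable]: "V \<in> borel_measurable P"
    and Y_meas [measurable]: "Y \<in> borel_measurable P"
    and V_bound: "\<And>p. p \<in> space P \<Longrightarrow> \<bar>V p\<bar> \<le> 1/2"
    and Y_bound: "\<And>p. p \<in> space P \<Longrightarrow> \<bar>Y p\<bar> \<le> 1/2"
    and moments: "\<And>j. odd j \<or> j < 2 * l \<Longrightarrow> (\<integral>p. V p ^ j - Y p ^ j \<partial>P) = 0"
begin

section \<open>The quadrature functional on power series\<close>

definition kap :: "(real \<Rightarrow> real) \<Rightarrow> real" where
  "kap F = (\<integral>p. F (V p) - F (Y p) \<partial>P)"

lemma kap_bound:
  assumes F: "\<And>x. \<bar>x\<bar> \<le> 1/2 \<Longrightarrow> \<bar>F x\<bar> \<le> B" and B: "0 \<le> B"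
  shows "\<bar>kap F\<bar> \<le> 2 * B"
proof -
  have "norm (\<integral>p. F (V p) - F (Y p) \<partial>P) \<le> 2 * B * measure P (space P)"
  proof (cases "integrable P (\<lambda>p. F (V p) - F (Y p))")
    case True
    have "AE p in P. norm (F (V p) - F (Y p)) \<le> 2 * B"
    proof (rule AE_I2)
      fix p assume "p \<in> space P"
      then show "norm (F (V p) - F (Y p)) \<le> 2 * B"
        using F[OF V_bound, of p] F[OF Y_bound, of p] by simp
    qed
    then show ?thesis
      using order.trans[OF integral_norm_bound integral_mono_AE[OF integrable_norm[OF True], of "\<lambda>_. 2 * B"]]
      by (simp add: prob_space)
  next
    \<comment> \<open>The integral of a non-integrable function is 0 by convention, so the bound
      holds for every F and measurability is not an issue.\<close>
    case False
    then show ?thesis using B by (simp add: not_integrable_integral_eq prob_space)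
  qed
  then show ?thesis by (simp add: kap_def prob_space)
qed

lemma kap_sums:
  assumes m [measurable]: "\<And>n. F n \<in> borel_measurable borel"
    and bd: "\<And>n x. \<bar>x\<bar> \<le> 1/2 \<Longrightarrow> \<bar>F n x\<bar> \<le> B n"
    and B: "summable B"
    and F: "\<And>x. \<bar>x\<bar> \<le> 1/2 \<Longrightarrow> (\<lambda>n. F n x) sums G x"
  shows "(\<lambda>n. kap (F n)) sums kap G"
proof -
  have bd': "norm (F n (V p) - F n (Y p)) \<le> 2 * B n" if "p \<in> space P" for n p
    using bd[OF V_bound[OF that], of n] bd[OF Y_bound[OF that], of n] by simp
  have int: "integrable P (\<lambda>p. F n (V p) - F n (Y p))" for n
    by (rule integrable_const_bound[where B = "2 * B n"]) (auto intro!: AE_I2 bd'[unfolded real_norm_def])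
  have Gs: "(\<lambda>n. F n (V p) - F n (Y p)) sums (G (V p) - G (Y p))" if "p \<in> space P" for p
    by (intro sums_diff F V_bound Y_bound that)
  have "(\<lambda>n. \<integral>p. F n (V p) - F n (Y p) \<partial>P) sums (\<integral>p. (\<Sum>n. F n (V p) - F n (Y p)) \<partial>P)"
  proof (rule sums_integral[OF int])
    show "AE p in P. summable (\<lambda>n. norm (F n (V p) - F n (Y p)))"
      by (intro AE_I2 summable_comparison_test'[OF summable_mult[OF B, of 2]]) (use bd' in auto)
    show "summable (\<lambda>n. \<integral>p. norm (F n (V p) - F n (Y p)) \<partial>P)"
    proof (rule summable_comparison_test'[OF summable_mult[OF B, of 2]])
      fix n
      have "(\<integral>p. norm (F n (V p) - F n (Y p)) \<partial>P) \<le> (\<integral>p. 2 * B n \<partial>P)"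
        by (intro integral_mono integrable_norm int) (use bd' in auto)
      then show "norm (\<integral>p. norm (F n (V p) - F n (Y p)) \<partial>P) \<le> 2 * B n"
        by (simp add: prob_space)
    qed
  qed
  also have "(\<integral>p. (\<Sum>n. F n (V p) - F n (Y p)) \<partial>P) = kap G"
    unfolding kap_def
    by (intro Bochner_Integration.integral_cong refl sums_unique[symmetric] Gs)
  finally show ?thesis unfolding kap_def .
qed

lemma kap_power_bound: "\<bar>kap (\<lambda>x. x ^ j)\<bar> \<le> 2 * (1/2) ^ j"
proof (rule kap_bound)
  fix x :: real assume "\<bar>x\<bar> \<le> 1/2"
  then show "\<bar>x ^ j\<bar> \<le> (1/2) ^ j" unfolding power_abs by (intro power_mono) auto
qed simp

lemma kap_power_eq_0: "odd j \<or> j < 2 * l \<Longrightarrow> kap (\<lambda>x. x ^ j) = 0"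
  using moments unfolding kap_def by blast

lemma kap_cmult: "kap (\<lambda>x. c * F x) = c * kap F"
  unfolding kap_def by (simp flip: right_diff_distrib)

text \<open>Only even exponents m + r - 1 \<ge> 2l survive. Hence m \<ge> 2l + 1 - r, and
  \<open>gcoef_bound\<close> gives the power of q. For r = 0 the surviving m are odd and at least 2l
  + 1, so \<open>gcoef_odd_bound\<close> supplies the factor c. For r > 2l + 1 the truncated
  exponent is 0 and the bound is a plain constant.\<close>

lemma kap_gderiv_bound:
  assumes q: "0 \<le> q" "q \<le> 1" and a: "\<bar>a\<bar> \<le> q\<^sup>2" and c: "\<bar>c\<bar> \<le> q\<^sup>2"
  shows "\<bar>kap (gderiv a c r)\<bar> \<le> (if r = 0 then \<bar>c\<bar> * q ^ (2 * l) else q ^ (2 * l + 1 - r)) * geo_const"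
    (is "_ \<le> ?K * _")
proof -
  have q2: "q\<^sup>2 \<le> 1" using q by (simp add: power_le_one)
  then have a1: "\<bar>a\<bar> \<le> 1" and c1: "\<bar>c\<bar> \<le> 1" using a c by auto
  have half: "summable (\<lambda>m. real (m + r) * (1/2) ^ (m + r - 1) :: real)"
  proof -
    have "(\<lambda>m. 1/2 * (real (m + r) * 2 * (1/2) ^ (m + r - 1))) = (\<lambda>m. real (m + r) * (1/2) ^ (m + r - 1) :: real)"
      by auto
    then show ?thesis using summable_mult[OF geo_shift_summable[of r], of "1/2"] by simp
  qed
  have K: "0 \<le> ?K" using q by auto
  have s: "(\<lambda>m. real (m + r) * gcoef a c m * kap (\<lambda>x. x ^ (m + r - 1))) sums kap (gderiv a c r)"
    unfolding kap_cmult[symmetric]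
  proof (rule kap_sums[OF _ _ half])
    fix n x assume "\<bar>x\<bar> \<le> (1/2::real)"
    then show "\<bar>real (n + r) * gcoef a c n * x ^ (n + r - 1)\<bar> \<le> real (n + r) * (1/2) ^ (n + r - 1)"
      by (rule gderiv_term_bound[OF a1 c1])
  next
    fix x assume "\<bar>x\<bar> \<le> (1/2::real)"
    then show "(\<lambda>n. real (n + r) * gcoef a c n * x ^ (n + r - 1)) sums gderiv a c r x"
      by (intro gderiv_sums a1 c1) auto
  qed simp
  have "norm (\<Sum>m. real (m + r) * gcoef a c m * kap (\<lambda>x. x ^ (m + r - 1)))
      \<le> (\<Sum>m. ?K * (real (m + r) * 2 * (1/2) ^ (m + r - 1)))"
  proof (intro norm_suminf_le summable_mult geo_shift_summable)
    fix m
    have "\<bar>gcoef a c m * kap (\<lambda>x. x ^ (m + r - 1))\<bar> \<le> ?K * (2 * (1/2) ^ (m + r - 1))"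
      if mr: "m + r \<noteq> 0"
    proof (cases "odd (m + r - 1) \<or> m + r - 1 < 2 * l")
      case True
      then show ?thesis using K by (simp add: kap_power_eq_0)
    next
      case False
      have "\<bar>gcoef a c m\<bar> \<le> ?K"
      proof (cases "r = 0")
        case True
        with False mr have "odd m" by simp
        then obtain k where k: "m = Suc (2 * k)" by (metis oddE Suc_eq_plus1)
        have "\<bar>gcoef a c m\<bar> \<le> \<bar>c\<bar> * q ^ (2 * k)"
          unfolding k by (rule gcoef_odd_bound[OF q a c])
        also have "\<dots> \<le> \<bar>c\<bar> * q ^ (2 * l)"
          using False True k q by (intro mult_left_mono power_decreasing) auto
        finally show ?thesis using True by simp
      next
        case r: False
        have "\<bar>gcoef a c m\<bar> \<le> q ^ m" by (rule gcoef_bound[OF q a c])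
        also have "\<dots> \<le> q ^ (2 * l + 1 - r)"
          using False r q by (intro power_decreasing) auto
        finally show ?thesis using r by simp
      qed
      then show ?thesis
        unfolding abs_mult by (intro mult_mono kap_power_bound K) auto
    qed
    then have "real (m + r) * \<bar>gcoef a c m * kap (\<lambda>x. x ^ (m + r - 1))\<bar>
        \<le> real (m + r) * (?K * (2 * (1/2) ^ (m + r - 1)))"
      by (cases "m + r = 0") (auto intro!: mult_left_mono simp del: of_nat_add)
    moreover have "norm (real (m + r) * gcoef a c m * kap (\<lambda>x. x ^ (m + r - 1)))
        = real (m + r) * \<bar>gcoef a c m * kap (\<lambda>x. x ^ (m + r - 1))\<bar>"
      by (simp add: abs_mult)
    ultimately show "norm (real (m + r) * gcoef a c m * kap (\<lambda>x. x ^ (m + r - 1)))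
        \<le> ?K * (real (m + r) * 2 * (1/2) ^ (m + r - 1))"
      by (simp only: mult_ac)
  qed
  also have "\<dots> = ?K * (\<Sum>m. real (m + r) * 2 * (1/2) ^ (m + r - 1))"
    by (rule suminf_mult[OF geo_shift_summable])
  also have "\<dots> \<le> ?K * geo_const"
    by (intro mult_left_mono geo_shift_le K)
  finally show ?thesis using sums_unique[OF s] by simp
qed

lemma gderiv_measurable [measurable]: "gderiv a c r \<in> borel_measurable borel"
  unfolding gderiv_def by measurable

text \<open>In a term with r \<ge> 1 one factor |\<rho>| is kept and the other r - 1 are bounded by
  q^2, so the exponents of q add up to 2 (r - 1) + 2 (2l + 1 - r) = 4l; beyond r = 2l + 1 the first
  summand alone exceeds 4l. The term r = 0 contributes the product of the two parity factors, and
  the factorials sum to \<open>exp 1\<close>.\<close>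

theorem kap_kap_gauss_kernel_bound:
  assumes q: "0 \<le> q" "q \<le> 1" and a: "\<bar>a\<bar> \<le> q\<^sup>2" and b: "\<bar>b\<bar> \<le> q\<^sup>2"
    and c: "\<bar>c\<bar> \<le> q\<^sup>2" and d: "\<bar>d\<bar> \<le> q\<^sup>2" and \<rho>: "\<bar>\<rho>\<bar> \<le> q\<^sup>2"
  shows "\<bar>kap (\<lambda>x. kap (gauss_kernel a b c d \<rho> x))\<bar>
    \<le> exp 1 * geo_const\<^sup>2 * q ^ (4 * l) * (\<bar>c\<bar> * \<bar>d\<bar> + \<bar>\<rho>\<bar>)"
proof -
  have q2: "q\<^sup>2 \<le> 1" using q by (simp add: power_le_one)
  note one = order.trans[OF a q2] order.trans[OF b q2] order.trans[OF c q2] order.trans[OF d q2]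
  have ex: "summable (\<lambda>r. \<bar>\<rho>\<bar> ^ r / fact r)"
    using summable_exp[of "\<bar>\<rho>\<bar>"] by (simp add: field_simps)
  have inner: "(\<lambda>r. \<rho> ^ r / fact r * gderiv a c r x * kap (gderiv b d r)) sums kap (gauss_kernel a b c d \<rho> x)"
    if x: "\<bar>x\<bar> \<le> 1/2" for x
    unfolding kap_cmult[symmetric]
  proof (rule kap_sums[OF _ _ summable_mult2[OF ex, of "geo_const * geo_const"]])
    fix r y assume y: "\<bar>y\<bar> \<le> (1/2::real)"
    have "\<bar>gderiv a c r x\<bar> * \<bar>gderiv b d r y\<bar> \<le> geo_const * geo_const"
      by (intro mult_mono gderiv_bound one x y geo_const_nonneg) auto
    then have "\<bar>\<rho>\<bar> ^ r / fact r * (\<bar>gderiv a c r x\<bar> * \<bar>gderiv b d r y\<bar>) \<le> \<bar>\<rho>\<bar> ^ r / fact r * (geo_const * geo_const)"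
      by (intro mult_left_mono) auto
    then show "\<bar>\<rho> ^ r / fact r * gderiv a c r x * gderiv b d r y\<bar> \<le> \<bar>\<rho>\<bar> ^ r / fact r * (geo_const * geo_const)"
      by (simp add: abs_mult power_abs mult_ac)
  next
    fix y
    show "(\<lambda>r. \<rho> ^ r / fact r * gderiv a c r x * gderiv b d r y) sums gauss_kernel a b c d \<rho> x y"
      using gauss_kernel_sums by (simp add: mult_ac)
  qed measurable
  have kb: "\<bar>kap (gderiv b d r)\<bar> \<le> 2 * geo_const" for r
    by (intro kap_bound gderiv_bound one geo_const_nonneg)
  have outer: "(\<lambda>r. \<rho> ^ r / fact r * kap (gderiv b d r) * kap (gderiv a c r)) sums
      kap (\<lambda>x. kap (gauss_kernel a b c d \<rho> x))"
  proof (subst kap_cmult[symmetric], rule kap_sums[OF _ _ summable_mult2[OF ex, of "geo_const * (2 * geo_const)"]])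
    fix r x assume x: "\<bar>x\<bar> \<le> (1/2::real)"
    have "\<bar>gderiv a c r x\<bar> * \<bar>kap (gderiv b d r)\<bar> \<le> geo_const * (2 * geo_const)"
      by (intro mult_mono gderiv_bound one x geo_const_nonneg kb) auto
    then have "\<bar>\<rho>\<bar> ^ r / fact r * (\<bar>gderiv a c r x\<bar> * \<bar>kap (gderiv b d r)\<bar>) \<le> \<bar>\<rho>\<bar> ^ r / fact r * (geo_const * (2 * geo_const))"
      by (intro mult_left_mono) auto
    then show "\<bar>\<rho> ^ r / fact r * kap (gderiv b d r) * gderiv a c r x\<bar> \<le> \<bar>\<rho>\<bar> ^ r / fact r * (geo_const * (2 * geo_const))"
      by (simp add: abs_mult power_abs mult_ac)
  next
    fix x assume "\<bar>x\<bar> \<le> (1/2::real)"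
    from inner[OF this]
    show "(\<lambda>r. \<rho> ^ r / fact r * kap (gderiv b d r) * gderiv a c r x) sums kap (gauss_kernel a b c d \<rho> x)"
      by (simp add: mult_ac)
  qed measurable
  let ?S = "geo_const\<^sup>2 * q ^ (4 * l) * (\<bar>c\<bar> * \<bar>d\<bar> + \<bar>\<rho>\<bar>)"
  have "norm (\<Sum>r. \<rho> ^ r / fact r * kap (gderiv b d r) * kap (gderiv a c r))
      \<le> (\<Sum>r. ?S * (1 ^ r / fact r))"
  proof (intro norm_suminf_le summable_mult)
    fix r
    show "norm (\<rho> ^ r / fact r * kap (gderiv b d r) * kap (gderiv a c r)) \<le> ?S * (1 ^ r / fact r)"
    proof (cases r)
      case 0
      have "\<bar>kap (gderiv b d 0)\<bar> * \<bar>kap (gderiv a c 0)\<bar>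
          \<le> (\<bar>d\<bar> * q ^ (2 * l) * geo_const) * (\<bar>c\<bar> * q ^ (2 * l) * geo_const)"
        using kap_gderiv_bound[OF q a c, of 0] kap_gderiv_bound[OF q b d, of 0] q geo_const_nonneg
        by (intro mult_mono) auto
      also have "\<dots> = geo_const\<^sup>2 * q ^ (4 * l) * (\<bar>c\<bar> * \<bar>d\<bar>)"
        by (simp add: power2_eq_square power_add[symmetric] mult_ac)
      also have "\<dots> \<le> ?S"
        using q by (intro mult_left_mono) auto
      finally show ?thesis using 0 by (simp add: abs_mult)
    next
      case (Suc k)
      let ?e = "2 * l + 1 - r"
      have "\<bar>\<rho>\<bar> ^ r * (\<bar>kap (gderiv b d r)\<bar> * \<bar>kap (gderiv a c r)\<bar>)
          \<le> (\<bar>\<rho>\<bar> * (q\<^sup>2) ^ k) * ((q ^ ?e * geo_const) * (q ^ ?e * geo_const))"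
        using kap_gderiv_bound[OF q a c, of r] kap_gderiv_bound[OF q b d, of r] q geo_const_nonneg \<rho> Suc
        by (intro mult_mono) (auto intro!: mult_left_mono power_mono)
      also have "\<dots> = geo_const\<^sup>2 * \<bar>\<rho>\<bar> * q ^ (2 * k + ?e + ?e)"
        by (simp only: power_mult[symmetric] power_add power2_eq_square[of geo_const] mult_ac)
      also have "\<dots> \<le> geo_const\<^sup>2 * \<bar>\<rho>\<bar> * q ^ (4 * l)"
        using q Suc by (intro mult_left_mono power_decreasing) auto
      also have "\<dots> = geo_const\<^sup>2 * q ^ (4 * l) * \<bar>\<rho>\<bar>" by simp
      also have "\<dots> \<le> ?S"
        using q by (intro mult_left_mono) auto
      finally show ?thesis
        by (simp add: abs_mult power_abs divide_right_mono mult.assoc)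
    qed
    show "summable (\<lambda>r. 1 ^ r / fact r :: real)"
      using summable_exp[of "1::real"] by (simp add: field_simps)
  qed
  also have "\<dots> = ?S * exp 1"
    using exp_converges[of "1::real"]
    by (subst suminf_mult) (auto simp: sums_iff field_simps)
  finally show ?thesis using sums_unique[OF outer] by (simp add: mult_ac)
qed

end

section \<open>Gaussian processes\<close>

lemma (in prob_space) gaussian_variable_integrable:
  assumes "gaussian_variable M Y"
  shows "integrable M Y" "integrable M (\<lambda>\<omega>. (Y \<omega>)\<^sup>2)"
proof -
  from assms obtain \<mu> \<sigma> where Y [measurable]: "Y \<in> borel_measurable M" and
    c: "(\<sigma> > 0 \<and> distributed M lborel Y (\<lambda>x. ennreal (normal_density \<mu> \<sigma> x)))
          \<or> (\<sigma> = 0 \<and> (AE \<omega> in M. Y \<omega> = \<mu>))"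
    unfolding gaussian_variable_def by blast
  have "integrable M Y \<and> integrable M (\<lambda>\<omega>. (Y \<omega>)\<^sup>2)"
    using c
  proof (elim disjE conjE)
    assume s: "\<sigma> > 0" and D: "distributed M lborel Y (\<lambda>x. ennreal (normal_density \<mu> \<sigma> x))"
    have 1: "integrable lborel (\<lambda>x. normal_density \<mu> \<sigma> x * x)"
      using s by (rule integrable_normal_moment_nz_1)
    have "integrable lborel (\<lambda>x. normal_density \<mu> \<sigma> x * (x - \<mu>) ^ 2
        + 2 * \<mu> * (normal_density \<mu> \<sigma> x * x) - \<mu>\<^sup>2 * normal_density \<mu> \<sigma> x)"
      using s by (intro Bochner_Integration.integrable_add Bochner_Integration.integrable_diff
          integrable_mult_right 1 integrable_normal_moment integrable_normal_density)
    then have 2: "integrable lborel (\<lambda>x. normal_density \<mu> \<sigma> x * x\<^sup>2)"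
      by (rule Bochner_Integration.integrable_cong[THEN iffD1, rotated 2])
        (auto simp: power2_eq_square algebra_simps)
    from 1 2 show ?thesis
      using distributed_integrable[OF D, of "\<lambda>x. x"] distributed_integrable[OF D, of "\<lambda>x. x\<^sup>2"] by simp
  next
    assume ae: "AE \<omega> in M. Y \<omega> = \<mu>"
    then have "AE \<omega> in M. \<mu> = Y \<omega>" "AE \<omega> in M. \<mu>\<^sup>2 = (Y \<omega>)\<^sup>2" by auto
    then show ?thesis
      using integrable_cong_AE[of "\<lambda>_. \<mu>" M Y] integrable_cong_AE[of "\<lambda>_. \<mu>\<^sup>2" M "\<lambda>\<omega>. (Y \<omega>)\<^sup>2"] by simp
  qed
  then show "integrable M Y" "integrable M (\<lambda>\<omega>. (Y \<omega>)\<^sup>2)" by auto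
qed

lemma (in prob_space) gaussian_variable_char:
  assumes G: "gaussian_variable M Y" and mean: "expectation Y = 0"
  shows "(CLINT \<omega>|M. iexp (Y \<omega>)) = complex_of_real (exp (- expectation (\<lambda>\<omega>. (Y \<omega>)\<^sup>2) / 2))"
proof -
  from G obtain \<mu> \<sigma> where Y [measurable]: "Y \<in> borel_measurable M" and
    c: "(\<sigma> > 0 \<and> distributed M lborel Y (\<lambda>x. ennreal (normal_density \<mu> \<sigma> x)))
          \<or> (\<sigma> = 0 \<and> (AE \<omega> in M. Y \<omega> = \<mu>))"
    unfolding gaussian_variable_def by blast
  from c show ?thesis
  proof (elim disjE conjE)
    assume s: "\<sigma> > 0" and D: "distributed M lborel Y (\<lambda>x. ennreal (normal_density \<mu> \<sigma> x))"
    have \<mu>: "\<mu> = 0" using normal_distributed_expectation[OF s D] mean by simp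
    have v: "expectation (\<lambda>\<omega>. (Y \<omega>)\<^sup>2) = \<sigma>\<^sup>2"
      using normal_distributed_variance[OF s D] mean by simp
    have D': "distributed M lborel (\<lambda>\<omega>. Y \<omega> / \<sigma>) (\<lambda>x. ennreal (std_normal_density x))"
      using normal_standard_normal_convert[OF s, of Y \<mu>] D \<mu> by simp
    have "(CLINT \<omega>|M. iexp (Y \<omega>)) = (CLINT \<omega>|M. iexp (\<sigma> * (Y \<omega> / \<sigma>)))"
      using s by simp
    also have "\<dots> = (CLINT z|distr M lborel (\<lambda>\<omega>. Y \<omega> / \<sigma>). iexp (\<sigma> * z))"
      by (subst integral_distr) auto
    also have "\<dots> = char std_normal_distribution \<sigma>"
      unfolding distributed_distr_eq_density[OF D'] char_def ..
    also have "\<dots> = complex_of_real (exp (- \<sigma>\<^sup>2 / 2))"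
      by (simp add: char_std_normal_distribution)
    finally show ?thesis using v by simp
  next
    assume ae: "AE \<omega> in M. Y \<omega> = \<mu>"
    have "expectation Y = expectation (\<lambda>_. \<mu>)"
      by (rule integral_cong_AE) (use ae in auto)
    then have \<mu>: "\<mu> = 0" using mean by (simp add: prob_space)
    have "(CLINT \<omega>|M. iexp (Y \<omega>)) = (CLINT \<omega>|M. 1)"
      by (rule integral_cong_AE) (use ae \<mu> in auto)
    moreover have "expectation (\<lambda>\<omega>. (Y \<omega>)\<^sup>2) = expectation (\<lambda>_. 0)"
      by (rule integral_cong_AE) (use ae \<mu> in auto)
    ultimately show ?thesis by (simp add: prob_space)
  qed
qed

section \<open>Differentiating characteristic functions\<close>

lemma difference_quotient_seq:
  fixes g :: "real \<Rightarrow> complex"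
  assumes "(g has_vector_derivative g') (at 0)"
  shows "(\<lambda>n. of_nat (Suc n) * (g (1 / real (Suc n)) - g 0)) \<longlonglongrightarrow> g'"
proof -
  have lim: "((\<lambda>h. norm (g (0 + h) - g 0 - h *\<^sub>R g') / norm h) \<longlongrightarrow> 0) (at 0)"
    using assms unfolding has_vector_derivative_def has_derivative_at by blast
  have "filterlim (\<lambda>n. 1 / real (Suc n)) (at 0) sequentially"
    unfolding filterlim_at using LIMSEQ_Suc[OF lim_1_over_n] by simp
  from filterlim_compose[OF lim this]
  have "(\<lambda>n. norm (of_nat (Suc n) * (g (1 / real (Suc n)) - g 0) - g')) \<longlonglongrightarrow> 0"
  proof (rule Lim_transform_eventually[OF _ always_eventually], intro allI)
    fix n
    let ?h = "1 / real (Suc n)"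
    have "of_nat (Suc n) * (g ?h - g 0) - g' = of_nat (Suc n) * (g (0 + ?h) - g 0 - ?h *\<^sub>R g')"
      by (simp add: scaleR_conv_of_real right_diff_distrib del: of_nat_Suc)
    then show "norm (g (0 + ?h) - g 0 - ?h *\<^sub>R g') / norm ?h
        = norm (of_nat (Suc n) * (g ?h - g 0) - g')"
      by (simp only: norm_mult norm_of_nat) simp
  qed
  then show ?thesis by (simp add: LIM_zero_iff tendsto_norm_zero_iff)
qed

text \<open>A factor V inside an expectation is produced as the derivative of a known function g.
  The difference quotients at y = 1 / (n + 1) are dominated by |W V| because |exp (i y) - 1| \<le>
  |y|, so dominated convergence identifies their limit.\<close>

lemma (in prob_space) diff_under_expectation:
  fixes W :: "'a \<Rightarrow> complex" and V :: "'a \<Rightarrow> real"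
  assumes W: "integrable M W" and V [measurable]: "V \<in> borel_measurable M"
    and WV: "integrable M (\<lambda>\<omega>. W \<omega> * V \<omega>)"
    and g: "\<And>y. (CLINT \<omega>|M. W \<omega> * iexp (y * V \<omega>)) = g y"
    and g': "(g has_vector_derivative g') (at 0)"
  shows "(CLINT \<omega>|M. \<i> * (W \<omega> * V \<omega>)) = g'"
proof (rule LIMSEQ_unique)
  have [measurable]: "W \<in> borel_measurable M" using W by auto
  have int: "integrable M (\<lambda>\<omega>. W \<omega> * iexp (y * V \<omega>))" for y
    by (rule Bochner_Integration.integrable_bound[OF W]) (auto simp: norm_mult)
  define s where "s n \<omega> = of_nat (Suc n) * (W \<omega> * iexp (1 / real (Suc n) * V \<omega>) - W \<omega> * iexp (0 * V \<omega>))"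
    for n \<omega>
  show "(\<lambda>n. (CLINT \<omega>|M. s n \<omega>)) \<longlonglongrightarrow> g'"
  proof -
    have "(CLINT \<omega>|M. s n \<omega>) = of_nat (Suc n) * (g (1 / real (Suc n)) - g 0)" for n
      unfolding s_def g[symmetric]
      by (subst integral_mult_right_zero, subst Bochner_Integration.integral_diff[OF int int]) simp
    then show ?thesis using difference_quotient_seq[OF g'] by simp
  qed
  show "(\<lambda>n. (CLINT \<omega>|M. s n \<omega>)) \<longlonglongrightarrow> (CLINT \<omega>|M. \<i> * (W \<omega> * V \<omega>))"
  proof (rule integral_dominated_convergence)
    show "integrable M (\<lambda>\<omega>. norm (W \<omega> * V \<omega>))" using WV by simp
    show "AE \<omega> in M. (\<lambda>n. s n \<omega>) \<longlonglongrightarrow> \<i> * (W \<omega> * V \<omega>)"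
    proof (rule AE_I2)
      fix \<omega>
      have "((\<lambda>y. W \<omega> * iexp (y * V \<omega>)) has_vector_derivative (\<i> * (W \<omega> * V \<omega>))) (at 0)"
      proof -
        have D: "((\<lambda>z. W \<omega> * exp (\<i> * (z * V \<omega>))) has_field_derivative \<i> * (W \<omega> * V \<omega>)) (at (of_real 0))"
          by (auto intro!: derivative_eq_intros)
        show ?thesis using has_vector_derivative_real_field[OF D] by simp
      qed
      from difference_quotient_seq[OF this]
      show "(\<lambda>n. s n \<omega>) \<longlonglongrightarrow> \<i> * (W \<omega> * V \<omega>)"
        by (simp add: s_def)
    qed
    fix n
    show "AE \<omega> in M. norm (s n \<omega>) \<le> norm (W \<omega> * V \<omega>)"
    proof (rule AE_I2)
      fix \<omega>
      have "norm (iexp (1 / real (Suc n) * V \<omega>) - 1) \<le> \<bar>1 / real (Suc n) * V \<omega>\<bar>"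
        using iexp_approx1[of "1 / real (Suc n) * V \<omega>" 0] by simp
      then have "real (Suc n) * norm (iexp (1 / real (Suc n) * V \<omega>) - 1) \<le> \<bar>V \<omega>\<bar>"
        by (simp add: abs_mult field_simps)
      then have "norm (W \<omega>) * (real (Suc n) * norm (iexp (1 / real (Suc n) * V \<omega>) - 1)) \<le> norm (W \<omega>) * \<bar>V \<omega>\<bar>"
        by (rule mult_left_mono) simp
      moreover have "s n \<omega> = W \<omega> * (of_nat (Suc n) * (iexp (1 / real (Suc n) * V \<omega>) - 1))"
        by (simp add: s_def algebra_simps)
      ultimately show "norm (s n \<omega>) \<le> norm (W \<omega> * V \<omega>)"
        by (simp only: norm_mult norm_of_nat norm_of_real)
    qed
  qed (auto simp: s_def)
qed

locale gaussian_process = prob_space M for M :: "'a measure" +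
  fixes X :: "real \<Rightarrow> 'a \<Rightarrow> real"
  assumes gp: "centered_gaussian_process M X"
begin

text \<open>Joint normality enters only through this span: each of its elements is a centered
  Gaussian variable, hence has a characteristic function determined by its variance.\<close>

definition gspan :: "('a \<Rightarrow> real) set" where
  "gspan = {Y. \<exists>I a. finite I \<and> I \<subseteq> {0..} \<and> Y = (\<lambda>\<omega>. \<Sum>t\<in>I. a t * X t \<omega>)}"

lemma gspan_base: "0 \<le> t \<Longrightarrow> X t \<in> gspan"
  unfolding gspan_def by (auto intro!: exI[of _ "{t}"] exI[of _ "\<lambda>_. 1"])

lemma gspan_cmult: "Y \<in> gspan \<Longrightarrow> (\<lambda>\<omega>. c * Y \<omega>) \<in> gspan"
proof -
  assume "Y \<in> gspan"
  then obtain I a where "finite I" "I \<subseteq> {0..}" "Y = (\<lambda>\<omega>. \<Sum>t\<in>I. a t * X t \<omega>)"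
    unfolding gspan_def by blast
  then show ?thesis unfolding gspan_def
    by (auto intro!: exI[of _ I] exI[of _ "\<lambda>t. c * a t"] simp: sum_distrib_left mult.assoc)
qed

lemma gspan_add:
  assumes "Y \<in> gspan" "Z \<in> gspan"
  shows "(\<lambda>\<omega>. Y \<omega> + Z \<omega>) \<in> gspan"
proof -
  obtain I a where Y: "finite I" "I \<subseteq> {0..}" "Y = (\<lambda>\<omega>. \<Sum>t\<in>I. a t * X t \<omega>)"
    using assms unfolding gspan_def by blast
  obtain J b where Z: "finite J" "J \<subseteq> {0..}" "Z = (\<lambda>\<omega>. \<Sum>t\<in>J. b t * X t \<omega>)"
    using assms unfolding gspan_def by blast
  define h where "h t = (if t \<in> I then a t else 0) + (if t \<in> J then b t else 0)" for t
  have "Y \<omega> + Z \<omega> = (\<Sum>t\<in>I \<union> J. h t * X t \<omega>)" for \<omega>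
  proof -
    have "Y \<omega> = (\<Sum>t\<in>I \<union> J. (if t \<in> I then a t else 0) * X t \<omega>)"
      unfolding Y by (rule sum.mono_neutral_cong_left) (use Y Z in auto)
    moreover have "Z \<omega> = (\<Sum>t\<in>I \<union> J. (if t \<in> J then b t else 0) * X t \<omega>)"
      unfolding Z by (rule sum.mono_neutral_cong_left) (use Y Z in auto)
    ultimately show ?thesis by (simp add: h_def sum.distrib algebra_simps)
  qed
  then show ?thesis
    unfolding gspan_def using Y Z by (auto intro!: exI[of _ "I \<union> J"] exI[of _ h])
qed

lemma gspan_diff: "Y \<in> gspan \<Longrightarrow> Z \<in> gspan \<Longrightarrow> (\<lambda>\<omega>. Y \<omega> - Z \<omega>) \<in> gspan"
  using gspan_add[OF _ gspan_cmult[of Z "-1"], of Y] by simp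

lemma X_gaussian: "0 \<le> t \<Longrightarrow> gaussian_variable M (X t)"
  using gp unfolding centered_gaussian_process_def
  by (auto dest!: conjunct1 spec[of _ "{t}"] spec[of _ "\<lambda>_. 1"])

lemma X_integrable: "0 \<le> t \<Longrightarrow> integrable M (X t)"
  by (intro gaussian_variable_integrable X_gaussian)

lemma gspan_gaussian:
  assumes "Y \<in> gspan"
  shows "gaussian_variable M Y" "expectation Y = 0"
proof -
  obtain I a where Y: "finite I" "I \<subseteq> {0..}" "Y = (\<lambda>\<omega>. \<Sum>t\<in>I. a t * X t \<omega>)"
    using assms unfolding gspan_def by blast
  show "gaussian_variable M Y"
    using gp Y unfolding centered_gaussian_process_def by blast
  have "expectation Y = (\<Sum>t\<in>I. expectation (\<lambda>\<omega>. a t * X t \<omega>))"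
    unfolding Y(3) by (rule Bochner_Integration.integral_sum) (use Y X_integrable in auto)
  also have "\<dots> = 0"
    using gp Y(2) unfolding centered_gaussian_process_def by (intro sum.neutral) auto
  finally show "expectation Y = 0" .
qed

lemma gspan_measurable: "Y \<in> gspan \<Longrightarrow> Y \<in> borel_measurable M"
  using gspan_gaussian(1) unfolding gaussian_variable_def by blast

lemma gspan_integrable: "Y \<in> gspan \<Longrightarrow> integrable M Y"
  by (rule gaussian_variable_integrable[OF gspan_gaussian(1)])

lemma gspan_integrable_mult:
  assumes "Y \<in> gspan" "Z \<in> gspan"
  shows "integrable M (\<lambda>\<omega>. Y \<omega> * Z \<omega>)"
proof (rule Bochner_Integration.integrable_bound)
  note [measurable] = gspan_measurable[OF assms(1)] gspan_measurable[OF assms(2)]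
  show "integrable M (\<lambda>\<omega>. (Y \<omega>)\<^sup>2 + (Z \<omega>)\<^sup>2)"
    by (intro Bochner_Integration.integrable_add gaussian_variable_integrable gspan_gaussian assms)
  show "AE \<omega> in M. norm (Y \<omega> * Z \<omega>) \<le> norm ((Y \<omega>)\<^sup>2 + (Z \<omega>)\<^sup>2)"
  proof (rule AE_I2)
    fix \<omega>
    have "2 * (\<bar>Y \<omega>\<bar> * \<bar>Z \<omega>\<bar>) \<le> (Y \<omega>)\<^sup>2 + (Z \<omega>)\<^sup>2"
      using sum_squares_bound[of "\<bar>Y \<omega>\<bar>" "\<bar>Z \<omega>\<bar>"] by (simp add: mult.assoc)
    moreover have "0 \<le> \<bar>Y \<omega>\<bar> * \<bar>Z \<omega>\<bar>" by simp
    ultimately have "\<bar>Y \<omega> * Z \<omega>\<bar> \<le> (Y \<omega>)\<^sup>2 + (Z \<omega>)\<^sup>2" unfolding abs_mult by linarith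
    then show "norm (Y \<omega> * Z \<omega>) \<le> norm ((Y \<omega>)\<^sup>2 + (Z \<omega>)\<^sup>2)" by simp
  qed
  show "(\<lambda>\<omega>. Y \<omega> * Z \<omega>) \<in> borel_measurable M" by measurable
qed

definition cov :: "('a \<Rightarrow> real) \<Rightarrow> ('a \<Rightarrow> real) \<Rightarrow> real" where
  "cov Y Z = expectation (\<lambda>\<omega>. Y \<omega> * Z \<omega>)"

lemma cov_commute: "cov Y Z = cov Z Y"
  unfolding cov_def by (simp add: mult.commute)

lemma cov_add_right:
  "Y \<in> gspan \<Longrightarrow> Z \<in> gspan \<Longrightarrow> U \<in> gspan \<Longrightarrow> cov U (\<lambda>\<omega>. Y \<omega> + Z \<omega>) = cov U Y + cov U Z"
  unfolding cov_def distrib_left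
  by (intro Bochner_Integration.integral_add gspan_integrable_mult)

lemma cov_cmult_right: "cov U (\<lambda>\<omega>. c * Y \<omega>) = c * cov U Y"
  unfolding cov_def by (simp add: mult.left_commute)

lemma cov_diff_right:
  "Y \<in> gspan \<Longrightarrow> Z \<in> gspan \<Longrightarrow> U \<in> gspan \<Longrightarrow> cov U (\<lambda>\<omega>. Y \<omega> - Z \<omega>) = cov U Y - cov U Z"
  unfolding cov_def right_diff_distrib
  by (intro Bochner_Integration.integral_diff gspan_integrable_mult)

lemma cov_add_left:
  "Y \<in> gspan \<Longrightarrow> Z \<in> gspan \<Longrightarrow> U \<in> gspan \<Longrightarrow> cov (\<lambda>\<omega>. Y \<omega> + Z \<omega>) U = cov Y U + cov Z U"
  using cov_add_right cov_commute by metis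

lemma cov_cmult_left: "cov (\<lambda>\<omega>. c * Y \<omega>) U = c * cov Y U"
  using cov_cmult_right cov_commute by metis

lemma cov_diff_left:
  "Y \<in> gspan \<Longrightarrow> Z \<in> gspan \<Longrightarrow> U \<in> gspan \<Longrightarrow> cov (\<lambda>\<omega>. Y \<omega> - Z \<omega>) U = cov Y U - cov Z U"
  using cov_diff_right cov_commute by metis

lemma char_gspan: "Y \<in> gspan \<Longrightarrow> (CLINT \<omega>|M. iexp (Y \<omega>)) = complex_of_real (exp (- cov Y Y / 2))"
  using gaussian_variable_char[OF gspan_gaussian] by (simp add: cov_def power2_eq_square)

lemma cov_affine_square:
  assumes [simp]: "Y \<in> gspan" "V \<in> gspan"
  shows "cov (\<lambda>\<omega>. Y \<omega> + y * V \<omega>) (\<lambda>\<omega>. Y \<omega> + y * V \<omega>) = cov Y Y + 2 * y * cov Y V + y\<^sup>2 * cov V V"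
  by (simp add: cov_add_left cov_add_right cov_cmult_left cov_cmult_right gspan_add gspan_cmult
      cov_commute[of V Y] power2_eq_square algebra_simps)

text \<open>Gaussian integration by parts: the characteristic function of Y + y U, whose exponent is
  quadratic in y by \<open>cov_affine_square\<close>, is differentiated at y = 0.\<close>

lemma expectation_linear_iexp:
  assumes U [simp]: "U \<in> gspan" and Y [simp]: "Y \<in> gspan"
  shows "(CLINT \<omega>|M. U \<omega> * iexp (Y \<omega>)) = \<i> * complex_of_real (cov U Y * exp (- cov Y Y / 2))"
proof -
  note [measurable] = gspan_measurable[OF U] gspan_measurable[OF Y]
  have "(CLINT \<omega>|M. \<i> * (iexp (Y \<omega>) * U \<omega>)) = - complex_of_real (cov U Y * exp (- cov Y Y / 2))"
  proof (rule diff_under_expectation)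
    show "integrable M (\<lambda>\<omega>. iexp (Y \<omega>))" by (rule integrable_iexp) simp_all
    show "integrable M (\<lambda>\<omega>. iexp (Y \<omega>) * complex_of_real (U \<omega>))"
      by (rule Bochner_Integration.integrable_bound[OF gspan_integrable[OF U]]) (auto simp: norm_mult)
    show "(CLINT \<omega>|M. iexp (Y \<omega>) * iexp (y * U \<omega>))
        = complex_of_real (exp (- (cov Y Y + 2 * y * cov U Y + y\<^sup>2 * cov U U) / 2))" for y
      using char_gspan[OF gspan_add[OF Y gspan_cmult[OF U, of y]]]
      by (simp add: cov_affine_square cov_commute[of Y U] exp_add[symmetric] algebra_simps)
    show "((\<lambda>y. complex_of_real (exp (- (cov Y Y + 2 * y * cov U Y + y\<^sup>2 * cov U U) / 2)))
        has_vector_derivative - complex_of_real (cov U Y * exp (- cov Y Y / 2))) (at 0)"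
      unfolding of_real_minus[symmetric] of_real_mult[symmetric]
      by (rule has_vector_derivative_of_real)
         (auto intro!: derivative_eq_intros simp flip: has_real_derivative_iff_has_vector_derivative)
  qed simp
  then have "\<i> * (CLINT \<omega>|M. U \<omega> * iexp (Y \<omega>)) = - complex_of_real (cov U Y * exp (- cov Y Y / 2))"
    by (simp add: mult.commute)
  then have "\<i> * (\<i> * (CLINT \<omega>|M. U \<omega> * iexp (Y \<omega>))) = \<i> * (- complex_of_real (cov U Y * exp (- cov Y Y / 2)))"
    by simp
  then show ?thesis by (simp add: mult.assoc[symmetric])
qed

text \<open>One more derivative, now of the linear formula at Y + y V. It hits the covariance
  factor, giving \<open>cov U V\<close>, and the exponential, giving the product of covariances; the
  minus sign is i squared.\<close>

lemma expectation_bilinear_iexp: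
  assumes U [simp]: "U \<in> gspan" and V [simp]: "V \<in> gspan" and Y [simp]: "Y \<in> gspan"
  shows "(CLINT \<omega>|M. U \<omega> * V \<omega> * iexp (Y \<omega>)) =
    complex_of_real ((cov U V - cov U Y * cov V Y) * exp (- cov Y Y / 2))"
proof -
  note [measurable] = gspan_measurable[OF U] gspan_measurable[OF Y] gspan_measurable[OF V]
  let ?R = "(cov U V - cov U Y * cov V Y) * exp (- cov Y Y / 2)"
  have "(CLINT \<omega>|M. \<i> * ((U \<omega> * iexp (Y \<omega>)) * V \<omega>)) = \<i> * complex_of_real ?R"
  proof (rule diff_under_expectation)
    show "integrable M (\<lambda>\<omega>. U \<omega> * iexp (Y \<omega>))"
      by (rule Bochner_Integration.integrable_bound[OF gspan_integrable[OF U]]) (auto simp: norm_mult)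
    show "integrable M (\<lambda>\<omega>. U \<omega> * iexp (Y \<omega>) * complex_of_real (V \<omega>))"
      by (rule Bochner_Integration.integrable_bound[OF gspan_integrable_mult[OF U V]])
        (auto simp: norm_mult abs_mult)
    show "(CLINT \<omega>|M. U \<omega> * iexp (Y \<omega>) * iexp (y * V \<omega>))
        = \<i> * complex_of_real ((cov U Y + y * cov U V) * exp (- (cov Y Y + 2 * y * cov Y V + y\<^sup>2 * cov V V) / 2))" for y
      using expectation_linear_iexp[OF U gspan_add[OF Y gspan_cmult[OF V, of y]]]
      by (simp add: cov_affine_square cov_add_right cov_cmult_right gspan_cmult exp_add[symmetric] algebra_simps)
    show "((\<lambda>y. \<i> * complex_of_real ((cov U Y + y * cov U V) * exp (- (cov Y Y + 2 * y * cov Y V + y\<^sup>2 * cov V V) / 2)))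
        has_vector_derivative \<i> * complex_of_real ?R) (at 0)"
      by (intro has_vector_derivative_mult_right has_vector_derivative_of_real)
         (auto intro!: derivative_eq_intros simp: algebra_simps cov_commute[of Y V] simp flip: has_real_derivative_iff_has_vector_derivative)
  qed simp
  then have "\<i> * (CLINT \<omega>|M. U \<omega> * V \<omega> * iexp (Y \<omega>)) = \<i> * complex_of_real ?R"
    by (simp add: mult_ac)
  then show ?thesis by (simp only: mult_cancel_left) simp
qed

end

section \<open>Fourier representation of smooth functions\<close>

text \<open>The derivative is an existential witness instead of an iterated \<open>deriv\<close>, so
  closure under sums, products and affine substitutions follows by induction from the derivative
  rules. \<open>Ck_on_imp_ck\<close> makes the connection with \<open>Ck_on\<close>.\<close>

primrec ck :: "nat \<Rightarrow> (real \<Rightarrow> real) \<Rightarrow> bool" where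
  "ck 0 f \<longleftrightarrow> continuous_on UNIV f"
| "ck (Suc k) f \<longleftrightarrow> (\<exists>f'. (\<forall>x. (f has_real_derivative f' x) (at x)) \<and> ck k f')"

lemma ck_imp_continuous: "ck k f \<Longrightarrow> continuous_on UNIV f"
proof (cases k)
  case (Suc j)
  moreover assume "ck k f"
  ultimately obtain f' where "\<And>x. (f has_real_derivative f' x) (at x)" by auto
  then show ?thesis by (intro continuous_at_imp_continuous_on ballI) (rule DERIV_continuous)
qed simp

lemma ck_SucD: "ck (Suc k) f \<Longrightarrow> ck k f"
proof (induction k arbitrary: f)
  case 0
  then show ?case using ck_imp_continuous[of "Suc 0" f] by simp
next
  case (Suc k)
  then obtain f' where "\<And>x. (f has_real_derivative f' x) (at x)" "ck (Suc k) f'" by auto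
  with Suc.IH[of f'] show ?case by auto
qed

lemma ck_le: "ck k f \<Longrightarrow> j \<le> k \<Longrightarrow> ck j f"
proof (induction k)
  case (Suc k)
  then show ?case using ck_SucD[of k f] by (cases "j = Suc k") simp_all
qed simp

lemma ck_add: "ck k f \<Longrightarrow> ck k g \<Longrightarrow> ck k (\<lambda>x. f x + g x)"
proof (induction k arbitrary: f g)
  case (Suc k)
  then obtain f' g' where "\<And>x. (f has_real_derivative f' x) (at x)" "ck k f'"
    "\<And>x. (g has_real_derivative g' x) (at x)" "ck k g'" by auto
  with Suc.IH[of f' g'] show ?case
    by (auto intro!: exI[of _ "\<lambda>x. f' x + g' x"] derivative_intros)
qed (auto intro!: continuous_intros)

lemma ck_mult: "ck k f \<Longrightarrow> ck k g \<Longrightarrow> ck k (\<lambda>x. f x * g x)"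
proof (induction k arbitrary: f g)
  case (Suc k)
  then obtain f' g' where "\<And>x. (f has_real_derivative f' x) (at x)" "ck k f'"
    "\<And>x. (g has_real_derivative g' x) (at x)" "ck k g'" by auto
  moreover have "ck k f" "ck k g" using Suc.prems by (auto intro: ck_SucD simp del: ck.simps)
  ultimately show ?case using Suc.IH[of f' g] Suc.IH[of f g']
    by (auto intro!: exI[of _ "\<lambda>x. f' x * g x + f x * g' x"] ck_add derivative_eq_intros)
qed (auto intro!: continuous_intros)

lemma ck_const: "ck k (\<lambda>x. c)"
proof (induction k arbitrary: c)
  case (Suc k)
  show ?case unfolding ck.simps by (rule exI[of _ "\<lambda>_. 0"]) (simp add: Suc)
qed simp

lemma ck_affine: "ck k f \<Longrightarrow> ck k (\<lambda>x. f (a * x + b))"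
proof (induction k arbitrary: f)
  case (Suc k)
  then obtain f' where f': "\<And>x. (f has_real_derivative f' x) (at x)" "ck k f'" by auto
  have "((\<lambda>x. f (a * x + b)) has_real_derivative a * f' (a * x + b)) (at x)" for x
    by (rule DERIV_chain2[OF f'(1), THEN DERIV_cong]) (auto intro!: derivative_eq_intros)
  then show ?case
    using ck_mult[OF ck_const[of k a] Suc.IH[OF f'(2)]]
    by (auto intro!: exI[of _ "\<lambda>x. a * f' (a * x + b)"])
next
  case 0
  then have "continuous_on UNIV (f \<circ> (\<lambda>x. a * x + b))"
    by (intro continuous_on_compose continuous_intros) (auto intro: continuous_on_subset)
  then show ?case by (simp add: o_def)
qed

section \<open>Step and cutoff functions of finite smoothness\<close>

lemma DERIV_pos_part_power:
  "((\<lambda>x. (max 0 x) ^ Suc (Suc m)) has_real_derivative real (Suc (Suc m)) * (max 0 x) ^ Suc m) (at x)"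
proof -
  consider "x < 0" | "x > 0" | "x = 0" by linarith
  then show ?thesis
  proof cases
    case 1
    have "((\<lambda>x. 0) has_real_derivative 0) (at x)" by simp
    then have "((\<lambda>x. (max 0 x) ^ Suc (Suc m)) has_real_derivative 0) (at x)"
      by (rule has_field_derivative_transform_within_open[of _ _ _ "{..<0}"]) (use 1 in auto)
    with 1 show ?thesis by simp
  next
    case 2
    have "((\<lambda>x. x ^ Suc (Suc m)) has_real_derivative real (Suc (Suc m)) * x ^ Suc m) (at x)"
      using DERIV_pow[of "Suc (Suc m)" x] by simp
    then have "((\<lambda>x. (max 0 x) ^ Suc (Suc m)) has_real_derivative real (Suc (Suc m)) * x ^ Suc m) (at x)"
      by (rule has_field_derivative_transform_within_open[of _ _ _ "{0<..}"]) (use 2 in auto)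
    with 2 show ?thesis by simp
  next
    case 3
    have "((\<lambda>h. ((max 0 (0 + h)) ^ Suc (Suc m) - (max 0 0) ^ Suc (Suc m)) / h) \<longlongrightarrow> 0) (at (0::real))"
    proof (rule Lim_null_comparison)
      show "\<forall>\<^sub>F h in at (0::real). norm (((max 0 (0 + h)) ^ Suc (Suc m) - (max 0 0) ^ Suc (Suc m)) / h) \<le> \<bar>h\<bar> ^ Suc m"
      proof (intro always_eventually allI)
        fix h :: real
        show "norm (((max 0 (0 + h)) ^ Suc (Suc m) - (max 0 0) ^ Suc (Suc m)) / h) \<le> \<bar>h\<bar> ^ Suc m"
          by (cases "h > 0") (simp_all add: max_def mult_nonpos_nonneg)
      qed
      show "((\<lambda>h. \<bar>h\<bar> ^ Suc m) \<longlongrightarrow> 0) (at (0::real))"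
      proof -
        have "((\<lambda>h. \<bar>h\<bar> ^ Suc m) \<longlongrightarrow> \<bar>0\<bar> ^ Suc m) (at (0::real))"
          by (rule tendsto_power[OF tendsto_rabs[OF tendsto_ident_at]])
        then show ?thesis by simp
      qed
    qed
    then show ?thesis using 3 by (simp add: DERIV_def)
  qed
qed

lemma ck_pos_part_power: "ck m (\<lambda>x. (max 0 x) ^ Suc m)"
proof (induction m)
  case 0
  show ?case by (auto intro!: continuous_intros)
next
  case (Suc m)
  then show ?case
    using DERIV_pos_part_power[of m] ck_mult[OF ck_const[of m "real (Suc (Suc m))"] Suc]
    by (auto simp del: power_Suc of_nat_Suc
        intro!: exI[of _ "\<lambda>x. real (Suc (Suc m)) * (max 0 x) ^ Suc m"])
qed

text \<open>Finite smoothness suffices, so s can be taken as the normalized primitive of the (k +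
  1)-st power of the positive part of x times that of 1 - x; no bump function of infinite order is
  involved.\<close>

lemma ck_step_function:
  obtains s where "ck k s" "\<And>x. x \<le> 0 \<Longrightarrow> s x = 0" "\<And>x. x \<ge> 1 \<Longrightarrow> s x = 1"
proof -
  define r where "r x = (max 0 x) ^ Suc k * (max 0 (- 1 * x + 1)) ^ Suc k" for x :: real
  have r: "ck k r"
    unfolding r_def
    by (intro ck_mult ck_pos_part_power ck_affine[of k "\<lambda>x. (max 0 x) ^ Suc k" "-1" 1])
  have "isCont r x" for x
    using ck_imp_continuous[OF r] by (simp add: continuous_on_eq_continuous_at)
  then obtain S where S: "\<And>x. (S has_real_derivative r x) (at x)"
    using einterval_antiderivative[of "-\<infinity>" "\<infinity>" r]
    by (auto simp: has_real_derivative_iff_has_vector_derivative)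
  have "S 0 < S 1"
  proof (rule DERIV_pos_imp_increasing_open[of 0 1])
    fix x :: real assume "0 < x" "x < 1"
    then have "r x > 0" by (simp add: r_def)
    then show "\<exists>y. (S has_real_derivative y) (at x) \<and> y > 0" using S by blast
  next
    show "continuous_on {0..1} S"
      by (intro continuous_at_imp_continuous_on ballI DERIV_continuous[OF S])
  qed simp
  have zero: "S x = S 0" if "x \<le> 0" for x
  proof (cases "x = 0")
    case False
    with that have "x < 0" by simp
    have "S 0 = S x"
    proof (rule DERIV_isconst2[OF \<open>x < 0\<close>, of S 0])
      show "continuous_on {x..0} S"
        by (intro continuous_at_imp_continuous_on ballI DERIV_continuous[OF S])
      fix z :: real assume "x < z" "z < 0"
      then have "r z = 0" by (simp add: r_def)
      then show "(S has_real_derivative 0) (at z)" using S[of z] by simp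
    qed (use that in auto)
    then show ?thesis by simp
  qed simp
  have one: "S x = S 1" if "x \<ge> 1" for x
  proof (cases "x = 1")
    case False
    with that have "1 < x" by simp
    have "S x = S 1"
    proof (rule DERIV_isconst2[OF \<open>1 < x\<close>, of S x])
      show "continuous_on {1..x} S"
        by (intro continuous_at_imp_continuous_on ballI DERIV_continuous[OF S])
      fix z :: real assume "1 < z" "z < x"
      then have "r z = 0" by (simp add: r_def)
      then show "(S has_real_derivative 0) (at z)" using S[of z] by simp
    qed (use that in auto)
    then show ?thesis .
  qed simp
  define c where "c = 1 / (S 1 - S 0)"
  have "ck k (\<lambda>x. c * (S x + - S 0))"
  proof -
    have "ck (Suc k) S" using S r unfolding ck.simps by blast
    then show ?thesis by (intro ck_mult ck_add ck_const) (rule ck_SucD)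
  qed
  then show ?thesis
  proof (rule that)
    fix x :: real
    show "c * (S x + - S 0) = 0" if "x \<le> 0" using zero[OF that] by simp
    show "c * (S x + - S 0) = 1" if "x \<ge> 1" using one[OF that] \<open>S 0 < S 1\<close> by (simp add: c_def)
  qed
qed

text \<open>The cutoff factor is s (R + 1 - x) s (R + 1 + x): both are 1 on [-R, R], and one of them
  vanishes as soon as |x| \<ge> R + 1.\<close>

lemma ck_cutoff:
  assumes "ck k g"
  obtains h where "ck k h" "\<And>x. \<bar>x\<bar> \<le> R \<Longrightarrow> h x = g x" "\<And>x. \<bar>x\<bar> \<ge> R + 1 \<Longrightarrow> h x = 0"
proof -
  obtain s where s: "ck k s" "\<And>x. x \<le> 0 \<Longrightarrow> s x = 0" "\<And>x. x \<ge> 1 \<Longrightarrow> s x = 1"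
    using ck_step_function[of k] by blast
  show ?thesis
  proof (rule that)
    show "ck k (\<lambda>x. g x * (s (- 1 * x + (R + 1)) * s (1 * x + (R + 1))))"
      by (rule ck_mult[OF assms ck_mult[OF ck_affine[OF s(1)] ck_affine[OF s(1)]]])
    fix x
    show "\<bar>x\<bar> \<le> R \<Longrightarrow> g x * (s (- 1 * x + (R + 1)) * s (1 * x + (R + 1))) = g x"
      by (simp add: s(3))
    assume "\<bar>x\<bar> \<ge> R + 1"
    then consider "x \<ge> R + 1" | "x \<le> - R - 1" by linarith
    then show "g x * (s (- 1 * x + (R + 1)) * s (1 * x + (R + 1))) = 0"
      by cases (simp_all add: s(2))
  qed
qed

section \<open>Fourier transforms of compactly supported functions\<close>

definition ft :: "(real \<Rightarrow> real) \<Rightarrow> real \<Rightarrow> complex" where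
  "ft h u = (CLINT y|lborel. h y * iexp (- (u * y)))"

lemma integrable_compact_support:
  fixes h :: "real \<Rightarrow> real"
  assumes h: "continuous_on UNIV h" and supp: "\<And>x. \<bar>x\<bar> > L \<Longrightarrow> h x = 0"
  shows "integrable lborel h"
proof -
  have "set_integrable lborel {-L..L} h"
    by (rule borel_integrable_atLeastAtMost') (rule continuous_on_subset[OF h], simp)
  moreover have "(\<lambda>x. indicator {-L..L} x *\<^sub>R h x) = h"
  proof
    fix x
    show "indicator {-L..L} x *\<^sub>R h x = h x"
    proof (cases "\<bar>x\<bar> > L")
      case False
      then have "x \<in> {-L..L}" by auto
      then show ?thesis by simp
    qed (simp add: supp)
  qed
  ultimately show ?thesis by (simp add: set_integrable_def)
qed

lemma integrable_mult_iexp: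
  fixes h :: "real \<Rightarrow> real"
  assumes "integrable M h" and [measurable]: "k \<in> borel_measurable M"
  shows "integrable M (\<lambda>y. complex_of_real (h y) * iexp (k y))"
proof -
  have [measurable]: "h \<in> borel_measurable M" using assms by auto
  show ?thesis
    by (rule Bochner_Integration.integrable_bound[OF assms(1)]) (auto simp: norm_mult)
qed

lemma norm_ft_le: "integrable lborel h \<Longrightarrow> norm (ft h u) \<le> (LINT y|lborel. \<bar>h y\<bar>)"
proof -
  have "norm (ft h u) \<le> (LINT y|lborel. norm (complex_of_real (h y) * iexp (- (u * y))))"
    unfolding ft_def by (rule integral_norm_bound)
  then show ?thesis by (simp add: norm_mult)
qed

lemma ft_measurable: 
  assumes h: "continuous_on UNIV h"
  shows "ft h \<in> borel_measurable borel"
proof -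
  have [measurable]: "h \<in> borel_measurable borel" using h by (rule borel_measurable_continuous_onI)
  have "(\<lambda>u. CLINT y|lborel. h y * iexp (- (u * y))) \<in> borel_measurable borel"
    by (rule lborel.borel_measurable_lebesgue_integral) measurable
  then show ?thesis unfolding ft_def[abs_def] .
qed

lemma ft_deriv:
  assumes h: "\<And>x. (h has_real_derivative h' x) (at x)" and h': "continuous_on UNIV h'"
    and supp: "\<And>x. \<bar>x\<bar> > L \<Longrightarrow> h x = 0" and L: "L > 0"
  shows "ft h' u = \<i> * u * ft h u" and "\<And>x. \<bar>x\<bar> > L \<Longrightarrow> h' x = 0"
proof -
  show supp': "h' x = 0" if "\<bar>x\<bar> > L" for x
  proof -
    have "((\<lambda>x. 0) has_real_derivative 0) (at x)" by simp
    then have "(h has_real_derivative 0) (at x)"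
      by (rule has_field_derivative_transform_within_open[of _ _ _ "{x. \<bar>x\<bar> > L}"])
         (use that supp in \<open>auto intro!: open_Collect_less continuous_intros\<close>)
    then show ?thesis using h DERIV_unique by blast
  qed
  have hc: "continuous_on UNIV h"
    by (intro continuous_at_imp_continuous_on ballI) (rule DERIV_continuous[OF h])
  have i: "integrable lborel h" by (rule integrable_compact_support[OF hc supp])
  have i': "integrable lborel h'" by (rule integrable_compact_support[OF h' supp'])
  \<comment> \<open>The support condition says nothing at L itself, so the integration by parts uses
    the interval [-L - 1, L + 1], at whose ends h is known to vanish.\<close>
  define L' where "L' = L + 1"
  define F where "F y = complex_of_real (h y) * iexp (- (u * y))" for y
  define F' where "F' y = complex_of_real (h' y) * iexp (- (u * y)) - \<i> * u * (h y * iexp (- (u * y)))" for y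
  have dF: "(F has_vector_derivative F' y) (at y within S)" for y S
  proof -
    have "((\<lambda>z. exp (- \<i> * (u * z))) has_field_derivative (- \<i> * u * exp (- \<i> * (u * y)))) (at (of_real y))"
      by (auto intro!: derivative_eq_intros)
    from has_vector_derivative_real_field[OF this]
    have "((\<lambda>y. iexp (- (u * y))) has_vector_derivative (- \<i> * u * iexp (- (u * y)))) (at y within S)"
      by simp
    moreover have "((\<lambda>y. complex_of_real (h y)) has_vector_derivative complex_of_real (h' y)) (at y within S)"
      by (intro has_vector_derivative_of_real has_vector_derivative_at_within)
         (use h in \<open>simp add: has_real_derivative_iff_has_vector_derivative\<close>)
    ultimately have "(F has_vector_derivative (h y * (- \<i> * u * iexp (- (u * y))) + h' y * iexp (- (u * y)))) (at y within S)"
      unfolding F_def by (rule has_vector_derivative_mult[rotated])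
    then show ?thesis by (simp add: F'_def algebra_simps)
  qed
  have "continuous_on {-L'..L'} F'"
    unfolding F'_def by (intro continuous_intros continuous_on_subset[OF h'] continuous_on_subset[OF hc]) auto
  then have "(CLINT y|lborel. indicator {-L'..L'} y *\<^sub>R F' y) = F L' - F (- L')"
    using L by (intro integral_FTC_atLeastAtMost dF) (auto simp: L'_def)
  also have "\<dots> = 0" using L by (simp add: F_def L'_def supp)
  also have "(CLINT y|lborel. indicator {-L'..L'} y *\<^sub>R F' y) = (CLINT y|lborel. F' y)"
  proof (rule Bochner_Integration.integral_cong)
    fix y show "indicator {-L'..L'} y *\<^sub>R F' y = F' y"
    proof (cases "\<bar>y\<bar> > L")
      case True
      then show ?thesis by (simp add: F'_def supp supp')
    next
      case False
      then have "y \<in> {-L'..L'}" by (auto simp: L'_def)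
      then show ?thesis by simp
    qed
  qed simp
  also have "\<dots> = ft h' u - \<i> * u * ft h u"
  proof -
    have A: "integrable lborel (\<lambda>y. complex_of_real (h y) * iexp (- (u * y)))"
      by (intro integrable_mult_iexp i) measurable
    have B: "integrable lborel (\<lambda>y. complex_of_real (h' y) * iexp (- (u * y)))"
      by (intro integrable_mult_iexp i') measurable
    show ?thesis
      unfolding F'_def ft_def
      by (subst Bochner_Integration.integral_diff[OF B integrable_mult_right[OF A]])
        (simp only: integral_mult_right_zero)
  qed
  finally show "ft h' u = \<i> * u * ft h u" by simp
qed

lemma ft_decay:
  assumes "ck k h" and "\<And>x. \<bar>x\<bar> > L \<Longrightarrow> h x = 0" and L: "L > 0"
  shows "\<exists>C. \<forall>u. \<bar>u\<bar> ^ k * norm (ft h u) \<le> C"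
  using assms(1,2)
proof (induction k arbitrary: h)
  case 0
  then show ?case
    using norm_ft_le[OF integrable_compact_support[of h L]] by auto
next
  case (Suc k)
  then obtain h' where h': "\<And>x. (h has_real_derivative h' x) (at x)" "ck k h'" by auto
  note d = ft_deriv[OF h'(1) ck_imp_continuous[OF h'(2)] Suc.prems(2) L]
  obtain C where "\<And>u. \<bar>u\<bar> ^ k * norm (ft h' u) \<le> C"
    using Suc.IH[OF h'(2) d(2)] by blast
  then have *: "\<bar>u\<bar> ^ k * norm (ft h' u) \<le> C" for u .
  have "\<bar>u\<bar> ^ Suc k * norm (ft h u) \<le> C" for u
  proof -
    have E: "\<bar>u\<bar> ^ Suc k * norm (ft h u) = \<bar>u\<bar> ^ k * norm (ft h' u)"
      by (simp add: d(1) norm_mult)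
    show ?thesis by (rule order.trans[OF eq_refl[OF E] *])
  qed
  then show ?case by blast
qed

lemma integrable_inverse_one_plus_square: "integrable lborel (\<lambda>u::real. 1 / (1 + u\<^sup>2))"
  using Sinc_Integral.integrable_inverse_1_plus_square
  by (simp add: set_integrable_def inverse_eq_divide einterval_def)

lemma integrable_of_decay:
  fixes G :: "real \<Rightarrow> complex"
  assumes [measurable]: "G \<in> borel_measurable borel" and C: "0 \<le> C" and m: "1 \<le> m"
    and bound: "\<And>u. norm (G u) \<le> C / (1 + u\<^sup>2) ^ m"
  shows "integrable lborel G"
proof (rule Bochner_Integration.integrable_bound[OF integrable_mult_right[OF integrable_inverse_one_plus_square, of C]])
  show "AE u in lborel. norm (G u) \<le> norm (C * (1 / (1 + u\<^sup>2)))"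
  proof (rule AE_I2)
    fix u :: real
    have "(1 + u\<^sup>2) ^ 1 \<le> (1 + u\<^sup>2) ^ m" using m by (intro power_increasing) auto
    then have "C / (1 + u\<^sup>2) ^ m \<le> C / (1 + u\<^sup>2)"
      using C by (intro divide_left_mono mult_pos_pos zero_less_power) (auto simp: add_pos_nonneg)
    with bound[of u] show "norm (G u) \<le> norm (C * (1 / (1 + u\<^sup>2)))" using C by simp
  qed
qed simp

text \<open>Plain boundedness and decay of order 2m combine through (1 + u^2)^m \<le> 2^m (1 +
  |u|^(2m)), which is checked separately for u^2 \<le> 1 and u^2 > 1.\<close>

lemma ft_bound:
  assumes h: "ck (2 * m) h" and supp: "\<And>x. \<bar>x\<bar> > L \<Longrightarrow> h x = 0" and L: "L > 0"
  obtains C where "\<And>u. norm (ft h u) \<le> C / (1 + u\<^sup>2) ^ m" "C \<ge> 0"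
proof -
  obtain C1 where C1: "\<And>u. \<bar>u\<bar> ^ (2 * m) * norm (ft h u) \<le> C1"
    using ft_decay[OF h supp L] by blast
  obtain C0 where C0: "\<And>u. norm (ft h u) \<le> C0"
    using norm_ft_le[OF integrable_compact_support[OF ck_imp_continuous[OF h] supp]] by blast
  have C0_nonneg: "0 \<le> C0" using C0[of 0] norm_ge_zero order.trans by blast
  have C1_nonneg: "0 \<le> C1" by (rule order.trans[OF _ C1[of 0]]) simp
  show ?thesis
  proof (rule that)
    fix u :: real
    have "(1 + u\<^sup>2) ^ m \<le> 2 ^ m * (1 + \<bar>u\<bar> ^ (2 * m))"
    proof (cases "u\<^sup>2 \<le> 1")
      case True
      then have "(1 + u\<^sup>2) ^ m \<le> 2 ^ m" by (intro power_mono) auto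
      also have "\<dots> \<le> 2 ^ m * (1 + \<bar>u\<bar> ^ (2 * m))" by simp
      finally show ?thesis .
    next
      case False
      then have "(1 + u\<^sup>2) ^ m \<le> (2 * u\<^sup>2) ^ m" by (intro power_mono) auto
      also have "\<dots> = 2 ^ m * \<bar>u\<bar> ^ (2 * m)" by (simp add: power_mult_distrib power_mult)
      also have "\<dots> \<le> 2 ^ m * (1 + \<bar>u\<bar> ^ (2 * m))" by simp
      finally show ?thesis .
    qed
    then have "(1 + u\<^sup>2) ^ m * norm (ft h u) \<le> 2 ^ m * (1 + \<bar>u\<bar> ^ (2 * m)) * norm (ft h u)"
      by (rule mult_right_mono) simp
    also have "\<dots> = 2 ^ m * (norm (ft h u) + \<bar>u\<bar> ^ (2 * m) * norm (ft h u))"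
      by (simp add: algebra_simps)
    also have "\<dots> \<le> 2 ^ m * (C0 + C1)"
      by (intro mult_left_mono add_mono C0 C1) simp
    finally show "norm (ft h u) \<le> 2 ^ m * (C0 + C1) / (1 + u\<^sup>2) ^ m"
      by (simp add: field_simps add_pos_nonneg)
  next
    show "0 \<le> 2 ^ m * (C0 + C1)" using C0_nonneg C1_nonneg by simp
  qed
qed

section \<open>Fourier inversion by Gaussian regularization\<close>

lemma gaussian_integral_iexp:
  assumes e: "e > 0"
  shows "(CLINT u|lborel. complex_of_real (exp (- (e * u)\<^sup>2 / 2)) * iexp (u * z))
    = complex_of_real (sqrt (2 * pi) / e * exp (- (z / e)\<^sup>2 / 2))"
proof -
  have "(CLINT u|lborel. std_normal_density u *\<^sub>R iexp (z / e * u)) = char std_normal_distribution (z / e)"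
    unfolding char_def by (subst integral_density) auto
  also have "\<dots> = complex_of_real (exp (- (z / e)\<^sup>2 / 2))" by (simp add: char_std_normal_distribution)
  finally have 1: "(CLINT u|lborel. std_normal_density u *\<^sub>R iexp (z / e * u)) = complex_of_real (exp (- (z / e)\<^sup>2 / 2))" .
  have "(CLINT u|lborel. std_normal_density u *\<^sub>R iexp (z / e * u))
      = \<bar>e\<bar> *\<^sub>R (CLINT u|lborel. std_normal_density (0 + e * u) *\<^sub>R iexp (z / e * (0 + e * u)))"
    using e by (intro lborel_integral_real_affine) simp
  also have "\<dots> = \<bar>e\<bar> *\<^sub>R (CLINT u|lborel. complex_of_real (1 / sqrt (2 * pi)) * (complex_of_real (exp (- (e * u)\<^sup>2 / 2)) * iexp (u * z)))"
    using e by (simp add: std_normal_density_def scaleR_conv_of_real mult_ac)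
  also have "\<dots> = complex_of_real (e / sqrt (2 * pi)) * (CLINT u|lborel. complex_of_real (exp (- (e * u)\<^sup>2 / 2)) * iexp (u * z))"
    using e by (subst integral_mult_right_zero) (simp add: scaleR_conv_of_real)
  finally have "complex_of_real (exp (- (z / e)\<^sup>2 / 2)) = complex_of_real (e / sqrt (2 * pi)) * (CLINT u|lborel. complex_of_real (exp (- (e * u)\<^sup>2 / 2)) * iexp (u * z))"
    using 1 by simp
  then show ?thesis using e by (simp add: field_simps)
qed

text \<open>The Gaussian factor makes the double integral absolutely convergent. After exchanging
  the integrals the inner one is a Gaussian in (x - y) / e, and the substitution y = x + e z turns
  the outer one into an average of h around x.\<close>

lemma fourier_inversion_smoothed:
  assumes h: "continuous_on UNIV h" and supp: "\<And>x. \<bar>x\<bar> > L \<Longrightarrow> h x = 0" and e: "e > 0"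
  shows "(CLINT u|lborel. complex_of_real (exp (- (e * u)\<^sup>2 / 2)) * iexp (u * x) * ft h u)
    = 2 * pi * (LINT z|lborel. h (x + e * z) * std_normal_density z)"
proof -
  have [measurable]: "h \<in> borel_measurable borel" using h by (rule borel_measurable_continuous_onI)
  have ih: "integrable lborel h" by (rule integrable_compact_support[OF h supp])
  have ig: "integrable lborel (\<lambda>u. exp (- (e * u)\<^sup>2 / 2))"
  proof -
    have "integrable lborel (\<lambda>u. sqrt (2 * pi) * std_normal_density (0 + e * u))"
      using e by (intro integrable_mult_right lborel_integrable_real_affine integrable_normal_density) auto
    then show ?thesis by (simp add: std_normal_density_def)
  qed
  let ?F = "\<lambda>u y. complex_of_real (exp (- (e * u)\<^sup>2 / 2)) * iexp (u * x) * (h y * iexp (- (u * y)))"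
  have int2: "integrable (lborel \<Otimes>\<^sub>M lborel) (\<lambda>(u, y). ?F u y)"
  proof (rule lborel_pair.Fubini_integrable)
    show "(\<lambda>(u, y). ?F u y) \<in> borel_measurable (lborel \<Otimes>\<^sub>M lborel)" by measurable
    show "integrable lborel (\<lambda>u. LINT y|lborel. norm (case (u, y) of (u, y) \<Rightarrow> ?F u y))"
      using ig by (simp add: norm_mult)
    show "AE u in lborel. integrable lborel (\<lambda>y. case (u, y) of (u, y) \<Rightarrow> ?F u y)"
      unfolding prod.case by (intro AE_I2 integrable_mult_right integrable_mult_iexp ih) measurable
  qed
  have "(CLINT u|lborel. complex_of_real (exp (- (e * u)\<^sup>2 / 2)) * iexp (u * x) * ft h u) = (CLINT u|lborel. CLINT y|lborel. ?F u y)"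
    unfolding ft_def by (simp only: integral_mult_right_zero)
  also have "\<dots> = (CLINT y|lborel. CLINT u|lborel. ?F u y)"
    by (rule lborel_pair.Fubini_integral[symmetric]) (rule int2)
  also have "\<dots> = (CLINT y|lborel. complex_of_real (h y * (sqrt (2 * pi) / e * exp (- ((x - y) / e)\<^sup>2 / 2))))"
  proof (intro Bochner_Integration.integral_cong refl)
    fix y
    have "(CLINT u|lborel. ?F u y) = (CLINT u|lborel. complex_of_real (h y) * (complex_of_real (exp (- (e * u)\<^sup>2 / 2)) * iexp (u * (x - y))))"
      by (intro Bochner_Integration.integral_cong refl) (simp add: right_diff_distrib exp_diff exp_minus field_simps)
    also have "\<dots> = complex_of_real (h y * (sqrt (2 * pi) / e * exp (- ((x - y) / e)\<^sup>2 / 2)))"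
      unfolding integral_mult_right_zero gaussian_integral_iexp[OF e] by (simp only: of_real_mult)
    finally show "(CLINT u|lborel. ?F u y) = complex_of_real (h y * (sqrt (2 * pi) / e * exp (- ((x - y) / e)\<^sup>2 / 2)))" .
  qed
  also have "\<dots> = complex_of_real (LINT y|lborel. h y * (sqrt (2 * pi) / e * exp (- ((x - y) / e)\<^sup>2 / 2)))"
    by (rule integral_complex_of_real)
  also have "(LINT y|lborel. h y * (sqrt (2 * pi) / e * exp (- ((x - y) / e)\<^sup>2 / 2)))
     = \<bar>e\<bar> *\<^sub>R (LINT z|lborel. h (x + e * z) * (sqrt (2 * pi) / e * exp (- ((x - (x + e * z)) / e)\<^sup>2 / 2)))"
    using e by (intro lborel_integral_real_affine) simp
  also have "\<dots> = (LINT z|lborel. e * (h (x + e * z) * (sqrt (2 * pi) / e * exp (- ((x - (x + e * z)) / e)\<^sup>2 / 2))))"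
    using e by simp
  also have "\<dots> = (LINT z|lborel. 2 * pi * (h (x + e * z) * std_normal_density z))"
  proof (intro Bochner_Integration.integral_cong refl)
    fix z
    have "2 * pi * (h (x + e * z) * std_normal_density z) = h (x + e * z) * ((2 * pi) / sqrt (2 * pi) * exp (- z\<^sup>2 / 2))"
      by (simp add: std_normal_density_def)
    also have "(2 * pi) / sqrt (2 * pi) = sqrt (2 * pi)" by (rule real_div_sqrt) simp
    finally show "e * (h (x + e * z) * (sqrt (2 * pi) / e * exp (- ((x - (x + e * z)) / e)\<^sup>2 / 2)))
        = 2 * pi * (h (x + e * z) * std_normal_density z)"
      using e by auto
  qed
  also have "\<dots> = 2 * pi * (LINT z|lborel. h (x + e * z) * std_normal_density z)" by simp
  finally show ?thesis by simp
qed

text \<open>Both sides of the smoothed formula converge as e tends to 0: the average because h is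
  continuous and bounded, the frequency integral because \<open>ft h\<close> is integrable and
  dominates.\<close>

lemma fourier_inversion:
  assumes h: "continuous_on UNIV h" and supp: "\<And>x. \<bar>x\<bar> > L \<Longrightarrow> h x = 0"
    and ft: "integrable lborel (ft h)"
  shows "complex_of_real (h x) = (CLINT u|lborel. ft h u / (2 * pi) * iexp (u * x))"
proof -
  have [measurable]: "h \<in> borel_measurable borel" using h by (rule borel_measurable_continuous_onI)
  have [measurable]: "ft h \<in> borel_measurable borel" by (rule ft_measurable[OF h])
  define e where "e n = 1 / real (Suc n)" for n
  have e: "e n > 0" for n by (simp add: e_def)
  have e0: "e \<longlonglongrightarrow> 0" unfolding e_def using LIMSEQ_Suc[OF lim_1_over_n] by simp
  obtain B where B: "\<And>x. \<bar>h x\<bar> \<le> B"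
  proof -
    have "compact (h ` {-L..L})" by (intro compact_continuous_image continuous_on_subset[OF h]) auto
    then have "bounded (h ` {-L..L})" by (rule compact_imp_bounded)
    then obtain B where B: "\<And>x. x \<in> {-L..L} \<Longrightarrow> \<bar>h x\<bar> \<le> B" "B > 0" unfolding bounded_pos by force
    have "\<bar>h x\<bar> \<le> B" for x
    proof (cases "\<bar>x\<bar> > L")
      case True
      then show ?thesis using B supp by simp
    next
      case False
      then have "x \<in> {-L..L}" by auto
      then show ?thesis by (rule B)
    qed
    then show ?thesis by (rule that)
  qed
  have 1: "(\<lambda>n. LINT z|lborel. h (x + e n * z) * std_normal_density z) \<longlonglongrightarrow> (LINT z|lborel. h x * std_normal_density z)"
  proof (rule integral_dominated_convergence[where w = "\<lambda>z. B * std_normal_density z"])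
    show "AE z in lborel. (\<lambda>n. h (x + e n * z) * std_normal_density z) \<longlonglongrightarrow> h x * std_normal_density z"
    proof (intro AE_I2 tendsto_mult tendsto_const)
      fix z
      have "(\<lambda>n. x + e n * z) \<longlonglongrightarrow> x + 0 * z" by (intro tendsto_intros e0)
      then show "(\<lambda>n. h (x + e n * z)) \<longlonglongrightarrow> h x"
        using continuous_on_tendsto_compose[OF h, of "\<lambda>n. x + e n * z" x] by simp
    qed
    show "AE z in lborel. norm (h (x + e n * z) * std_normal_density z) \<le> B * std_normal_density z" for n
      using B by (auto simp: abs_mult intro!: mult_right_mono)
  qed auto
  have "(\<lambda>n. complex_of_real (2 * pi * (LINT z|lborel. h (x + e n * z) * std_normal_density z))) \<longlonglongrightarrow> complex_of_real (2 * pi * h x)"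
    using tendsto_of_real[OF tendsto_mult_left[OF 1, of "2 * pi"], where 'a = complex] by simp
  then have lim1: "(\<lambda>n. CLINT u|lborel. complex_of_real (exp (- (e n * u)\<^sup>2 / 2)) * iexp (u * x) * ft h u) \<longlonglongrightarrow> complex_of_real (2 * pi * h x)"
    by (subst fourier_inversion_smoothed[OF h supp e]) simp_all
  have "(\<lambda>n. CLINT u|lborel. complex_of_real (exp (- (e n * u)\<^sup>2 / 2)) * iexp (u * x) * ft h u) \<longlonglongrightarrow> (CLINT u|lborel. iexp (u * x) * ft h u)"
  proof (rule integral_dominated_convergence[where w = "\<lambda>u. norm (ft h u)"])
    show "AE u in lborel. (\<lambda>n. complex_of_real (exp (- (e n * u)\<^sup>2 / 2)) * iexp (u * x) * ft h u) \<longlonglongrightarrow> iexp (u * x) * ft h u"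
    proof (rule AE_I2)
      fix u
      have "(\<lambda>n. complex_of_real (exp (- (e n * u)\<^sup>2 / 2)) * iexp (u * x) * ft h u) \<longlonglongrightarrow> complex_of_real (exp (- (0 * u)\<^sup>2 / 2)) * iexp (u * x) * ft h u"
        by (intro tendsto_intros e0) auto
      then show "(\<lambda>n. complex_of_real (exp (- (e n * u)\<^sup>2 / 2)) * iexp (u * x) * ft h u) \<longlonglongrightarrow> iexp (u * x) * ft h u" by simp
    qed
    show "AE u in lborel. norm (complex_of_real (exp (- (e n * u)\<^sup>2 / 2)) * iexp (u * x) * ft h u) \<le> norm (ft h u)" for n
      by (rule AE_I2) (simp add: norm_mult mult_left_le_one_le)
  qed (use ft in auto)
  then have "complex_of_real (2 * pi * h x) = (CLINT u|lborel. iexp (u * x) * ft h u)"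
    by (rule LIMSEQ_unique[OF lim1])
  then have "complex_of_real (h x) = 1 / (2 * pi) * (CLINT u|lborel. iexp (u * x) * ft h u)"
    by (simp add: eq_divide_eq mult_ac)
  also have "\<dots> = (CLINT u|lborel. 1 / (2 * pi) * (iexp (u * x) * ft h u))"
    by (simp only: integral_mult_right_zero)
  finally show ?thesis by (simp add: mult_ac)
qed

text \<open>Asking for the identity on [-R, R] only allows g to be cut off beforehand; paths that
  leave this interval are discarded later with small probability.\<close>

lemma fourier_representation:
  assumes g: "ck (2 * m) g" and m: "m \<ge> 1" and R: "R > 0"
  obtains G C where "G \<in> borel_measurable borel" "C \<ge> 0" "\<And>u. norm (G u) \<le> C / (1 + u\<^sup>2) ^ m"
    "\<And>x. \<bar>x\<bar> \<le> R \<Longrightarrow> complex_of_real (g x) = (CLINT u|lborel. G u * iexp (u * x))"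
proof -
  obtain h where h: "ck (2 * m) h" "\<And>x. \<bar>x\<bar> \<le> R \<Longrightarrow> h x = g x" "\<And>x. \<bar>x\<bar> \<ge> R + 1 \<Longrightarrow> h x = 0"
    using ck_cutoff[OF g] by blast
  note hc = ck_imp_continuous[OF h(1)]
  have supp: "\<And>x. \<bar>x\<bar> > R + 1 \<Longrightarrow> h x = 0" using h(3) by simp
  obtain C where C: "\<And>u. norm (ft h u) \<le> C / (1 + u\<^sup>2) ^ m" "C \<ge> 0"
    by (rule ft_bound[OF h(1), of "R + 1"]) (use R supp in auto)
  note [measurable] = ft_measurable[OF hc]
  have "integrable lborel (ft h)"
    by (rule integrable_of_decay[OF _ C(2) m C(1)]) simp
  note inv = fourier_inversion[OF hc, of "R + 1", OF supp this]
  show ?thesis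
  proof (rule that)
    show "(\<lambda>u. ft h u / (2 * pi)) \<in> borel_measurable borel" by simp
    show "C / (2 * pi) \<ge> 0" using C by simp
    show "norm (ft h u / (2 * pi)) \<le> C / (2 * pi) / (1 + u\<^sup>2) ^ m" for u
      using divide_right_mono[OF C(1)[of u], of "2 * pi"] by (simp add: norm_divide mult_ac)
    show "complex_of_real (g x) = (CLINT u|lborel. ft h u / (2 * pi) * iexp (u * x))" if "\<bar>x\<bar> \<le> R" for x
      using inv[of x] h(2)[OF that] by simp
  qed
qed

section \<open>Covariance kernels of self-similar processes\<close>

text \<open>Applied with p = 2 \<beta> to the growth of the variance between consecutive
  integers.\<close>

lemma powr_Suc_diff_le_one:
  assumes "0 < p" "p \<le> 1"
  shows "real (Suc i) powr p - real i powr p \<le> 1"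
proof (cases "i = 0")
  case False
  have "real (Suc i) powr p = real (Suc i) * real (Suc i) powr (p - 1)"
    by (simp add: powr_mult_base)
  also have "\<dots> = real i * real (Suc i) powr (p - 1) + real (Suc i) powr (p - 1)"
    by (simp add: algebra_simps)
  also have "\<dots> \<le> real i * real i powr (p - 1) + 1"
    using False assms powr_mono[of "p - 1" 0 "real (Suc i)"]
    by (intro add_mono mult_left_mono powr_mono2') auto
  also have "real i * real i powr (p - 1) = real i powr p"
    by (simp add: powr_mult_base)
  finally show ?thesis by simp
qed (use assms in auto)

text \<open>The properties of \<phi> in the form in which they are consumed, with one common
  constant. \<open>growth\<close> is Cauchy-Schwarz, \<open>near\<close> and \<open>far\<close> are
  obtained by integrating the bound on the second derivative, and \<open>second\<close> merges the
  two regimes of that bound.\<close>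

locale selfsimilar_kernel =
  fixes \<phi> \<phi>1 \<phi>2 :: "real \<Rightarrow> real" and \<alpha> \<beta> \<theta> C :: real
  assumes alpha: "0 < \<alpha>" "\<alpha> < 1" and beta: "0 < \<beta>" "\<beta> \<le> 1/2" "\<alpha> \<le> 2 * \<beta>" and theta: "1 < \<theta>"
    and cont: "continuous_on {1..} \<phi>"
    and d1: "\<And>x. 1 < x \<Longrightarrow> (\<phi> has_real_derivative \<phi>1 x) (at x)"
    and d2: "\<And>x. 1 < x \<Longrightarrow> (\<phi>1 has_real_derivative \<phi>2 x) (at x)"
    and growth: "\<And>x. 1 \<le> x \<Longrightarrow> \<bar>\<phi> x\<bar> \<le> C * x powr \<beta>"
    and near: "\<And>x. 1 < x \<Longrightarrow> \<bar>\<phi>1 x\<bar> \<le> C * (x - 1) powr (\<alpha> - 1)"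
    and far: "\<And>x. 2 \<le> x \<Longrightarrow> \<bar>\<phi>1 x\<bar> \<le> C * x powr (- \<theta>)"
    and second: "\<And>x. 1 < x \<Longrightarrow> \<bar>x * \<phi>2 x\<bar> \<le> C * ((x - 1) powr (\<alpha> - 2) + x powr (- \<theta>))"
begin

lemma C_nonneg: "0 \<le> C"
  using growth[of 1] by simp

text \<open>The covariance of the process at times s and t. At s = 0 the quotient t / s is 0 by
  convention, but the factor \<open>s powr (2 * \<beta>)\<close> is 0 as well, in agreement with X 0
  = 0.\<close>

definition ker :: "real \<Rightarrow> real \<Rightarrow> real" where
  "ker s t = (if s \<le> t then s powr (2 * \<beta>) * \<phi> (t / s) else t powr (2 * \<beta>) * \<phi> (s / t))"

text \<open>The covariance of the increments over [i, i + 1] and [j, j + 1]. Integer grids suffice: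
  by self-similarity a grid of mesh 1 / n differs only by the factor n^(-2 \<beta>).\<close>

definition dker :: "nat \<Rightarrow> nat \<Rightarrow> real" where
  "dker i j = ker (Suc i) (Suc j) - ker (Suc i) j - ker i (Suc j) + ker i j"

lemma ker_commute: "ker s t = ker t s"
  unfolding ker_def by auto

lemma dker_commute: "dker i j = dker j i"
  unfolding dker_def by (simp add: ker_commute)

text \<open>The right side is the increment of a primitive of the bound \<open>near\<close>. The
  mean value inequality asks only for continuity at the endpoint 1, where the derivative may be
  singular, and the difference form telescopes in \<open>ker_variation\<close>.\<close>

lemma phi_increment:
  assumes "1 \<le> x" "x \<le> y"
  shows "\<bar>\<phi> y - \<phi> x\<bar> \<le> C / \<alpha> * ((y - 1) powr \<alpha> - (x - 1) powr \<alpha>)"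
proof (cases "x = y")
  case False
  have "norm (\<phi> y - \<phi> x) \<le> C / \<alpha> * (y - 1) powr \<alpha> - C / \<alpha> * (x - 1) powr \<alpha>"
  proof (rule differentiable_bound_general[where \<phi> = "\<lambda>x. C / \<alpha> * (x - 1) powr \<alpha>"])
    show "x < y" using False assms by simp
    show "continuous_on {x..y} \<phi>" using assms by (intro continuous_on_subset[OF cont]) auto
    show "continuous_on {x..y} (\<lambda>x. C / \<alpha> * (x - 1) powr \<alpha>)"
      using alpha assms by (intro continuous_on_mult continuous_on_const continuous_on_powr' continuous_intros) auto
    fix z assume z: "x < z" "z < y"
    then show "(\<phi> has_vector_derivative \<phi>1 z) (at z)"
      using d1[of z] assms by (simp add: has_real_derivative_iff_has_vector_derivative)
    show "((\<lambda>x. C / \<alpha> * (x - 1) powr \<alpha>) has_vector_derivative C * (z - 1) powr (\<alpha> - 1)) (at z)"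
      unfolding has_real_derivative_iff_has_vector_derivative[symmetric]
      using z assms alpha by (auto intro!: derivative_eq_intros)
    show "norm (\<phi>1 z) \<le> C * (z - 1) powr (\<alpha> - 1)" using near[of z] z assms by simp
  qed
  then show ?thesis by (simp add: right_diff_distrib)
qed simp

lemma phi_increment_1:
  assumes "1 \<le> x"
  shows "\<bar>\<phi> x - \<phi> 1\<bar> \<le> C / \<alpha> * (x - 1) powr \<alpha>"
  using phi_increment[of 1 x] assms by simp

lemma ker_right_increment:
  assumes k: "1 \<le> k" and i: "k \<le> i"
  shows "\<bar>ker (Suc i) k - ker i k\<bar> \<le>
    C / \<alpha> * k powr (2 * \<beta>) * ((real (Suc i) / k - 1) powr \<alpha> - (real i / k - 1) powr \<alpha>)"
proof -
  have eq: "ker j k = k powr (2 * \<beta>) * \<phi> (real j / k)" if "k \<le> j" for j :: nat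
    using that unfolding ker_def by (cases "j = k") auto
  have e: "ker (Suc i) k = k powr (2 * \<beta>) * \<phi> (real (Suc i) / k)" "ker i k = k powr (2 * \<beta>) * \<phi> (real i / k)"
    by (intro eq; use i in simp)+
  have "\<bar>ker (Suc i) k - ker i k\<bar> = k powr (2 * \<beta>) * \<bar>\<phi> (real (Suc i) / k) - \<phi> (real i / k)\<bar>"
    unfolding e right_diff_distrib[symmetric] abs_mult by simp
  also have "\<dots> \<le> k powr (2 * \<beta>) * (C / \<alpha> * ((real (Suc i) / k - 1) powr \<alpha> - (real i / k - 1) powr \<alpha>))"
    using i k by (intro mult_left_mono phi_increment) (auto simp: field_simps)
  finally show ?thesis by (simp add: mult_ac)
qed

section \<open>Partial derivatives of the kernel off the diagonal\<close>

definition ker_s :: "real \<Rightarrow> real \<Rightarrow> real" where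
  "ker_s s t = 2 * \<beta> * s powr (2 * \<beta> - 1) * \<phi> (t / s) - s powr (2 * \<beta> - 2) * t * \<phi>1 (t / s)"

definition ker_st :: "real \<Rightarrow> real \<Rightarrow> real" where
  "ker_st s t = s powr (2 * \<beta> - 2) * ((2 * \<beta> - 1) * \<phi>1 (t / s) - t / s * \<phi>2 (t / s))"

lemma DERIV_ker:
  assumes "0 < s" "s < t"
  shows "((\<lambda>s. s powr (2 * \<beta>) * \<phi> (t / s)) has_real_derivative ker_s s t) (at s)"
proof -
  have x: "1 < t / s" using assms by simp
  have "((\<lambda>s. t / s) has_real_derivative - (t / s\<^sup>2)) (at s)"
    using assms by (auto intro!: derivative_eq_intros simp: power2_eq_square)
  from DERIV_chain2[OF d1[OF x] this]
  have "((\<lambda>s. \<phi> (t / s)) has_real_derivative \<phi>1 (t / s) * - (t / s\<^sup>2)) (at s)" .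
  with assms have "((\<lambda>s. s powr (2 * \<beta>) * \<phi> (t / s)) has_real_derivative
      2 * \<beta> * s powr (2 * \<beta> - 1) * \<phi> (t / s) + \<phi>1 (t / s) * - (t / s\<^sup>2) * s powr (2 * \<beta>)) (at s)"
    by (intro DERIV_mult has_real_derivative_powr)
  moreover have "s powr (2 * \<beta> - 2) = s powr (2 * \<beta>) / s\<^sup>2"
    using assms by (simp add: powr_diff powr_numeral)
  ultimately show ?thesis unfolding ker_s_def by (simp add: field_simps)
qed

lemma DERIV_ker_s:
  assumes "0 < s" "s < t"
  shows "((\<lambda>t. ker_s s t) has_real_derivative ker_st s t) (at t)"
proof -
  have x: "1 < t / s" using assms by simp
  have q: "((\<lambda>t. t / s) has_real_derivative 1 / s) (at t)"
    using assms by (auto intro!: derivative_eq_intros)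
  have e: "s powr (2 * \<beta> - 1) = s powr (2 * \<beta> - 2) * s"
    using assms powr_add[of s "2 * \<beta> - 2" 1] by simp
  show ?thesis
    unfolding ker_s_def ker_st_def e
    using assms
    by (auto intro!: derivative_eq_intros DERIV_chain2[OF d1[OF x] q] DERIV_chain2[OF d2[OF x] q] simp: field_simps)
qed

text \<open>The two summands reflect the two singularities in s, at the origin and on the diagonal.
  For t / s \<ge> 2 the derivative of \<phi> is at most of order s / t and joins the first summand;
  otherwise s is comparable to t. Both summands have explicit primitives in s.\<close>

lemma ker_s_bound:
  assumes s: "0 < s" "s < t"
  shows "\<bar>ker_s s t\<bar> \<le> 2 * C * t powr \<beta> * s powr (\<beta> - 1) + 4 * C * t powr (2 * \<beta> - \<alpha>) * (t - s) powr (\<alpha> - 1)"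
proof -
  let ?x = "t / s"
  have x: "1 < ?x" using s by simp
  have t: "0 < t" using s by simp
  have sq: "s powr (2 * \<beta> - 1) = s powr (\<beta> - 1) * s powr \<beta>"
    by (simp flip: powr_add)
  have "\<bar>2 * \<beta> * s powr (2 * \<beta> - 1) * \<phi> ?x\<bar> = 2 * \<beta> * (s powr (2 * \<beta> - 1) * \<bar>\<phi> ?x\<bar>)"
    using beta by (simp add: abs_mult)
  also have "\<dots> \<le> 1 * (s powr (2 * \<beta> - 1) * (C * ?x powr \<beta>))"
    using beta x C_nonneg by (intro mult_mono mult_left_mono growth) auto
  also have "\<dots> = C * t powr \<beta> * s powr (\<beta> - 1)"
    using s by (simp add: sq powr_divide)
  finally have 1: "\<bar>2 * \<beta> * s powr (2 * \<beta> - 1) * \<phi> ?x\<bar> \<le> C * t powr \<beta> * s powr (\<beta> - 1)" .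
  have 2: "\<bar>s powr (2 * \<beta> - 2) * t * \<phi>1 ?x\<bar> \<le> C * t powr \<beta> * s powr (\<beta> - 1) + 4 * C * t powr (2 * \<beta> - \<alpha>) * (t - s) powr (\<alpha> - 1)"
  proof (cases "2 \<le> ?x")
    case True
    have "\<bar>\<phi>1 ?x\<bar> \<le> C * ?x powr (- \<theta>)" by (rule far[OF True])
    also have "\<dots> \<le> C * ?x powr (- 1)"
      using theta x C_nonneg by (intro mult_left_mono powr_mono) auto
    also have "\<dots> = C * (s / t)" using s t by (simp add: powr_minus_divide)
    finally have "s powr (2 * \<beta> - 2) * t * \<bar>\<phi>1 ?x\<bar> \<le> s powr (2 * \<beta> - 2) * t * (C * (s / t))"
      using t by (intro mult_left_mono) auto
    also have "\<dots> = C * (s powr (2 * \<beta> - 2) * s)" using t by simp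
    also have "s powr (2 * \<beta> - 2) * s = s powr (2 * \<beta> - 1)"
      using s powr_add[of s "2 * \<beta> - 2" 1] by simp
    also have "C * s powr (2 * \<beta> - 1) \<le> C * (s powr (\<beta> - 1) * t powr \<beta>)"
      unfolding sq using s beta C_nonneg by (intro mult_left_mono powr_mono2) auto
    finally have "s powr (2 * \<beta> - 2) * t * \<bar>\<phi>1 ?x\<bar> \<le> C * t powr \<beta> * s powr (\<beta> - 1)"
      by (simp add: mult_ac)
    moreover have "0 \<le> 4 * C * t powr (2 * \<beta> - \<alpha>) * (t - s) powr (\<alpha> - 1)"
      using C_nonneg by simp
    moreover have "\<bar>s powr (2 * \<beta> - 2) * t * \<phi>1 ?x\<bar> = s powr (2 * \<beta> - 2) * t * \<bar>\<phi>1 ?x\<bar>"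
      using t by (simp add: abs_mult)
    ultimately show ?thesis by linarith
  next
    case False
    then have st: "t / 2 \<le> s" using s by (simp add: field_simps)
    have e: "?x - 1 = (t - s) / s" using s by (simp add: field_simps)
    have e': "s powr (1 - \<alpha>) = 1 / s powr (\<alpha> - 1)"
      using powr_minus_divide[of s "\<alpha> - 1"] by simp
    have "(?x - 1) powr (\<alpha> - 1) = (t - s) powr (\<alpha> - 1) * s powr (1 - \<alpha>)"
      unfolding e e' powr_divide by simp
    then have "\<bar>\<phi>1 ?x\<bar> \<le> C * ((t - s) powr (\<alpha> - 1) * s powr (1 - \<alpha>))"
      using near[OF x] by simp
    then have "s powr (2 * \<beta> - 2) * t * \<bar>\<phi>1 ?x\<bar> \<le> s powr (2 * \<beta> - 2) * t * (C * ((t - s) powr (\<alpha> - 1) * s powr (1 - \<alpha>)))"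
      using t by (intro mult_left_mono) auto
    also have "\<dots> = C * t * (t - s) powr (\<alpha> - 1) * (s powr (2 * \<beta> - 2) * s powr (1 - \<alpha>))"
      by (simp add: mult_ac)
    also have "s powr (2 * \<beta> - 2) * s powr (1 - \<alpha>) = s powr (2 * \<beta> - 1 - \<alpha>)"
      using powr_add[of s "2 * \<beta> - 2" "1 - \<alpha>"] by (simp add: algebra_simps)
    also have "C * t * (t - s) powr (\<alpha> - 1) * s powr (2 * \<beta> - 1 - \<alpha>)
        \<le> C * t * (t - s) powr (\<alpha> - 1) * (4 * t powr (2 * \<beta> - 1 - \<alpha>))"
    proof (intro mult_left_mono)
      have "s powr (2 * \<beta> - 1 - \<alpha>) \<le> (t / 2) powr (2 * \<beta> - 1 - \<alpha>)"
        using alpha beta t st by (intro powr_mono2') auto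
      also have "\<dots> = t powr (2 * \<beta> - 1 - \<alpha>) * 2 powr (1 + \<alpha> - 2 * \<beta>)"
      proof -
        have "1 + \<alpha> - 2 * \<beta> = - (2 * \<beta> - 1 - \<alpha>)" by simp
        then show ?thesis by (simp only: powr_minus_divide powr_divide) simp
      qed
      \<comment> \<open>The exponent 1 + \<alpha> - 2 \<beta> lies below 2; this is the source of
        the constant 4.\<close>
      also have "\<dots> \<le> t powr (2 * \<beta> - 1 - \<alpha>) * 2 powr 2"
        using alpha beta by (intro mult_left_mono powr_mono) auto
      finally show "s powr (2 * \<beta> - 1 - \<alpha>) \<le> 4 * t powr (2 * \<beta> - 1 - \<alpha>)"
        by (simp add: powr_numeral)
    qed (use C_nonneg t in auto)
    also have "\<dots> = 4 * C * (t * t powr (2 * \<beta> - 1 - \<alpha>)) * (t - s) powr (\<alpha> - 1)"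
      by (simp add: mult_ac)
    also have "t * t powr (2 * \<beta> - 1 - \<alpha>) = t powr (2 * \<beta> - \<alpha>)"
      using t by (simp add: powr_mult_base)
    finally have "s powr (2 * \<beta> - 2) * t * \<bar>\<phi>1 ?x\<bar> \<le> 4 * C * t powr (2 * \<beta> - \<alpha>) * (t - s) powr (\<alpha> - 1)" .
    moreover have "0 \<le> C * t powr \<beta> * s powr (\<beta> - 1)" using C_nonneg by simp
    moreover have "\<bar>s powr (2 * \<beta> - 2) * t * \<phi>1 ?x\<bar> = s powr (2 * \<beta> - 2) * t * \<bar>\<phi>1 ?x\<bar>"
      using t by (simp add: abs_mult)
    ultimately show ?thesis by linarith
  qed
  show ?thesis unfolding ker_s_def using 1 2 by linarith
qed

text \<open>The first term is the singularity on the diagonal, the second the decay far from it. For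
  s \<ge> 1 and 2 \<beta> \<le> 1 the power of s in the second term may be raised to \<theta> - 1,
  which makes it homogeneous of degree -1, the borderline for bounded row sums.\<close>

lemma ker_st_bound:
  assumes s: "1 \<le> s" "s < t"
  shows "\<bar>ker_st s t\<bar> \<le> 2 * C * (s powr (2 * \<beta> - \<alpha>) * (t - s) powr (\<alpha> - 2)) + 2 * C * (s powr (\<theta> - 1) * t powr (- \<theta>))"
proof -
  let ?x = "t / s"
  have x: "1 < ?x" using s by simp
  have "\<bar>\<phi>1 ?x\<bar> \<le> C * ((?x - 1) powr (\<alpha> - 2) + ?x powr (- \<theta>))"
  proof (cases "2 \<le> ?x")
    case True
    have "C * ?x powr (- \<theta>) \<le> C * ((?x - 1) powr (\<alpha> - 2) + ?x powr (- \<theta>))"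
      using C_nonneg by (intro mult_left_mono) auto
    then show ?thesis using far[OF True] by linarith
  next
    case False
    have "(?x - 1) powr (\<alpha> - 1) \<le> (?x - 1) powr (\<alpha> - 2)"
      using False x by (intro powr_mono') auto
    then have "C * (?x - 1) powr (\<alpha> - 1) \<le> C * ((?x - 1) powr (\<alpha> - 2) + ?x powr (- \<theta>))"
      using C_nonneg by (intro mult_left_mono add_increasing2) auto
    then show ?thesis using near[OF x] by linarith
  qed
  moreover have "\<bar>2 * \<beta> - 1\<bar> \<le> 1" using beta by auto
  ultimately have "\<bar>(2 * \<beta> - 1) * \<phi>1 ?x\<bar> \<le> C * ((?x - 1) powr (\<alpha> - 2) + ?x powr (- \<theta>))"
    unfolding abs_mult using mult_right_mono[of "\<bar>2 * \<beta> - 1\<bar>" 1 "\<bar>\<phi>1 ?x\<bar>"] by simp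
  from order.trans[OF abs_triangle_ineq4 add_mono[OF this second[OF x]]]
  have "\<bar>(2 * \<beta> - 1) * \<phi>1 ?x - ?x * \<phi>2 ?x\<bar> \<le> 2 * C * ((?x - 1) powr (\<alpha> - 2) + ?x powr (- \<theta>))"
    by (simp only: mult_2[of C] distrib_right[of C C])
  then have "\<bar>ker_st s t\<bar> \<le> s powr (2 * \<beta> - 2) * (2 * C * ((?x - 1) powr (\<alpha> - 2) + ?x powr (- \<theta>)))"
    unfolding ker_st_def abs_mult by (simp add: mult_left_mono)
  also have "\<dots> = 2 * C * (s powr (2 * \<beta> - 2) * (?x - 1) powr (\<alpha> - 2)) + 2 * C * (s powr (2 * \<beta> - 2) * ?x powr (- \<theta>))"
    by (simp add: algebra_simps)
  also have "s powr (2 * \<beta> - 2) * (?x - 1) powr (\<alpha> - 2) = s powr (2 * \<beta> - \<alpha>) * (t - s) powr (\<alpha> - 2)"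
  proof -
    have "?x - 1 = (t - s) / s" using s by (simp add: field_simps)
    then have "s powr (2 * \<beta> - 2) * (?x - 1) powr (\<alpha> - 2) = (t - s) powr (\<alpha> - 2) * (s powr (2 * \<beta> - 2) / s powr (\<alpha> - 2))"
      by (simp add: powr_divide)
    also have "s powr (2 * \<beta> - 2) / s powr (\<alpha> - 2) = s powr (2 * \<beta> - \<alpha>)"
      by (simp flip: powr_diff)
    finally show ?thesis by simp
  qed
  also have "s powr (2 * \<beta> - 2) * ?x powr (- \<theta>) = s powr (2 * \<beta> - 2 + \<theta>) * t powr (- \<theta>)"
  proof -
    have "s powr (2 * \<beta> - 2) * ?x powr (- \<theta>) = t powr (- \<theta>) * (s powr (2 * \<beta> - 2) / s powr (- \<theta>))"
      by (simp add: powr_divide)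
    also have "s powr (2 * \<beta> - 2) / s powr (- \<theta>) = s powr (2 * \<beta> - 2 + \<theta>)"
      by (simp flip: powr_diff)
    finally show ?thesis by simp
  qed
  also have "2 * C * (s powr (2 * \<beta> - 2 + \<theta>) * t powr (- \<theta>)) \<le> 2 * C * (s powr (\<theta> - 1) * t powr (- \<theta>))"
    using C_nonneg s beta by (intro mult_left_mono mult_right_mono powr_mono) auto
  finally show ?thesis by simp
qed

end

context selfsimilar_kernel
begin

text \<open>H is the primitive in s of the bound in \<open>ker_s_bound\<close>; its second term has
  a minus sign because (k - s)^\<alpha> decreases in s. Continuity of \<phi> at 1 covers the case
  \<open>Suc i = k\<close>, where the interval ends on the diagonal.\<close>

lemma ker_left_increment:
  fixes i k :: nat
  assumes i: "1 \<le> i" "Suc i \<le> k"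
  defines "H \<equiv> \<lambda>s::real. 2 * C / \<beta> * k powr \<beta> * s powr \<beta> - 4 * C / \<alpha> * k powr (2 * \<beta> - \<alpha>) * (k - s) powr \<alpha>"
  shows "\<bar>ker (Suc i) k - ker i k\<bar> \<le> H (real (Suc i)) - H (real i)"
proof -
  let ?f = "\<lambda>s::real. s powr (2 * \<beta>) * \<phi> (real k / s)"
  have "norm (?f (Suc i) - ?f i) \<le> H (real (Suc i)) - H (real i)"
  proof (rule differentiable_bound_general[where f = ?f and \<phi> = H and a = "real i" and b = "real (Suc i)"])
    show "real i < real (Suc i)" by simp
    have "continuous_on {real i..real (Suc i)} (\<lambda>s. \<phi> (real k / s))"
    proof (rule continuous_on_compose2[OF cont])
      show "continuous_on {real i..real (Suc i)} (\<lambda>s. real k / s)"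
        using i by (intro continuous_intros) auto
      show "(\<lambda>s. real k / s) ` {real i..real (Suc i)} \<subseteq> {1..}"
        using i by (auto simp: field_simps)
    qed
    moreover have "continuous_on {real i..real (Suc i)} (\<lambda>s. s powr (2 * \<beta>))"
      using i by (intro continuous_intros) auto
    ultimately show "continuous_on {real i..real (Suc i)} ?f"
      by (rule continuous_on_mult[rotated])
    show "continuous_on {real i..real (Suc i)} H"
      unfolding H_def using i alpha
      by (intro continuous_on_diff continuous_on_mult continuous_on_const continuous_on_powr' continuous_intros) auto
    fix s assume s: "real i < s" "s < real (Suc i)"
    then have s': "0 < s" "s < k" using i by auto
    show "(?f has_vector_derivative ker_s s k) (at s)"
      using DERIV_ker[OF s'] by (simp add: has_real_derivative_iff_has_vector_derivative)
    show "norm (ker_s s k) \<le> 2 * C * k powr \<beta> * s powr (\<beta> - 1) + 4 * C * k powr (2 * \<beta> - \<alpha>) * (k - s) powr (\<alpha> - 1)"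
      using ker_s_bound[OF s'] by simp
    show "(H has_vector_derivative 2 * C * k powr \<beta> * s powr (\<beta> - 1) + 4 * C * k powr (2 * \<beta> - \<alpha>) * (k - s) powr (\<alpha> - 1)) (at s)"
      unfolding has_real_derivative_iff_has_vector_derivative[symmetric] H_def
      using s' alpha beta by (auto intro!: derivative_eq_intros)
  qed
  moreover have "ker (real j) k = ?f (real j)" if "j \<le> k" for j
    using that unfolding ker_def by auto
  moreover from this[of "Suc i"] this[of i] have "ker (real (Suc i)) k = ?f (real (Suc i))" "ker (real i) k = ?f (real i)"
    using i by auto
  ultimately show ?thesis by (simp only: real_norm_def)
qed

text \<open>Bounded variation uniformly in k, by telescoping: the primitive H controls the steps
  below k and the powers (i / k - 1)^\<alpha> those above. The step from 0 to 1 is separate, since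
  the formula in s is differentiable only for s > 0; there \<open>ker 0 k = 0\<close> and
  \<open>growth\<close> is enough.\<close>

lemma ker_variation:
  fixes k N :: nat
  assumes k: "k \<le> N"
  shows "(\<Sum>i<N. \<bar>ker (Suc i) k - ker i k\<bar>) \<le> (C + 2 * C / \<beta> + 5 * C / \<alpha>) * N powr (2 * \<beta>)"
proof (cases "k = 0")
  case True
  then have z: "ker j k = 0" for j :: nat using beta by (auto simp: ker_def)
  have "(\<Sum>i<N. \<bar>ker (Suc i) k - ker i k\<bar>) = 0" by (simp only: z) simp
  then show ?thesis using C_nonneg alpha beta by simp
next
  case False
  then have k1: "1 \<le> k" by simp
  let ?d = "\<lambda>i. \<bar>ker (Suc i) k - ker i k\<bar>"
  have kN: "real k powr p \<le> real N powr p" if "p \<ge> 0" for p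
    using k that by (intro powr_mono2) auto
  have k2: "real k powr (2 * \<beta>) = real k powr (2 * \<beta> - \<alpha>) * real k powr \<alpha>"
    by (simp flip: powr_add)
  have "{..<N} = {..<k} \<union> {k..<N}" using k by auto
  then have "(\<Sum>i<N. ?d i) = (\<Sum>i\<in>{..<k} \<union> {k..<N}. ?d i)" by (rule sum.cong) simp
  also have "\<dots> = (\<Sum>i<k. ?d i) + (\<Sum>i=k..<N. ?d i)"
    by (rule sum.union_disjoint) auto
  also have "(\<Sum>i<k. ?d i) = ?d 0 + (\<Sum>i=1..<k. ?d i)"
  proof -
    have "{..<k} = insert 0 {1..<k}" using k1 by auto
    then have "(\<Sum>i<k. ?d i) = (\<Sum>i\<in>insert 0 {1..<k}. ?d i)" by (rule sum.cong) simp
    also have "\<dots> = ?d 0 + (\<Sum>i=1..<k. ?d i)" by (rule sum.insert) auto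
    finally show ?thesis .
  qed
  also have "?d 0 \<le> C * N powr (2 * \<beta>)"
  proof -
    have "?d 0 = \<bar>\<phi> k\<bar>" using k1 beta by (auto simp: ker_def)
    also have "\<dots> \<le> C * k powr \<beta>" using k1 by (intro growth) auto
    also have "\<dots> \<le> C * N powr (2 * \<beta>)"
      using C_nonneg k1 k beta by (intro mult_left_mono powr_mono_both) auto
    finally show ?thesis .
  qed
  also have "(\<Sum>i=1..<k. ?d i) \<le> (2 * C / \<beta> + 4 * C / \<alpha>) * N powr (2 * \<beta>)"
  proof -
    define H where "H s = 2 * C / \<beta> * k powr \<beta> * s powr \<beta> - 4 * C / \<alpha> * k powr (2 * \<beta> - \<alpha>) * (k - s) powr \<alpha>" for s :: real
    have "(\<Sum>i=1..<k. ?d i) \<le> (\<Sum>i=1..<k. H (real (Suc i)) - H (real i))"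
      unfolding H_def by (intro sum_mono ker_left_increment) auto
    also have "\<dots> = H k - H 1"
      using sum_Suc_diff'[of 1 k "\<lambda>i. H (real i)"] k1 by simp
    also have "\<dots> \<le> 2 * C / \<beta> * k powr \<beta> * k powr \<beta> + 4 * C / \<alpha> * k powr (2 * \<beta> - \<alpha>) * k powr \<alpha>"
    proof -
      have "H k = 2 * C / \<beta> * k powr \<beta> * k powr \<beta>" using alpha by (simp add: H_def)
      moreover have "4 * C / \<alpha> * k powr (2 * \<beta> - \<alpha>) * (real k - 1) powr \<alpha> \<le> 4 * C / \<alpha> * k powr (2 * \<beta> - \<alpha>) * k powr \<alpha>"
        using k1 C_nonneg alpha by (intro mult_left_mono powr_mono2) auto
      moreover have "0 \<le> 2 * C / \<beta> * k powr \<beta> * 1 powr \<beta>" using C_nonneg beta by simp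
      ultimately show ?thesis by (simp add: H_def)
    qed
    also have "\<dots> = (2 * C / \<beta> + 4 * C / \<alpha>) * k powr (2 * \<beta>)"
    proof -
      have "real k powr \<beta> * real k powr \<beta> = real k powr (2 * \<beta>)" by (simp flip: powr_add)
      then show ?thesis unfolding distrib_right using k2 by (simp add: mult.assoc)
    qed
    also have "\<dots> \<le> (2 * C / \<beta> + 4 * C / \<alpha>) * N powr (2 * \<beta>)"
      using C_nonneg alpha beta by (intro mult_left_mono kN) auto
    finally show ?thesis .
  qed
  also have "(\<Sum>i=k..<N. ?d i) \<le> C / \<alpha> * N powr (2 * \<beta>)"
  proof -
    define G where "G i = (real i / k - 1) powr \<alpha>" for i :: nat
    have "(\<Sum>i=k..<N. ?d i) \<le> (\<Sum>i=k..<N. C / \<alpha> * k powr (2 * \<beta>) * (G (Suc i) - G i))"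
      unfolding G_def using k1 by (intro sum_mono ker_right_increment) auto
    also have "\<dots> = C / \<alpha> * k powr (2 * \<beta>) * (G N - G k)"
      unfolding sum_distrib_left[symmetric] using sum_Suc_diff'[of k N G] k by simp
    also have "G k = 0" using k1 alpha by (simp add: G_def)
    also have "C / \<alpha> * k powr (2 * \<beta>) * (G N - 0) \<le> C / \<alpha> * k powr (2 * \<beta>) * (real N / k) powr \<alpha>"
      unfolding G_def diff_0_right using C_nonneg alpha k1 k by (intro mult_left_mono powr_mono2) (auto simp: field_simps)
    also have "\<dots> = C / \<alpha> * (k powr (2 * \<beta> - \<alpha>) * N powr \<alpha>)"
      using k1 unfolding k2 by (simp add: powr_divide)
    also have "\<dots> \<le> C / \<alpha> * (N powr (2 * \<beta> - \<alpha>) * N powr \<alpha>)"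
      using C_nonneg alpha beta by (intro mult_left_mono mult_right_mono kN) auto
    also have "N powr (2 * \<beta> - \<alpha>) * N powr \<alpha> = N powr (2 * \<beta>)" by (simp flip: powr_add)
    finally show ?thesis .
  qed
  finally show ?thesis by (simp add: algebra_simps)
qed

text \<open>The rectangle of the two intervals avoids the diagonal, so two applications of the mean
  value theorem express the covariance as \<open>ker_st s t\<close> at an interior point. Every
  factor of \<open>ker_st_bound\<close> is monotone, which allows s \<le> i + 1, t \<ge> j and t - s
  \<ge> j - i - 1 to be inserted. For i = 0 the rectangle touches s = 0; there only an increment of
  \<phi> is left, and \<open>far\<close> applies.\<close>

lemma dker_off_diagonal:
  assumes ij: "i + 2 \<le> j"
  shows "\<bar>dker i j\<bar> \<le> 2 * C * (Suc i powr (2 * \<beta> - \<alpha>) * real (j - i - 1) powr (\<alpha> - 2))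
    + 2 * C * (Suc i powr (\<theta> - 1) * j powr (- \<theta>))"
proof (cases "i = 0")
  case True
  have j: "2 \<le> j" using ij by simp
  have "dker i j = \<phi> (Suc j) - \<phi> j"
    using True j beta by (simp add: dker_def ker_def)
  moreover obtain z where z: "real j < z" "z < real (Suc j)" "\<phi> (real (Suc j)) - \<phi> (real j) = (real (Suc j) - real j) * \<phi>1 z"
    using MVT2[of "real j" "real (Suc j)" \<phi> \<phi>1] d1 j by (metis d1 less_add_one of_nat_Suc add.commute less_le_trans one_less_numeral_iff of_nat_numeral of_nat_le_iff semiring_norm(76))
  ultimately have "\<bar>dker i j\<bar> = \<bar>\<phi>1 z\<bar>" by simp
  also have "\<dots> \<le> C * z powr (- \<theta>)" using z j by (intro far) auto
  also have "\<dots> \<le> C * j powr (- \<theta>)"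
    using z j theta C_nonneg by (intro mult_left_mono powr_mono2') auto
  also have "\<dots> \<le> 2 * C * (Suc i powr (2 * \<beta> - \<alpha>) * real (j - i - 1) powr (\<alpha> - 2)) + 2 * C * (Suc i powr (\<theta> - 1) * j powr (- \<theta>))"
    using True C_nonneg by (simp add: add_increasing)
  finally show ?thesis .
next
  case False
  have eq: "ker s t = s powr (2 * \<beta>) * \<phi> (t / s)" if "s \<le> t" for s t
    using that by (simp add: ker_def)
  let ?h = "\<lambda>s. s powr (2 * \<beta>) * \<phi> (real (Suc j) / s) - s powr (2 * \<beta>) * \<phi> (real j / s)"
  have "\<exists>s. real i < s \<and> s < real (Suc i) \<and> ?h (real (Suc i)) - ?h (real i)
      = (real (Suc i) - real i) * (ker_s s (Suc j) - ker_s s j)"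
    by (rule MVT2) (use False ij in \<open>auto intro!: DERIV_diff DERIV_ker\<close>)
  then obtain s where s: "real i < s" "s < real (Suc i)" "?h (real (Suc i)) - ?h (real i) = ker_s s (Suc j) - ker_s s j"
    by auto
  have "\<exists>t. real j < t \<and> t < real (Suc j) \<and> ker_s s (Suc j) - ker_s s j = (real (Suc j) - real j) * ker_st s t"
    by (rule MVT2) (use False ij s in \<open>auto intro!: DERIV_ker_s\<close>)
  then obtain t where t: "real j < t" "t < real (Suc j)" "ker_s s (Suc j) - ker_s s j = ker_st s t"
    by auto
  have "dker i j = ?h (real (Suc i)) - ?h (real i)"
    using ij by (simp add: dker_def eq)
  then have "\<bar>dker i j\<bar> = \<bar>ker_st s t\<bar>" using s t by simp
  also have "\<dots> \<le> 2 * C * (s powr (2 * \<beta> - \<alpha>) * (t - s) powr (\<alpha> - 2)) + 2 * C * (s powr (\<theta> - 1) * t powr (- \<theta>))"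
    using s t ij False by (intro ker_st_bound) auto
  also have "\<dots> \<le> 2 * C * (Suc i powr (2 * \<beta> - \<alpha>) * real (j - i - 1) powr (\<alpha> - 2)) + 2 * C * (Suc i powr (\<theta> - 1) * j powr (- \<theta>))"
    using s t ij False C_nonneg alpha beta theta
    by (intro add_mono mult_left_mono mult_mono powr_mono2 powr_mono2') (auto simp: of_nat_diff)
  finally show ?thesis .
qed

text \<open>The rectangle meets the diagonal, so only increments of \<phi> are available. An
  increment of order (1 / i)^\<alpha> is multiplied by i^(2 \<beta>), whence the exponent 2 \<beta>
  - \<alpha>.\<close>

lemma dker_near_diagonal:
  assumes "j = i \<or> j = Suc i"
  shows "\<bar>dker i j\<bar> \<le> (C + 3 * C / \<alpha>) * Suc i powr (2 * \<beta> - \<alpha>)"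
proof -
  have eq: "ker s t = s powr (2 * \<beta>) * \<phi> (t / s)" if "s \<le> t" for s t
    using that by (simp add: ker_def)
  have mono: "real i powr (2 * \<beta> - \<alpha>) \<le> Suc i powr (2 * \<beta> - \<alpha>)"
    using beta by (intro powr_mono2) auto
  have one: "1 \<le> Suc i powr (2 * \<beta> - \<alpha>)"
    using beta by (intro ge_one_powr_ge_zero) auto
  have Ca: "0 \<le> C / \<alpha>" using C_nonneg alpha by simp
  have incr: "real m powr (2 * \<beta>) * (C / \<alpha> * (c / m) powr \<alpha>) = C / \<alpha> * (c powr \<alpha> * real m powr (2 * \<beta> - \<alpha>))"
    if "m > 0" for m :: nat and c
    using that by (simp add: powr_divide powr_diff)
  show ?thesis
  proof (cases "j = i")
    case True
    \<comment> \<open>The variance of one increment is split into the growth of the variance and the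
      defect of \<phi> near 1. The first part is at most C, and \<alpha> \<le> 2 \<beta> allows a
      constant to be absorbed into \<open>Suc i powr (2 * \<beta> - \<alpha>)\<close>.\<close>
    have "dker i j = \<phi> 1 * (Suc i powr (2 * \<beta>) - i powr (2 * \<beta>)) - 2 * (i powr (2 * \<beta>) * (\<phi> (Suc i / i) - \<phi> 1))"
      using True ker_commute[of "Suc i" i] beta
      by (cases "i = 0") (simp_all add: dker_def eq algebra_simps)
    moreover have "\<bar>\<phi> 1 * (Suc i powr (2 * \<beta>) - i powr (2 * \<beta>))\<bar> \<le> C * 1"
      unfolding abs_mult
    proof (intro mult_mono)
      show "\<bar>\<phi> 1\<bar> \<le> C" using growth[of 1] by simp
      have "real i powr (2 * \<beta>) \<le> Suc i powr (2 * \<beta>)" using beta by (intro powr_mono2) auto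
      then show "\<bar>Suc i powr (2 * \<beta>) - i powr (2 * \<beta>)\<bar> \<le> 1"
        using powr_Suc_diff_le_one[of "2 * \<beta>" i] beta by simp
    qed (use C_nonneg in auto)
    moreover have "\<bar>i powr (2 * \<beta>) * (\<phi> (Suc i / i) - \<phi> 1)\<bar> \<le> C / \<alpha> * Suc i powr (2 * \<beta> - \<alpha>)"
    proof (cases "i = 0")
      case False
      have "\<bar>\<phi> (Suc i / i) - \<phi> 1\<bar> \<le> C / \<alpha> * (Suc i / i - 1) powr \<alpha>"
        using False by (intro phi_increment_1) (simp add: field_simps)
      also have "Suc i / i - 1 = 1 / real i" using False by (simp add: field_simps)
      finally have "\<bar>i powr (2 * \<beta>) * (\<phi> (Suc i / i) - \<phi> 1)\<bar> \<le> i powr (2 * \<beta>) * (C / \<alpha> * (1 / real i) powr \<alpha>)"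
        unfolding abs_mult by (intro mult_mono) auto
      also have "\<dots> = C / \<alpha> * (1 powr \<alpha> * i powr (2 * \<beta> - \<alpha>))" using False by (intro incr) simp
      also have "\<dots> \<le> C / \<alpha> * Suc i powr (2 * \<beta> - \<alpha>)"
        using mult_left_mono[OF mono Ca] by simp
      finally show ?thesis .
    qed (use Ca beta in simp)
    moreover have "C * 1 \<le> C * Suc i powr (2 * \<beta> - \<alpha>)"
      using one C_nonneg by (intro mult_left_mono)
    moreover have "0 \<le> C / \<alpha> * Suc i powr (2 * \<beta> - \<alpha>)" by (intro mult_nonneg_nonneg Ca) simp
    moreover have "(C + 3 * C / \<alpha>) * Suc i powr (2 * \<beta> - \<alpha>) = C * Suc i powr (2 * \<beta> - \<alpha>) + 3 * (C / \<alpha> * Suc i powr (2 * \<beta> - \<alpha>))"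
      by (simp add: algebra_simps)
    ultimately show ?thesis by linarith
  next
    case False
    with assms have j: "j = Suc i" by simp
    have "dker i j = Suc i powr (2 * \<beta>) * (\<phi> (Suc (Suc i) / Suc i) - \<phi> 1)
        - i powr (2 * \<beta>) * (\<phi> (Suc (Suc i) / i) - \<phi> (Suc i / i))"
      by (simp add: j dker_def eq algebra_simps)
    moreover have "\<bar>Suc i powr (2 * \<beta>) * (\<phi> (Suc (Suc i) / Suc i) - \<phi> 1)\<bar> \<le> C / \<alpha> * Suc i powr (2 * \<beta> - \<alpha>)"
    proof -
      have "\<bar>\<phi> (Suc (Suc i) / Suc i) - \<phi> 1\<bar> \<le> C / \<alpha> * (Suc (Suc i) / Suc i - 1) powr \<alpha>"
        by (intro phi_increment_1) (simp add: field_simps)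
      also have "Suc (Suc i) / Suc i - 1 = 1 / real (Suc i)" by (simp add: field_simps)
      finally have "\<bar>Suc i powr (2 * \<beta>) * (\<phi> (Suc (Suc i) / Suc i) - \<phi> 1)\<bar> \<le> Suc i powr (2 * \<beta>) * (C / \<alpha> * (1 / real (Suc i)) powr \<alpha>)"
        unfolding abs_mult by (intro mult_mono) auto
      also have "\<dots> = C / \<alpha> * (1 powr \<alpha> * Suc i powr (2 * \<beta> - \<alpha>))" by (intro incr) simp
      finally show ?thesis by simp
    qed
    moreover have "\<bar>i powr (2 * \<beta>) * (\<phi> (Suc (Suc i) / i) - \<phi> (Suc i / i))\<bar> \<le> 2 * (C / \<alpha> * Suc i powr (2 * \<beta> - \<alpha>))"
    proof (cases "i = 0")
      case False
      have "\<bar>\<phi> (Suc (Suc i) / i) - \<phi> (Suc i / i)\<bar> \<le> C / \<alpha> * ((Suc (Suc i) / i - 1) powr \<alpha> - (Suc i / i - 1) powr \<alpha>)"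
        using False by (intro phi_increment) (auto simp: field_simps)
      also have "\<dots> \<le> C / \<alpha> * (Suc (Suc i) / i - 1) powr \<alpha>"
        using Ca by (intro mult_left_mono) auto
      also have "Suc (Suc i) / i - 1 = 2 / real i" using False by (simp add: field_simps)
      finally have "\<bar>i powr (2 * \<beta>) * (\<phi> (Suc (Suc i) / i) - \<phi> (Suc i / i))\<bar> \<le> i powr (2 * \<beta>) * (C / \<alpha> * (2 / real i) powr \<alpha>)"
        unfolding abs_mult by (intro mult_mono) auto
      also have "\<dots> = C / \<alpha> * (2 powr \<alpha> * i powr (2 * \<beta> - \<alpha>))" using False by (intro incr) simp
      also have "\<dots> \<le> C / \<alpha> * (2 powr 1 * Suc i powr (2 * \<beta> - \<alpha>))"
        using Ca mono alpha by (intro mult_left_mono mult_mono powr_mono) auto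
      finally show ?thesis by (simp add: mult_ac)
    qed (use Ca beta in simp)
    moreover have "(C + 3 * C / \<alpha>) * Suc i powr (2 * \<beta> - \<alpha>) = C * Suc i powr (2 * \<beta> - \<alpha>) + 3 * (C / \<alpha> * Suc i powr (2 * \<beta> - \<alpha>))"
      by (simp add: algebra_simps)
    moreover have "0 \<le> C * Suc i powr (2 * \<beta> - \<alpha>)" using C_nonneg by simp
    ultimately show ?thesis by linarith
  qed
qed

text \<open>Comparison of the sum with the integral, in telescoping form: the right side is the
  integral of x^(-\<theta>) over [j - 1, j].\<close>

lemma powr_le_diff:
  assumes "2 \<le> j"
  shows "real j powr (- \<theta>) \<le> 1 / (\<theta> - 1) * (real (j - 1) powr (1 - \<theta>) - real j powr (1 - \<theta>))"
proof -
  let ?f = "\<lambda>x::real. - (x powr (1 - \<theta>))"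
  have "\<exists>z. real (j - 1) < z \<and> z < real j \<and> ?f (real j) - ?f (real (j - 1)) = (real j - real (j - 1)) * ((\<theta> - 1) * z powr (- \<theta>))"
    by (rule MVT2) (use assms in \<open>auto intro!: derivative_eq_intros simp: algebra_simps of_nat_diff\<close>)
  then obtain z where z: "real (j - 1) < z" "z < real j" "real (j - 1) powr (1 - \<theta>) - real j powr (1 - \<theta>) = (\<theta> - 1) * z powr (- \<theta>)"
    using assms by (auto simp: of_nat_diff)
  have "real j powr (- \<theta>) \<le> z powr (- \<theta>)"
    using z theta assms by (intro powr_mono2') auto
  then show ?thesis using z theta by simp
qed

lemma summable_powr_alpha: "summable (\<lambda>m. real m powr (\<alpha> - 2))"
  using alpha by (subst summable_real_powr_iff) auto

text \<open>The summands are the diagonal singularity on both sides, the far term to the right of i,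
  the far term to the left of i, and at most three entries next to the diagonal.\<close>

definition row_const :: real where
  "row_const = 4 * C * (\<Sum>m. real m powr (\<alpha> - 2)) + 2 * C / (\<theta> - 1) + 2 * C + 3 * (C + 3 * C / \<alpha>)"

lemma row_const_nonneg: "0 \<le> row_const"
  unfolding row_const_def using C_nonneg alpha theta
  by (intro add_nonneg_nonneg mult_nonneg_nonneg suminf_nonneg summable_powr_alpha divide_nonneg_pos) auto

text \<open>The homogeneous term sums to a constant on both sides: for j > i the factor (i +
  1)^(\<theta> - 1) meets a tail sum of j^(-\<theta>) of order (i + 1)^(1 - \<theta>), and for j < i
  each of at most i entries is at most of order 1 / i. The diagonal singularity is summable because
  \<alpha> < 1, and N^(2 \<beta> - \<alpha>) \<ge> 1 absorbs the constants.\<close>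

theorem dker_row_sum:
  assumes i: "i < N"
  shows "(\<Sum>j<N. \<bar>dker i j\<bar>) \<le> row_const * N powr (2 * \<beta> - \<alpha>)"
proof -
  let ?S = "\<Sum>m. real m powr (\<alpha> - 2)"
  let ?P = "real N powr (2 * \<beta> - \<alpha>)"
  define e1 where "e1 j = (if i + 2 \<le> j then \<bar>dker i j\<bar> else 0)" for j
  define e2 where "e2 j = (if j + 2 \<le> i then \<bar>dker i j\<bar> else 0)" for j
  \<comment> \<open>For i = 0 the truncated i - 1 coincides with i, which only makes the index set
    smaller.\<close>
  define e3 where "e3 j = (if j \<in> {i - 1, i, i + 1} then (C + 3 * C / \<alpha>) * ?P else 0)" for j
  have P1: "1 \<le> ?P" using i beta by (intro ge_one_powr_ge_zero) auto
  have mono: "Suc k powr (2 * \<beta> - \<alpha>) \<le> ?P" if "k < N" for k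
    using that beta by (intro powr_mono2) auto
  have D: "0 \<le> C + 3 * C / \<alpha>" using C_nonneg alpha by simp
  have S: "(\<Sum>m\<in>A. real m powr (\<alpha> - 2)) \<le> ?S" if "finite A" for A
    by (rule sum_le_suminf[OF summable_powr_alpha that]) simp
  have split: "\<bar>dker i j\<bar> \<le> e1 j + e2 j + e3 j" if "j < N" for j
  proof -
    consider "i + 2 \<le> j" | "j + 2 \<le> i" | "j = i \<or> j = Suc i" | "i = Suc j" by linarith
    then show ?thesis
    proof cases
      case 3
      then have "\<bar>dker i j\<bar> \<le> (C + 3 * C / \<alpha>) * Suc i powr (2 * \<beta> - \<alpha>)" by (rule dker_near_diagonal)
      also have "\<dots> \<le> (C + 3 * C / \<alpha>) * ?P" using D by (intro mult_left_mono mono i)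
      finally show ?thesis using 3 by (auto simp: e1_def e2_def e3_def)
    next
      case 4
      then have "\<bar>dker j i\<bar> \<le> (C + 3 * C / \<alpha>) * Suc j powr (2 * \<beta> - \<alpha>)" by (intro dker_near_diagonal) simp
      also have "\<dots> \<le> (C + 3 * C / \<alpha>) * ?P" using D by (intro mult_left_mono mono that)
      finally show ?thesis using 4 by (auto simp: e1_def e2_def e3_def dker_commute)
    qed (use D in \<open>auto simp: e1_def e2_def e3_def\<close>)
  qed
  have s1: "(\<Sum>j<N. e1 j) \<le> 2 * C * ?S * ?P + 2 * C / (\<theta> - 1) * ?P"
  proof -
    have "(\<Sum>j<N. e1 j) = (\<Sum>j=i+2..<N. \<bar>dker i j\<bar>)"
      unfolding e1_def sum.If_cases[OF finite_lessThan]
      by (simp, intro sum.cong) auto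
    also have "\<dots> \<le> (\<Sum>j=i+2..<N. 2 * C * ?P * real (j - i - 1) powr (\<alpha> - 2)
        + 2 * C * Suc i powr (\<theta> - 1) * (1 / (\<theta> - 1) * (real (j - 1) powr (1 - \<theta>) - real j powr (1 - \<theta>))))"
    proof (rule sum_mono)
      fix j assume j: "j \<in> {i+2..<N}"
      then have "\<bar>dker i j\<bar> \<le> 2 * C * (Suc i powr (2 * \<beta> - \<alpha>) * real (j - i - 1) powr (\<alpha> - 2)) + 2 * C * (Suc i powr (\<theta> - 1) * j powr (- \<theta>))"
        by (intro dker_off_diagonal) simp
      also have "\<dots> \<le> 2 * C * (?P * real (j - i - 1) powr (\<alpha> - 2)) + 2 * C * (Suc i powr (\<theta> - 1) * (1 / (\<theta> - 1) * (real (j - 1) powr (1 - \<theta>) - real j powr (1 - \<theta>))))"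
        using C_nonneg j i by (intro add_mono mult_left_mono mult_right_mono mono powr_le_diff) auto
      finally show "\<bar>dker i j\<bar> \<le> 2 * C * ?P * real (j - i - 1) powr (\<alpha> - 2)
        + 2 * C * Suc i powr (\<theta> - 1) * (1 / (\<theta> - 1) * (real (j - 1) powr (1 - \<theta>) - real j powr (1 - \<theta>)))"
        by (simp add: mult.assoc)
    qed
    also have "\<dots> = 2 * C * ?P * (\<Sum>j=i+2..<N. real (j - i - 1) powr (\<alpha> - 2))
        + 2 * C * Suc i powr (\<theta> - 1) * (1 / (\<theta> - 1) * (\<Sum>j=i+2..<N. real (j - 1) powr (1 - \<theta>) - real j powr (1 - \<theta>)))"
      by (simp add: sum.distrib sum_distrib_left)
    also have "\<dots> \<le> 2 * C * ?P * ?S + 2 * C * Suc i powr (\<theta> - 1) * (1 / (\<theta> - 1) * Suc i powr (1 - \<theta>))"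
    proof (intro add_mono mult_left_mono)
      have "inj_on (\<lambda>j. j - i - 1) {i+2..<N}" by (auto simp: inj_on_def)
      then have "(\<Sum>j=i+2..<N. real (j - i - 1) powr (\<alpha> - 2)) = (\<Sum>m\<in>(\<lambda>j. j - i - 1) ` {i+2..<N}. real m powr (\<alpha> - 2))"
        by (simp add: sum.reindex)
      also have "\<dots> \<le> ?S" by (rule S) simp
      finally show "(\<Sum>j=i+2..<N. real (j - i - 1) powr (\<alpha> - 2)) \<le> ?S" .
      show "(\<Sum>j=i+2..<N. real (j - 1) powr (1 - \<theta>) - real j powr (1 - \<theta>)) \<le> Suc i powr (1 - \<theta>)"
      proof (cases "i + 2 \<le> N")
        case True
        have "(\<Sum>j=i+2..<N. real (j - 1) powr (1 - \<theta>) - real j powr (1 - \<theta>))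
            = (\<Sum>j=i+2..<N. (\<lambda>j. - (real (j - 1) powr (1 - \<theta>))) (Suc j) - (\<lambda>j. - (real (j - 1) powr (1 - \<theta>))) j)"
          by simp
        also have "\<dots> = - (real (N - 1) powr (1 - \<theta>)) + real (Suc i) powr (1 - \<theta>)"
          by (subst sum_Suc_diff'[OF True]) simp
        finally show ?thesis by simp
      qed simp
    qed (use C_nonneg theta in auto)
    also have "2 * C * Suc i powr (\<theta> - 1) * (1 / (\<theta> - 1) * Suc i powr (1 - \<theta>)) = 2 * C / (\<theta> - 1) * (Suc i powr (\<theta> - 1) * Suc i powr (1 - \<theta>))"
      by (simp add: mult_ac)
    also have "real (Suc i) powr (\<theta> - 1) * Suc i powr (1 - \<theta>) = 1"
      by (simp flip: powr_add)
    also have "2 * C / (\<theta> - 1) * 1 \<le> 2 * C / (\<theta> - 1) * ?P"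
      using P1 C_nonneg theta by (intro mult_left_mono) auto
    finally show ?thesis by (simp add: mult_ac)
  qed
  have s2: "(\<Sum>j<N. e2 j) \<le> 2 * C * ?S * ?P + 2 * C * ?P"
  proof -
    let ?J = "{j. j + 2 \<le> i}"
    have fin: "finite ?J" by (rule finite_subset[of _ "{..i}"]) auto
    have "(\<Sum>j<N. e2 j) = (\<Sum>j\<in>?J. \<bar>dker i j\<bar>)"
      unfolding e2_def sum.If_cases[OF finite_lessThan]
      using i by (simp, intro sum.cong) auto
    also have "\<dots> \<le> (\<Sum>j\<in>?J. 2 * C * ?P * real (i - j - 1) powr (\<alpha> - 2) + 2 * C * (1 / real i))"
    proof (rule sum_mono)
      fix j assume j: "j \<in> ?J"
      then have "\<bar>dker i j\<bar> \<le> 2 * C * (Suc j powr (2 * \<beta> - \<alpha>) * real (i - j - 1) powr (\<alpha> - 2)) + 2 * C * (Suc j powr (\<theta> - 1) * i powr (- \<theta>))"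
        unfolding dker_commute[of i j] by (intro dker_off_diagonal) simp
      also have "\<dots> \<le> 2 * C * (?P * real (i - j - 1) powr (\<alpha> - 2)) + 2 * C * (real i powr (\<theta> - 1) * i powr (- \<theta>))"
        using C_nonneg j i theta by (intro add_mono mult_left_mono mult_right_mono mono powr_mono2) auto
      also have "real i powr (\<theta> - 1) * i powr (- \<theta>) = 1 / i"
      proof -
        have "real i powr (\<theta> - 1) * i powr (- \<theta>) = real i powr (- 1)"
          by (simp only: powr_add[symmetric]) simp
        then show ?thesis using j by (simp add: powr_minus_divide)
      qed
      finally show "\<bar>dker i j\<bar> \<le> 2 * C * ?P * real (i - j - 1) powr (\<alpha> - 2) + 2 * C * (1 / real i)"
        by (simp add: mult.assoc)
    qed
    also have "\<dots> = 2 * C * ?P * (\<Sum>j\<in>?J. real (i - j - 1) powr (\<alpha> - 2)) + 2 * C * (card ?J / i)"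
      by (simp add: sum.distrib sum_distrib_left)
    also have "\<dots> \<le> 2 * C * ?P * ?S + 2 * C * 1"
    proof (intro add_mono mult_left_mono)
      have "inj_on (\<lambda>j. i - j - 1) ?J" by (auto simp: inj_on_def)
      then have "(\<Sum>j\<in>?J. real (i - j - 1) powr (\<alpha> - 2)) = (\<Sum>m\<in>(\<lambda>j. i - j - 1) ` ?J. real m powr (\<alpha> - 2))"
        by (simp add: sum.reindex)
      also have "\<dots> \<le> ?S" by (rule S) (use fin in simp)
      finally show "(\<Sum>j\<in>?J. real (i - j - 1) powr (\<alpha> - 2)) \<le> ?S" .
      have "card ?J \<le> card {..<i}" by (intro card_mono) auto
      then show "card ?J / i \<le> (1::real)" by (cases "i = 0") (auto simp: field_simps)
    qed (use C_nonneg in auto)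
    also have "2 * C * 1 \<le> 2 * C * ?P" using P1 C_nonneg by (intro mult_left_mono) auto
    finally show ?thesis by (simp add: mult_ac)
  qed
  have s3: "(\<Sum>j<N. e3 j) \<le> 3 * (C + 3 * C / \<alpha>) * ?P"
  proof -
    have "(\<Sum>j<N. e3 j) = (\<Sum>j\<in>{..<N} \<inter> {i - 1, i, i + 1}. (C + 3 * C / \<alpha>) * ?P)"
      unfolding e3_def by (subst sum.inter_restrict) auto
    also have "\<dots> = card ({..<N} \<inter> {i - 1, i, i + 1}) * ((C + 3 * C / \<alpha>) * ?P)" by simp
    also have "\<dots> \<le> 3 * ((C + 3 * C / \<alpha>) * ?P)"
    proof (rule mult_right_mono)
      have "card ({..<N} \<inter> {i - 1, i, i + 1}) \<le> card {i - 1, i, i + 1}" by (intro card_mono) auto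
      also have "\<dots> \<le> 3" by (simp add: card_insert_if)
      finally show "real (card ({..<N} \<inter> {i - 1, i, i + 1})) \<le> 3" by simp
    qed (use D P1 in auto)
    finally show ?thesis by (simp only: mult.assoc)
  qed
  have "(\<Sum>j<N. \<bar>dker i j\<bar>) \<le> (\<Sum>j<N. e1 j + e2 j + e3 j)"
    by (intro sum_mono split) simp
  also have "\<dots> = (\<Sum>j<N. e1 j) + (\<Sum>j<N. e2 j) + (\<Sum>j<N. e3 j)"
    by (simp add: sum.distrib)
  also have "\<dots> \<le> row_const * ?P"
    using s1 s2 s3 unfolding row_const_def by (simp add: algebra_simps)
  finally show ?thesis .
qed

end

text \<open>If F1 x exceeded the bound by e > 0, then F1 y - (K / \<theta>) y^(-\<theta>), being
  nondecreasing, would stay above e, and F would grow at least linearly, against its growth of order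
  sqrt y. The statement is one-sided so that it can be applied to \<phi> and to its
  negative.\<close>

lemma derivative_upper_decay:
  fixes F F1 F2 :: "real \<Rightarrow> real"
  assumes F1: "\<And>x. 2 < x \<Longrightarrow> (F has_real_derivative F1 x) (at x)"
    and F2: "\<And>x. 2 < x \<Longrightarrow> (F1 has_real_derivative F2 x) (at x)"
    and low: "\<And>x. 2 < x \<Longrightarrow> - (K * x powr (- \<theta> - 1)) \<le> F2 x"
    and growth: "\<And>x. 2 < x \<Longrightarrow> F x \<le> B * sqrt x"
    and \<theta>: "0 < \<theta>" and x: "2 < x" and K: "0 \<le> K"
  shows "F1 x \<le> K / \<theta> * x powr (- \<theta>)"
proof (rule ccontr)
  assume neg: "\<not> F1 x \<le> K / \<theta> * x powr (- \<theta>)"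
  define e where "e = F1 x - K / \<theta> * x powr (- \<theta>)"
  have e: "0 < e" using neg by (simp add: e_def)
  have F1_ge: "e \<le> F1 y" if y: "x \<le> y" for y
  proof -
    have "F1 x - K / \<theta> * x powr (- \<theta>) \<le> F1 y - K / \<theta> * y powr (- \<theta>)"
    proof (rule DERIV_nonneg_imp_nondecreasing[OF y])
      fix z assume z: "x \<le> z" "z \<le> y"
      have "((\<lambda>y. F1 y - K / \<theta> * y powr (- \<theta>)) has_real_derivative F2 z + K * z powr (- \<theta> - 1)) (at z)"
        using z x \<theta> by (auto intro!: derivative_eq_intros F2)
      then show "\<exists>d. ((\<lambda>y. F1 y - K / \<theta> * y powr (- \<theta>)) has_real_derivative d) (at z) \<and> 0 \<le> d"
        using low[of z] z x by (intro exI[of _ "F2 z + K * z powr (- \<theta> - 1)"]) auto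
    qed
    moreover have "0 \<le> K / \<theta> * y powr (- \<theta>)" using K \<theta> by simp
    ultimately show ?thesis by (simp add: e_def)
  qed
  have F_ge: "F x + e * (y - x) \<le> F y" if y: "x \<le> y" for y
  proof -
    have "F x - e * x \<le> F y - e * y"
    proof (rule DERIV_nonneg_imp_nondecreasing[OF y])
      fix z assume z: "x \<le> z" "z \<le> y"
      have "((\<lambda>y. F y - e * y) has_real_derivative F1 z - e) (at z)"
        using z x by (auto intro!: derivative_eq_intros F1)
      then show "\<exists>d. ((\<lambda>y. F y - e * y) has_real_derivative d) (at z) \<and> 0 \<le> d"
        using F1_ge[of z] z by (intro exI[of _ "F1 z - e"]) auto
    qed
    then show ?thesis by (simp add: algebra_simps)
  qed
  \<comment> \<open>The inequality B sqrt y \<le> e y / 2 + B^2 / (2 e) spends half of the linear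
    growth; what is left bounds y.\<close>
  have bd: "e / 2 * y \<le> e * x - F x + B\<^sup>2 / (2 * e)" if y: "x \<le> y" for y
  proof -
    have y0: "0 \<le> y" using y x by simp
    have "0 \<le> (e * sqrt y - B)\<^sup>2 / (2 * e)" using e by simp
    also have "\<dots> = e / 2 * y - B * sqrt y + B\<^sup>2 / (2 * e)"
      using e y0 by (simp add: power2_diff power_mult_distrib field_simps power2_eq_square)
    finally have "B * sqrt y \<le> e / 2 * y + B\<^sup>2 / (2 * e)" by simp
    then show ?thesis using F_ge[OF y] growth[of y] y x by (simp add: algebra_simps)
  qed
  \<comment> \<open>Chosen so that e y / 2 exceeds the bound \<open>bd\<close> by at least
    1.\<close>
  define y where "y = max x ((e * x - F x + B\<^sup>2 / (2 * e) + 1) * 2 / e)"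
  have "e / 2 * ((e * x - F x + B\<^sup>2 / (2 * e) + 1) * 2 / e) \<le> e / 2 * y"
    using e by (intro mult_left_mono) (auto simp: y_def)
  moreover have "e / 2 * ((e * x - F x + B\<^sup>2 / (2 * e) + 1) * 2 / e) = e * x - F x + B\<^sup>2 / (2 * e) + 1"
    using e by simp
  ultimately show False using bd[of y] by (simp add: y_def)
qed

text \<open>The bound on F2 is integrated from x to the base point 2. On (1, 2] the power (x -
  1)^(\<alpha> - 1) is at least 1 and absorbs the value at the base point.\<close>

lemma derivative_lower_near:
  fixes F1 F2 :: "real \<Rightarrow> real"
  assumes F2: "\<And>x. 1 < x \<Longrightarrow> (F1 has_real_derivative F2 x) (at x)"
    and up: "\<And>x. 1 < x \<Longrightarrow> x \<le> 2 \<Longrightarrow> F2 x \<le> K * (x - 1) powr (\<alpha> - 2)"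
    and a: "\<alpha> < 1" and x: "1 < x" "x \<le> 2" and K: "0 \<le> K"
  shows "- ((\<bar>F1 2\<bar> + K / (1 - \<alpha>)) * (x - 1) powr (\<alpha> - 1)) \<le> F1 x"
proof -
  have "F1 2 + K / (1 - \<alpha>) * (2 - 1) powr (\<alpha> - 1) \<le> F1 x + K / (1 - \<alpha>) * (x - 1) powr (\<alpha> - 1)"
  proof (rule DERIV_nonpos_imp_nonincreasing[OF x(2)])
    fix z assume z: "x \<le> z" "z \<le> 2"
    have "((\<lambda>y. F1 y + K / (1 - \<alpha>) * (y - 1) powr (\<alpha> - 1)) has_real_derivative
        F2 z + K / (1 - \<alpha>) * ((\<alpha> - 1) * (z - 1) powr (\<alpha> - 1 - 1))) (at z)"
      using z x a by (auto intro!: derivative_eq_intros F2)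
    moreover have "K / (1 - \<alpha>) * ((\<alpha> - 1) * (z - 1) powr (\<alpha> - 1 - 1)) = - (K * (z - 1) powr (\<alpha> - 2))"
    proof -
      have "K / (1 - \<alpha>) * (\<alpha> - 1) = - K" using a by (simp add: field_simps)
      then have "K / (1 - \<alpha>) * (\<alpha> - 1) * (z - 1) powr (\<alpha> - 2) = - K * (z - 1) powr (\<alpha> - 2)" by simp
      then show ?thesis by (simp only: mult.assoc) simp
    qed
    ultimately show "\<exists>d. ((\<lambda>y. F1 y + K / (1 - \<alpha>) * (y - 1) powr (\<alpha> - 1)) has_real_derivative d) (at z) \<and> d \<le> 0"
      using up[of z] z x by (intro exI[of _ "F2 z - K * (z - 1) powr (\<alpha> - 2)"]) auto
  qed
  moreover have "0 \<le> K / (1 - \<alpha>)" using K a by simp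
  moreover have "1 \<le> (x - 1) powr (\<alpha> - 1)"
    using powr_mono'[of "\<alpha> - 1" 0 "x - 1"] x a by simp
  then have "\<bar>F1 2\<bar> * 1 \<le> \<bar>F1 2\<bar> * (x - 1) powr (\<alpha> - 1)" by (intro mult_left_mono) auto
  ultimately show ?thesis by (simp add: distrib_right)
qed

lemma selfsimilar_kernel_exists:
  fixes \<phi> :: "real \<Rightarrow> real"
  assumes alpha: "0 < \<alpha>" "\<alpha> < 1" and beta: "0 < \<beta>" "\<beta> \<le> 1/2" "\<alpha> \<le> 2 * \<beta>" and theta: "1 < \<theta>"
    and cont: "continuous_on {1..} \<phi>"
    and ck: "Ck_on 2 {1<..} \<phi>"
    and growth: "\<And>x. 1 \<le> x \<Longrightarrow> \<bar>\<phi> x\<bar> \<le> B * x powr \<beta>"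
    and C12: "C1 > 0" "C2 > 0"
    and bd: "\<And>x. x > 1 \<Longrightarrow> \<bar>(deriv ^^ 2) \<phi> x\<bar> \<le>
           C1 * indicator {1<..2} x * (x - 1) powr (\<alpha> - 2)
           + C2 * indicator {2<..} x * x powr (- \<theta> - 1)"
  shows "\<exists>C. selfsimilar_kernel \<phi> (deriv \<phi>) (deriv (deriv \<phi>)) \<alpha> \<beta> \<theta> C"
proof -
  define \<phi>1 where "\<phi>1 = deriv \<phi>"
  define \<phi>2 where "\<phi>2 = deriv \<phi>1"
  have B: "0 \<le> B" using growth[of 1] by simp
  have d1: "(\<phi> has_real_derivative \<phi>1 x) (at x)" if "1 < x" for x
    using ck that unfolding Ck_on_def \<phi>1_def
    by (auto dest!: conjunct1 spec[of _ 0] simp: DERIV_deriv_iff_real_differentiable)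
  have d2: "(\<phi>1 has_real_derivative \<phi>2 x) (at x)" if "1 < x" for x
    using ck that unfolding Ck_on_def \<phi>2_def \<phi>1_def
    by (auto dest!: conjunct1 spec[of _ 1] simp: DERIV_deriv_iff_real_differentiable)
  have b1: "\<bar>\<phi>2 x\<bar> \<le> C1 * (x - 1) powr (\<alpha> - 2)" if "1 < x" "x \<le> 2" for x
    using bd[of x] that by (simp add: \<phi>2_def \<phi>1_def numeral_2_eq_2)
  have b2: "\<bar>\<phi>2 x\<bar> \<le> C2 * x powr (- \<theta> - 1)" if "2 < x" for x
    using bd[of x] that by (simp add: \<phi>2_def \<phi>1_def numeral_2_eq_2)
  have gr: "\<bar>\<phi> x\<bar> \<le> B * sqrt x" if "2 < x" for x
  proof -
    have "\<bar>\<phi> x\<bar> \<le> B * x powr \<beta>" using growth[of x] that by simp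
    also have "\<dots> \<le> B * x powr (1/2)" using that beta B by (intro mult_left_mono powr_mono) auto
    finally show ?thesis using that by (simp add: powr_half_sqrt)
  qed
  have far0: "\<bar>\<phi>1 x\<bar> \<le> C2 / \<theta> * x powr (- \<theta>)" if x: "2 < x" for x
  proof -
    have "\<phi>1 x \<le> C2 / \<theta> * x powr (- \<theta>)"
    proof (rule derivative_upper_decay[of \<phi> \<phi>1 \<phi>2 C2 \<theta> B])
      fix z :: real assume z: "2 < z"
      show "- (C2 * z powr (- \<theta> - 1)) \<le> \<phi>2 z" using b2[OF z] by linarith
      show "\<phi> z \<le> B * sqrt z" using gr[OF z] by linarith
    qed (use d1 d2 x theta C12 in auto)
    moreover have "- \<phi>1 x \<le> C2 / \<theta> * x powr (- \<theta>)"
    proof (rule derivative_upper_decay[of "\<lambda>x. - \<phi> x" "\<lambda>x. - \<phi>1 x" "\<lambda>x. - \<phi>2 x" C2 \<theta> B])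
      fix z :: real assume z: "2 < z"
      show "- (C2 * z powr (- \<theta> - 1)) \<le> - \<phi>2 z" using b2[OF z] by linarith
      show "- \<phi> z \<le> B * sqrt z" using gr[OF z] by linarith
      show "((\<lambda>x. - \<phi> x) has_real_derivative - \<phi>1 z) (at z)" using z by (intro DERIV_minus d1) simp
      show "((\<lambda>x. - \<phi>1 x) has_real_derivative - \<phi>2 z) (at z)" using z by (intro DERIV_minus d2) simp
    qed (use x theta C12 in auto)
    ultimately show ?thesis by linarith
  qed
  let ?K = "\<bar>\<phi>1 2\<bar> + C1 / (1 - \<alpha>)"
  have near0: "\<bar>\<phi>1 x\<bar> \<le> ?K * (x - 1) powr (\<alpha> - 1)" if x: "1 < x" "x \<le> 2" for x
  proof -
    have "- (?K * (x - 1) powr (\<alpha> - 1)) \<le> \<phi>1 x"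
    proof (rule derivative_lower_near[of \<phi>1 \<phi>2])
      fix z :: real assume z: "1 < z" "z \<le> 2"
      show "\<phi>2 z \<le> C1 * (z - 1) powr (\<alpha> - 2)" using b1[OF z] by linarith
    qed (use d2 x alpha C12 in auto)
    moreover have "- ((\<bar>- \<phi>1 2\<bar> + C1 / (1 - \<alpha>)) * (x - 1) powr (\<alpha> - 1)) \<le> - \<phi>1 x"
    proof (rule derivative_lower_near[of "\<lambda>x. - \<phi>1 x" "\<lambda>x. - \<phi>2 x"])
      fix z :: real assume z: "1 < z" "z \<le> 2"
      show "- \<phi>2 z \<le> C1 * (z - 1) powr (\<alpha> - 2)" using b1[OF z] by linarith
    next
      fix z :: real assume z: "1 < z"
      show "((\<lambda>x. - \<phi>1 x) has_real_derivative - \<phi>2 z) (at z)" using z by (intro DERIV_minus d2) simp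
    qed (use x alpha C12 in auto)
    ultimately show ?thesis by simp
  qed
  \<comment> \<open>The decay obtained from the second derivative holds for x > 2 only; the second
    summand extends it to x = 2.\<close>
  define far_c where "far_c = C2 / \<theta> + \<bar>\<phi>1 2\<bar> * 2 powr \<theta>"
  have K: "0 \<le> ?K" using C12 alpha by simp
  have fc: "0 \<le> far_c" using C12 theta by (simp add: far_c_def)
  \<comment> \<open>The summands serve \<open>growth\<close>, \<open>near\<close>,
    \<open>far\<close> and \<open>second\<close>; in the last one C1 is doubled because \<phi>2 is
    multiplied by x \<le> 2 in the near regime.\<close>
  define C where "C = B + ?K + far_c + 2 * C1 + C2"
  have le: "B \<le> C" "?K \<le> C" "far_c \<le> C" "2 * C1 \<le> C" "C2 \<le> C"
    using B K fc C12 by (simp_all add: C_def)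
  have far: "\<bar>\<phi>1 x\<bar> \<le> C * x powr (- \<theta>)" if x: "2 \<le> x" for x
  proof -
    have "\<bar>\<phi>1 x\<bar> \<le> far_c * x powr (- \<theta>)"
    proof (cases "x = 2")
      case True
      have "far_c * 2 powr (- \<theta>) = C2 / \<theta> * 2 powr (- \<theta>) + \<bar>\<phi>1 2\<bar> * (2 powr \<theta> * 2 powr (- \<theta>))"
        by (simp add: far_c_def algebra_simps)
      also have "(2::real) powr \<theta> * 2 powr (- \<theta>) = 1" by (simp flip: powr_add)
      finally show ?thesis using True C12 theta by simp
    next
      case False
      have "C2 / \<theta> * x powr (- \<theta>) \<le> far_c * x powr (- \<theta>)"
        by (intro mult_right_mono) (auto simp: far_c_def)
      then show ?thesis using far0[of x] False x by simp
    qed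
    also have "\<dots> \<le> C * x powr (- \<theta>)" using le by (intro mult_right_mono) auto
    finally show ?thesis .
  qed
  have near: "\<bar>\<phi>1 x\<bar> \<le> C * (x - 1) powr (\<alpha> - 1)" if x: "1 < x" for x
  proof (cases "x \<le> 2")
    case True
    have "?K * (x - 1) powr (\<alpha> - 1) \<le> C * (x - 1) powr (\<alpha> - 1)" using le by (intro mult_right_mono) auto
    then show ?thesis using near0[OF x True] by linarith
  next
    case False
    have "x powr (- \<theta>) \<le> x powr (\<alpha> - 1)" using x theta alpha by (intro powr_mono) auto
    also have "\<dots> \<le> (x - 1) powr (\<alpha> - 1)" using x alpha by (intro powr_mono2') auto
    finally have "C * x powr (- \<theta>) \<le> C * (x - 1) powr (\<alpha> - 1)"
      using le B by (intro mult_left_mono) auto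
    then show ?thesis using far[of x] False by simp
  qed
  have second: "\<bar>x * \<phi>2 x\<bar> \<le> C * ((x - 1) powr (\<alpha> - 2) + x powr (- \<theta>))" if x: "1 < x" for x
  proof (cases "x \<le> 2")
    case True
    have "\<bar>x * \<phi>2 x\<bar> \<le> 2 * (C1 * (x - 1) powr (\<alpha> - 2))"
      unfolding abs_mult using x True b1[OF x True] by (intro mult_mono) auto
    also have "\<dots> = 2 * C1 * (x - 1) powr (\<alpha> - 2)" by simp
    also have "\<dots> \<le> C * ((x - 1) powr (\<alpha> - 2) + x powr (- \<theta>))"
      using le C12 by (intro mult_mono) auto
    finally show ?thesis .
  next
    case False
    then have "\<bar>x * \<phi>2 x\<bar> \<le> x * (C2 * x powr (- \<theta> - 1))"
      unfolding abs_mult using x b2[of x] by (intro mult_mono) auto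
    also have "\<dots> = C2 * (x * x powr (- \<theta> - 1))" by simp
    also have "x * x powr (- \<theta> - 1) = x powr (- \<theta>)" using x by (simp add: powr_mult_base)
    also have "C2 * x powr (- \<theta>) \<le> C * ((x - 1) powr (\<alpha> - 2) + x powr (- \<theta>))"
      using le C12 by (intro mult_mono) auto
    finally show ?thesis .
  qed
  have gr': "\<bar>\<phi> x\<bar> \<le> C * x powr \<beta>" if "1 \<le> x" for x
    using order.trans[OF growth[OF that] mult_right_mono[OF le(1), of "x powr \<beta>"]] by simp
  have "selfsimilar_kernel \<phi> \<phi>1 \<phi>2 \<alpha> \<beta> \<theta> C"
    by unfold_locales (fact alpha beta theta cont d1 d2 gr' near far second)+
  then show ?thesis unfolding \<phi>2_def \<phi>1_def by blast
qed

section \<open>Quadrature errors of exponentials along a Gaussian grid\<close>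

lemma Fubini_dominated:
  fixes f :: "'b \<Rightarrow> 'a \<Rightarrow> complex"
  assumes "prob_space P" "sigma_finite_measure M"
    and f [measurable]: "(\<lambda>(p, \<omega>). f p \<omega>) \<in> borel_measurable (P \<Otimes>\<^sub>M M)"
    and w: "integrable M w"
    and bd: "\<And>p \<omega>. p \<in> space P \<Longrightarrow> \<omega> \<in> space M \<Longrightarrow> norm (f p \<omega>) \<le> w \<omega>"
  shows "(CLINT \<omega>|M. CLINT p|P. f p \<omega>) = (CLINT p|P. CLINT \<omega>|M. f p \<omega>)"
proof -
  interpret P: prob_space P by fact
  interpret M: sigma_finite_measure M by fact
  interpret PM: pair_sigma_finite P M ..
  have int: "integrable M (\<lambda>\<omega>. f p \<omega>)" if "p \<in> space P" for p
    by (rule Bochner_Integration.integrable_bound[OF w]) (use that bd in \<open>auto intro!: AE_I2 order.trans[OF bd]\<close>)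
  have "integrable (P \<Otimes>\<^sub>M M) (\<lambda>(p, \<omega>). f p \<omega>)"
  proof (rule PM.Fubini_integrable)
    show "integrable P (\<lambda>p. LINT \<omega>|M. norm (case (p, \<omega>) of (p, \<omega>) \<Rightarrow> f p \<omega>))"
    proof (rule P.integrable_const_bound[where B = "LINT \<omega>|M. w \<omega>"])
      show "AE p in P. norm (LINT \<omega>|M. norm (case (p, \<omega>) of (p, \<omega>) \<Rightarrow> f p \<omega>)) \<le> (LINT \<omega>|M. w \<omega>)"
        by (intro AE_I2) (auto intro!: integral_mono integrable_norm int w bd)
    qed simp
    show "AE p in P. integrable M (\<lambda>\<omega>. case (p, \<omega>) of (p, \<omega>) \<Rightarrow> f p \<omega>)"
      using int by auto
  qed simp
  then show ?thesis by (rule PM.Fubini_integral)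
qed

lemma cnj_borel_measurable [measurable]: "cnj \<in> borel_measurable borel"
  by (intro borel_measurable_continuous_onI continuous_intros)

text \<open>The grid values form an arbitrary sequence in the Gaussian span. The instances of
  interest are X (j / n), one grid for each n.\<close>

locale gaussian_grid = A: gaussian_process M X + Q: moment_matching P V Y l
  for M :: "'a measure" and X :: "real \<Rightarrow> 'a \<Rightarrow> real"
    and P :: "'b measure" and V Y :: "'b \<Rightarrow> real" and l :: nat +
  fixes x :: "nat \<Rightarrow> 'a \<Rightarrow> real"
  assumes x_span [simp]: "\<And>j. x j \<in> A.gspan"
begin

definition D :: "nat \<Rightarrow> 'a \<Rightarrow> real" where "D j \<omega> = x (Suc j) \<omega> - x j \<omega>"

text \<open>Each interval is parametrized from its midpoint, so that reflection becomes a change of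
  sign of v and symmetric laws lose their odd moments.\<close>

definition mid :: "nat \<Rightarrow> 'a \<Rightarrow> real" where "mid j \<omega> = 1/2 * (x j \<omega> + x (Suc j) \<omega>)"

definition wave :: "real \<Rightarrow> nat \<Rightarrow> real \<Rightarrow> 'a \<Rightarrow> complex" where
  "wave u j v \<omega> = iexp (u * (mid j \<omega> + v * D j \<omega>))"

definition err :: "real \<Rightarrow> nat \<Rightarrow> 'a \<Rightarrow> complex" where
  "err u j \<omega> = (CLINT p|P. D j \<omega> * (wave u j (V p) \<omega> - wave u j (Y p) \<omega>))"

lemma D_span [simp]: "D j \<in> A.gspan"
  unfolding D_def[abs_def] by (intro A.gspan_diff) auto

lemma mid_span [simp]: "mid j \<in> A.gspan"
  unfolding mid_def[abs_def] by (intro A.gspan_cmult A.gspan_add) auto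

lemma D_measurable [measurable]: "D j \<in> borel_measurable M"
  by (rule A.gspan_measurable) simp

lemma mid_measurable [measurable]: "mid j \<in> borel_measurable M"
  by (rule A.gspan_measurable) simp

lemma wave_measurable [measurable]:
  assumes [measurable]: "f \<in> borel_measurable N" "g \<in> measurable N M" "h \<in> borel_measurable N"
  shows "(\<lambda>z. wave (h z) j (f z) (g z)) \<in> borel_measurable N"
  unfolding wave_def by measurable

lemma norm_wave [simp]: "norm (wave u j v \<omega>) = 1"
  unfolding wave_def by simp

lemma cnj_wave: "cnj (wave u j v \<omega>) = iexp (- (u * (mid j \<omega> + v * D j \<omega>)))"
  unfolding wave_def by (simp add: exp_cnj)

lemma err_measurable2 [measurable]: "(\<lambda>(u, \<omega>). err u j \<omega>) \<in> borel_measurable (borel \<Otimes>\<^sub>M M)"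
  unfolding err_def case_prod_beta
  by (rule Q.borel_measurable_lebesgue_integral) measurable

lemma err_measurable [measurable]: "err u j \<in> borel_measurable M"
  using measurable_compose[OF _ err_measurable2, of "\<lambda>\<omega>. (u, \<omega>)" M] by simp

lemma norm_err_le: "norm (err u j \<omega>) \<le> 2 * \<bar>D j \<omega>\<bar>"
proof -
  let ?f = "\<lambda>p. complex_of_real (D j \<omega>) * (wave u j (V p) \<omega> - wave u j (Y p) \<omega>)"
  have b: "norm (?f p) \<le> 2 * \<bar>D j \<omega>\<bar>" for p
    using norm_triangle_ineq4[of "wave u j (V p) \<omega>" "wave u j (Y p) \<omega>"]
    by (simp add: norm_mult mult.commute[of 2] mult_left_mono)
  have "norm (err u j \<omega>) \<le> (LINT p|P. norm (?f p))" unfolding err_def by (rule integral_norm_bound)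
  also have "\<dots> \<le> (LINT p|P. 2 * \<bar>D j \<omega>\<bar>)"
    by (rule integral_mono') (use b in auto)
  finally show ?thesis by (simp add: Q.prob_space)
qed

text \<open>Z is the difference of the phases of the two waves; the formula is the value of E
  [D_i D_j exp (i Z)] given by \<open>expectation_bilinear_iexp\<close>.\<close>

definition wave_cov :: "real \<Rightarrow> nat \<Rightarrow> nat \<Rightarrow> real \<Rightarrow> real \<Rightarrow> real" where
  "wave_cov u i j v w =
    (let Z = (\<lambda>\<omega>. (u * (mid i \<omega> - mid j \<omega>) + u * v * D i \<omega>) - u * w * D j \<omega>)
     in (A.cov (D i) (D j) - A.cov (D i) Z * A.cov (D j) Z) * exp (- A.cov Z Z / 2))"

lemma expectation_wave:
  "(CLINT \<omega>|M. D i \<omega> * D j \<omega> * (wave u i v \<omega> * cnj (wave u j w \<omega>))) = complex_of_real (wave_cov u i j v w)"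
proof -
  define Z where "Z = (\<lambda>\<omega>. (u * (mid i \<omega> - mid j \<omega>) + u * v * D i \<omega>) - u * w * D j \<omega>)"
  have Z: "Z \<in> A.gspan"
    unfolding Z_def by (intro A.gspan_diff A.gspan_add A.gspan_cmult D_span mid_span)
  have "wave u i v \<omega> * cnj (wave u j w \<omega>) = iexp (Z \<omega>)" for \<omega>
    unfolding cnj_wave unfolding wave_def Z_def by (simp add: exp_add[symmetric] algebra_simps)
  then show ?thesis
    using A.expectation_bilinear_iexp[OF D_span[of i] D_span[of j] Z]
    unfolding wave_cov_def Let_def Z_def[symmetric] by simp
qed

lemma DD_integrable: "integrable M (\<lambda>\<omega>. D i \<omega> * D j \<omega>)"
  by (intro A.gspan_integrable_mult) auto

lemma wave_cov_bounded: "\<bar>wave_cov u i j v w\<bar> \<le> (LINT \<omega>|M. \<bar>D i \<omega> * D j \<omega>\<bar>)"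
proof -
  have "norm (complex_of_real (wave_cov u i j v w)) \<le> (LINT \<omega>|M. norm (D i \<omega> * D j \<omega> * (wave u i v \<omega> * cnj (wave u j w \<omega>))))"
    unfolding expectation_wave[symmetric] by (rule integral_norm_bound)
  then show ?thesis by (simp add: norm_mult abs_mult)
qed

text \<open>Up to a factor i, u D_i times a wave is the derivative of the wave in v. So u^2 times
  \<open>wave_cov\<close> is the mixed derivative of exp (- Var Z / 2) in v and w. Expanding the
  variance of Z yields the quadratic form of \<open>gauss_kernel\<close>; its constant part is the
  prefactor, and d has the opposite sign because the second wave is conjugated.\<close>

lemma wave_cov_gauss_kernel:
  "u\<^sup>2 * wave_cov u i j v w = exp (- (u\<^sup>2 * A.cov (\<lambda>\<omega>. mid i \<omega> - mid j \<omega>) (\<lambda>\<omega>. mid i \<omega> - mid j \<omega>)) / 2) *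
    gauss_kernel (u\<^sup>2 * A.cov (D i) (D i)) (u\<^sup>2 * A.cov (D j) (D j))
      (u\<^sup>2 * A.cov (D i) (\<lambda>\<omega>. mid i \<omega> - mid j \<omega>)) (- (u\<^sup>2 * A.cov (D j) (\<lambda>\<omega>. mid i \<omega> - mid j \<omega>)))
      (u\<^sup>2 * A.cov (D i) (D j)) v w"
proof -
  define W where "W = (\<lambda>\<omega>. mid i \<omega> - mid j \<omega>)"
  have W [simp]: "W \<in> A.gspan" unfolding W_def by (intro A.gspan_diff mid_span)
  define Z where "Z = (\<lambda>\<omega>. (u * W \<omega> + u * v * D i \<omega>) - u * w * D j \<omega>)"
  note span = A.gspan_diff A.gspan_add A.gspan_cmult
  note lin = A.cov_add_left A.cov_add_right A.cov_diff_left A.cov_diff_right A.cov_cmult_left A.cov_cmult_right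
  have c1: "A.cov (D i) Z = u * A.cov (D i) W + u * v * A.cov (D i) (D i) - u * w * A.cov (D i) (D j)"
    unfolding Z_def by (simp add: lin span)
  have c2: "A.cov (D j) Z = u * A.cov (D j) W + u * v * A.cov (D i) (D j) - u * w * A.cov (D j) (D j)"
    unfolding Z_def by (simp add: lin span A.cov_commute[of "D j" "D i"])
  have c3: "A.cov Z Z = u\<^sup>2 * (A.cov W W + v\<^sup>2 * A.cov (D i) (D i) + w\<^sup>2 * A.cov (D j) (D j)
      + 2 * v * A.cov (D i) W - 2 * w * A.cov (D j) W - 2 * v * w * A.cov (D i) (D j))"
    unfolding Z_def
    by (simp add: lin span A.cov_commute[of "D j" "D i"] A.cov_commute[of W "D i"] A.cov_commute[of W "D j"])
      (simp add: algebra_simps power2_eq_square)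
  have G: "wave_cov u i j v w = (A.cov (D i) (D j) - A.cov (D i) Z * A.cov (D j) Z) * exp (- A.cov Z Z / 2)"
    unfolding wave_cov_def Let_def Z_def W_def by simp
  have e: "exp (- A.cov Z Z / 2) = exp (- (u\<^sup>2 * A.cov W W) / 2) *
      (exp (- (u\<^sup>2 * A.cov (D i) (D i)) * v\<^sup>2 / 2 - u\<^sup>2 * A.cov (D i) W * v) *
       exp (- (u\<^sup>2 * A.cov (D j) (D j)) * w\<^sup>2 / 2 - (- (u\<^sup>2 * A.cov (D j) W)) * w) *
       exp (u\<^sup>2 * A.cov (D i) (D j) * v * w))"
    unfolding c3 exp_add[symmetric] by (rule arg_cong[where f = exp]) (simp add: field_simps)
  have "u\<^sup>2 * (A.cov (D i) (D j) - A.cov (D i) Z * A.cov (D j) Z) =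
      u\<^sup>2 * A.cov (D i) (D j) + (- (u\<^sup>2 * A.cov (D i) (D i)) * v - u\<^sup>2 * A.cov (D i) W + u\<^sup>2 * A.cov (D i) (D j) * w) *
      (- (u\<^sup>2 * A.cov (D j) (D j)) * w - (- (u\<^sup>2 * A.cov (D j) W)) + u\<^sup>2 * A.cov (D i) (D j) * v)"
    unfolding c1 c2 by (simp add: algebra_simps power2_eq_square)
  then show ?thesis
    unfolding G e gauss_kernel_def W_def[symmetric] by (simp add: mult_ac)
qed

lemma wave_cov_measurable [measurable]: "(\<lambda>w. wave_cov u i j v w) \<in> borel_measurable borel" "(\<lambda>v. wave_cov u i j v w) \<in> borel_measurable borel"
proof -
  have "wave_cov u i j v w = Re (CLINT \<omega>|M. D i \<omega> * D j \<omega> * (wave u i v \<omega> * cnj (wave u j w \<omega>)))" for v w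
    by (subst expectation_wave) simp
  moreover have "(\<lambda>w. CLINT \<omega>|M. D i \<omega> * D j \<omega> * (wave u i v \<omega> * cnj (wave u j w \<omega>))) \<in> borel_measurable borel"
    unfolding cnj_wave by (rule A.borel_measurable_lebesgue_integral) measurable
  moreover have "(\<lambda>v. CLINT \<omega>|M. D i \<omega> * D j \<omega> * (wave u i v \<omega> * cnj (wave u j w \<omega>))) \<in> borel_measurable borel"
    by (rule A.borel_measurable_lebesgue_integral) measurable
  ultimately show "(\<lambda>w. wave_cov u i j v w) \<in> borel_measurable borel" "(\<lambda>v. wave_cov u i j v w) \<in> borel_measurable borel"
    by simp_all
qed

text \<open>Fubini for each of the two errors, dominated by 4 |D_i D_j|; the four products of waves
  give the two differences in \<open>kap\<close>.\<close>

lemma expectation_err: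
  "(CLINT \<omega>|M. err u i \<omega> * cnj (err u j \<omega>)) = complex_of_real (Q.kap (\<lambda>v. Q.kap (wave_cov u i j v)))"
proof -
  define T where "T k p \<omega> = complex_of_real (D k \<omega>) * (wave u k (V p) \<omega> - wave u k (Y p) \<omega>)" for k p \<omega>
  have T_norm: "norm (T k p \<omega>) \<le> 2 * \<bar>D k \<omega>\<bar>" for k p \<omega>
    using norm_triangle_ineq4[of "wave u k (V p) \<omega>" "wave u k (Y p) \<omega>"]
    by (simp add: T_def norm_mult mult.commute[of 2] mult_left_mono)
  have err: "err u k \<omega> = (CLINT p|P. T k p \<omega>)" for k \<omega> unfolding err_def T_def ..
  have T_meas [measurable]: "(\<lambda>(p, \<omega>). T k p \<omega>) \<in> borel_measurable (P \<Otimes>\<^sub>M M)" for k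
    unfolding T_def by measurable
  have w: "integrable M (\<lambda>\<omega>. 4 * \<bar>D i \<omega> * D j \<omega>\<bar>)"
    using DD_integrable by auto
  have bd: "norm a * norm b \<le> 4 * \<bar>D i \<omega> * D j \<omega>\<bar>"
    if "norm a \<le> 2 * \<bar>D i \<omega>\<bar>" "norm b \<le> 2 * \<bar>D j \<omega>\<bar>" for a b :: complex and \<omega>
    using mult_mono[OF that] by (simp add: abs_mult)
  have "(CLINT \<omega>|M. err u i \<omega> * cnj (err u j \<omega>)) = (CLINT \<omega>|M. CLINT p|P. T i p \<omega> * cnj (err u j \<omega>))"
    unfolding err[of i] by simp
  also have "\<dots> = (CLINT p|P. CLINT \<omega>|M. T i p \<omega> * cnj (err u j \<omega>))"
  proof (rule Fubini_dominated[OF Q.prob_space_axioms A.sigma_finite_measure_axioms _ w])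
    show "norm (T i p \<omega> * cnj (err u j \<omega>)) \<le> 4 * \<bar>D i \<omega> * D j \<omega>\<bar>" for p \<omega>
      unfolding norm_mult complex_mod_cnj by (intro bd T_norm norm_err_le)
  qed measurable
  also have "\<dots> = (CLINT p|P. complex_of_real (Q.kap (wave_cov u i j (V p)) - Q.kap (wave_cov u i j (Y p))))"
  proof (intro Bochner_Integration.integral_cong refl)
    fix p assume p: "p \<in> space P"
    have "(CLINT \<omega>|M. T i p \<omega> * cnj (err u j \<omega>)) = (CLINT \<omega>|M. CLINT p'|P. T i p \<omega> * cnj (T j p' \<omega>))"
      unfolding err[of j] by (simp flip: integral_cnj)
    also have "\<dots> = (CLINT p'|P. CLINT \<omega>|M. T i p \<omega> * cnj (T j p' \<omega>))"
    proof (rule Fubini_dominated[OF Q.prob_space_axioms A.sigma_finite_measure_axioms _ w])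
      show "norm (T i p \<omega> * cnj (T j p' \<omega>)) \<le> 4 * \<bar>D i \<omega> * D j \<omega>\<bar>" for p' \<omega>
        unfolding norm_mult complex_mod_cnj by (intro bd T_norm)
      have [measurable]: "T i p \<in> borel_measurable M"
        unfolding T_def by measurable
      show "(\<lambda>(p', \<omega>). T i p \<omega> * cnj (T j p' \<omega>)) \<in> borel_measurable (P \<Otimes>\<^sub>M M)"
        by measurable
    qed
    also have "\<dots> = (CLINT p'|P. complex_of_real ((wave_cov u i j (V p) (V p') - wave_cov u i j (V p) (Y p')) - (wave_cov u i j (Y p) (V p') - wave_cov u i j (Y p) (Y p'))))"
    proof (intro Bochner_Integration.integral_cong refl)
      fix p'
      have int: "integrable M (\<lambda>\<omega>. complex_of_real (D i \<omega> * D j \<omega>) * (wave u i v \<omega> * cnj (wave u j w \<omega>)))" for v w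
        by (rule Bochner_Integration.integrable_bound[OF DD_integrable[of i j]]) (auto simp: norm_mult abs_mult)
      have "(CLINT \<omega>|M. T i p \<omega> * cnj (T j p' \<omega>)) = (CLINT \<omega>|M.
         (D i \<omega> * D j \<omega> * (wave u i (V p) \<omega> * cnj (wave u j (V p') \<omega>)) - D i \<omega> * D j \<omega> * (wave u i (V p) \<omega> * cnj (wave u j (Y p') \<omega>)))
         - (D i \<omega> * D j \<omega> * (wave u i (Y p) \<omega> * cnj (wave u j (V p') \<omega>)) - D i \<omega> * D j \<omega> * (wave u i (Y p) \<omega> * cnj (wave u j (Y p') \<omega>))))"
        by (intro Bochner_Integration.integral_cong refl) (simp add: T_def algebra_simps)
      also have "\<dots> = complex_of_real ((wave_cov u i j (V p) (V p') - wave_cov u i j (V p) (Y p')) - (wave_cov u i j (Y p) (V p') - wave_cov u i j (Y p) (Y p')))"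
        by (simp only: Bochner_Integration.integral_diff int Bochner_Integration.integrable_diff expectation_wave of_real_diff)
      finally show "(CLINT \<omega>|M. T i p \<omega> * cnj (T j p' \<omega>)) = complex_of_real ((wave_cov u i j (V p) (V p') - wave_cov u i j (V p) (Y p')) - (wave_cov u i j (Y p) (V p') - wave_cov u i j (Y p) (Y p')))" .
    qed
    also have "\<dots> = complex_of_real (Q.kap (wave_cov u i j (V p)) - Q.kap (wave_cov u i j (Y p)))"
    proof -
      have int: "integrable P (\<lambda>p'. wave_cov u i j v (V p') - wave_cov u i j v (Y p'))" for v
        by (intro Bochner_Integration.integrable_diff Q.integrable_const_bound[where B = "LINT \<omega>|M. \<bar>D i \<omega> * D j \<omega>\<bar>"])
           (use wave_cov_bounded in auto)
      show ?thesis
        unfolding Q.kap_def integral_complex_of_real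
        by (subst Bochner_Integration.integral_diff[OF int int]) simp
    qed
    finally show "(CLINT \<omega>|M. T i p \<omega> * cnj (err u j \<omega>)) = complex_of_real (Q.kap (wave_cov u i j (V p)) - Q.kap (wave_cov u i j (Y p)))" .
  qed
  also have "\<dots> = complex_of_real (Q.kap (\<lambda>v. Q.kap (wave_cov u i j v)))"
    unfolding integral_complex_of_real by (simp add: Q.kap_def[of "\<lambda>v. Q.kap (wave_cov u i j v)"])
  finally show ?thesis .
qed

end

context gaussian_grid
begin

section \<open>First and second moments of the error sums\<close>

definition bilinear_const :: real where "bilinear_const = exp 1 * geo_const\<^sup>2"

lemma bilinear_const_nonneg: "0 \<le> bilinear_const"
  unfolding bilinear_const_def by simp

lemma cov_D_D_nonneg: "0 \<le> A.cov (D i) (D i)"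
  unfolding A.cov_def by (intro Bochner_Integration.integral_nonneg) auto

text \<open>The choice q^2 = 2 u^2 B has its factor 2 from the covariances with a difference of two
  midpoints. In the product |c| |d| only one factor is bounded uniformly; the other is kept for the
  summation over pairs. Finally the factor u^2 of \<open>wave_cov_gauss_kernel\<close> is divided
  out.\<close>

lemma expectation_err_bound:
  assumes B: "2 * u\<^sup>2 * B \<le> 1" and u: "u \<noteq> 0"
    and var: "\<bar>A.cov (D i) (D i)\<bar> \<le> B" "\<bar>A.cov (D j) (D j)\<bar> \<le> B" "\<bar>A.cov (D i) (D j)\<bar> \<le> B"
    and c: "\<bar>A.cov (D i) (\<lambda>\<omega>. mid i \<omega> - mid j \<omega>)\<bar> \<le> 2 * B"
    and d: "\<bar>A.cov (D j) (\<lambda>\<omega>. mid i \<omega> - mid j \<omega>)\<bar> \<le> 2 * B"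
  shows "\<bar>Q.kap (\<lambda>v. Q.kap (wave_cov u i j v))\<bar> \<le> bilinear_const * (2 * u\<^sup>2 * B) ^ (2 * l) *
    (2 * u\<^sup>2 * B * \<bar>A.cov (D i) (\<lambda>\<omega>. mid i \<omega> - mid j \<omega>)\<bar> + \<bar>A.cov (D i) (D j)\<bar>)"
proof -
  let ?W = "\<lambda>\<omega>. mid i \<omega> - mid j \<omega>"
  let ?a = "u\<^sup>2 * A.cov (D i) (D i)" and ?b = "u\<^sup>2 * A.cov (D j) (D j)"
  let ?c = "u\<^sup>2 * A.cov (D i) ?W" and ?d = "- (u\<^sup>2 * A.cov (D j) ?W)" and ?r = "u\<^sup>2 * A.cov (D i) (D j)"
  let ?K = "exp (- (u\<^sup>2 * A.cov ?W ?W) / 2)"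
  define q where "q = sqrt (2 * u\<^sup>2 * B)"
  have B0: "0 \<le> B" using var by linarith
  have q: "0 \<le> q" "q \<le> 1" using B B0 by (auto simp: q_def)
  have q2: "q\<^sup>2 = 2 * u\<^sup>2 * B" using B0 by (simp add: q_def)
  have le1: "\<bar>u\<^sup>2 * z\<bar> \<le> q\<^sup>2" if "\<bar>z\<bar> \<le> 2 * B" for z
    using mult_left_mono[OF that, of "u\<^sup>2"] by (simp add: q2 abs_mult mult_ac)
  have le2: "\<bar>u\<^sup>2 * z\<bar> \<le> q\<^sup>2" if "\<bar>z\<bar> \<le> B" for z
    using le1[of z] that B0 by simp
  have qp: "q ^ (4 * l) = (2 * u\<^sup>2 * B) ^ (2 * l)"
    unfolding q2[symmetric] power_mult[symmetric] by simp
  have "u\<^sup>2 * Q.kap (\<lambda>v. Q.kap (wave_cov u i j v)) = Q.kap (\<lambda>v. Q.kap (\<lambda>w. u\<^sup>2 * wave_cov u i j v w))"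
    by (simp only: Q.kap_cmult)
  also have "\<dots> = ?K * Q.kap (\<lambda>v. Q.kap (gauss_kernel ?a ?b ?c ?d ?r v))"
    unfolding wave_cov_gauss_kernel by (simp only: Q.kap_cmult)
  finally have eq: "u\<^sup>2 * Q.kap (\<lambda>v. Q.kap (wave_cov u i j v)) = ?K * Q.kap (\<lambda>v. Q.kap (gauss_kernel ?a ?b ?c ?d ?r v))" .
  have "0 \<le> A.cov ?W ?W" unfolding A.cov_def by (intro Bochner_Integration.integral_nonneg) auto
  then have K: "?K \<le> 1" by simp
  have "u\<^sup>2 * \<bar>Q.kap (\<lambda>v. Q.kap (wave_cov u i j v))\<bar> = ?K * \<bar>Q.kap (\<lambda>v. Q.kap (gauss_kernel ?a ?b ?c ?d ?r v))\<bar>"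
    using arg_cong[OF eq, of abs] by (simp add: abs_mult)
  also have "\<dots> \<le> \<bar>Q.kap (\<lambda>v. Q.kap (gauss_kernel ?a ?b ?c ?d ?r v))\<bar>"
    using K by (intro mult_left_le_one_le) auto
  also have "\<dots> \<le> exp 1 * geo_const\<^sup>2 * q ^ (4 * l) * (\<bar>?c\<bar> * \<bar>?d\<bar> + \<bar>?r\<bar>)"
    using le1[OF d] by (intro Q.kap_kap_gauss_kernel_bound q le1 le2 var c) simp
  also have "\<dots> \<le> exp 1 * geo_const\<^sup>2 * q ^ (4 * l) * (\<bar>?c\<bar> * (2 * u\<^sup>2 * B) + \<bar>?r\<bar>)"
    using le1[OF d] q q2 by (intro mult_left_mono add_mono) auto
  also have "\<dots> = u\<^sup>2 * (bilinear_const * (2 * u\<^sup>2 * B) ^ (2 * l) * (2 * u\<^sup>2 * B * \<bar>A.cov (D i) ?W\<bar> + \<bar>A.cov (D i) (D j)\<bar>))"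
    unfolding qp bilinear_const_def by (simp add: abs_mult algebra_simps)
  finally show ?thesis using u by simp
qed

lemma err_integrable: "integrable M (err u j)"
  by (rule Bochner_Integration.integrable_bound[OF integrable_mult_right[OF A.gspan_integrable[OF D_span[of j]], of 2]])
    (use norm_err_le in \<open>auto simp: abs_mult\<close>)

lemma err_mult_integrable: "integrable M (\<lambda>\<omega>. err u i \<omega> * cnj (err u j \<omega>))"
proof (rule Bochner_Integration.integrable_bound[OF integrable_mult_right[OF DD_integrable, of 4]])
  show "AE \<omega> in M. norm (err u i \<omega> * cnj (err u j \<omega>)) \<le> norm (4 * (D i \<omega> * D j \<omega>))"
  proof (rule AE_I2)
    fix \<omega>
    show "norm (err u i \<omega> * cnj (err u j \<omega>)) \<le> norm (4 * (D i \<omega> * D j \<omega>))"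
      using mult_mono[OF norm_err_le[of u i \<omega>] norm_err_le[of u j \<omega>]] by (simp add: norm_mult abs_mult)
  qed
qed measurable

definition err_sum :: "nat \<Rightarrow> real \<Rightarrow> 'a \<Rightarrow> complex" where
  "err_sum N u \<omega> = (\<Sum>j<N. err u j \<omega>)"

lemma err_sum_measurable2 [measurable]: "(\<lambda>(u, \<omega>). err_sum N u \<omega>) \<in> borel_measurable (borel \<Otimes>\<^sub>M M)"
proof -
  have "(\<lambda>p. \<Sum>j<N. (\<lambda>(u, \<omega>). err u j \<omega>) p) \<in> borel_measurable (borel \<Otimes>\<^sub>M M)"
    by (intro borel_measurable_sum err_measurable2)
  then show ?thesis by (simp add: err_sum_def case_prod_beta)
qed

lemma err_sum_integrable: "integrable M (err_sum N u)"
  unfolding err_sum_def[abs_def] by (intro Bochner_Integration.integrable_sum err_integrable)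

lemma err_0 [simp]: "err 0 j \<omega> = 0"
  unfolding err_def wave_def by simp

text \<open>No cancellation is used: each error is at most 2 |D|, and E |D| is at most the standard
  deviation. The bound is uniform in u, so it serves for high frequencies and for the integrability
  in Fubini.\<close>

lemma err_sum_trivial_bound:
  assumes "\<And>i. i < N \<Longrightarrow> A.cov (D i) (D i) \<le> B"
  shows "(LINT \<omega>|M. norm (err_sum N u \<omega>)) \<le> 2 * real N * sqrt B"
proof -
  have Dj: "(LINT \<omega>|M. \<bar>D j \<omega>\<bar>) \<le> sqrt B" if "j < N" for j
  proof -
    have i1: "integrable M (\<lambda>\<omega>. \<bar>D j \<omega>\<bar>)" using A.gspan_integrable[OF D_span[of j]] by simp
    have i2: "integrable M (\<lambda>\<omega>. \<bar>D j \<omega>\<bar>\<^sup>2)" using DD_integrable[of j j] by (simp add: power2_eq_square)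
    have "0 \<le> A.variance (\<lambda>\<omega>. \<bar>D j \<omega>\<bar>)" by (rule A.variance_positive)
    then have "(LINT \<omega>|M. \<bar>D j \<omega>\<bar>)\<^sup>2 \<le> A.cov (D j) (D j)"
      unfolding A.variance_eq[OF i1 i2] by (simp add: A.cov_def power2_eq_square)
    also have "\<dots> \<le> B" using assms that by blast
    finally show ?thesis by (rule real_le_rsqrt)
  qed
  have "(LINT \<omega>|M. norm (err_sum N u \<omega>)) \<le> (LINT \<omega>|M. (\<Sum>j<N. 2 * \<bar>D j \<omega>\<bar>))"
  proof (rule integral_mono)
    show "integrable M (\<lambda>\<omega>. norm (err_sum N u \<omega>))" by (intro integrable_norm err_sum_integrable)
    show "integrable M (\<lambda>\<omega>. \<Sum>j<N. 2 * \<bar>D j \<omega>\<bar>)"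
      using A.gspan_integrable[OF D_span] by auto
    show "norm (err_sum N u \<omega>) \<le> (\<Sum>j<N. 2 * \<bar>D j \<omega>\<bar>)" for \<omega>
      unfolding err_sum_def by (intro order.trans[OF norm_sum] sum_mono norm_err_le)
  qed
  also have "\<dots> = (\<Sum>j<N. 2 * (LINT \<omega>|M. \<bar>D j \<omega>\<bar>))"
    using A.gspan_integrable[OF D_span] by (subst Bochner_Integration.integral_sum) auto
  also have "\<dots> \<le> (\<Sum>j<N. 2 * sqrt B)" by (intro sum_mono mult_left_mono Dj) auto
  finally show ?thesis by (simp add: mult_ac)
qed

text \<open>Since x k is the sum of the increments before k, its covariance with D i is a partial
  row sum, so B bounds the covariances with grid values and midpoints too. Over all pairs the
  covariances of increments sum to at most N B, and the cross terms to u^2 B times N W up to a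
  constant.\<close>

theorem err_sum_bound:
  assumes x0: "\<And>\<omega>. \<omega> \<in> space M \<Longrightarrow> x 0 \<omega> = 0"
    and row: "\<And>i. i < N \<Longrightarrow> (\<Sum>j<N. \<bar>A.cov (D i) (D j)\<bar>) \<le> B"
    and var: "\<And>k. k \<le> N \<Longrightarrow> (\<Sum>i<N. \<bar>A.cov (D i) (x k)\<bar>) \<le> W"
    and mono: "\<And>i. A.cov (x i) (x i) \<le> A.cov (x (Suc i)) (x (Suc i))"
    and B: "2 * u\<^sup>2 * B \<le> 1" and B0: "0 \<le> B"
  shows "(LINT \<omega>|M. norm (err_sum N u \<omega>)) \<le>
    sqrt (bilinear_const * (2 * u\<^sup>2 * B) ^ (2 * l) * (N * B * (1 + 4 * u\<^sup>2 * W)))"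
proof (cases "u = 0")
  \<comment> \<open>The bound for a pair was divided by u^2; at u = 0 all errors vanish
    anyway.\<close>
  case True
  have "0 \<le> W" by (rule order.trans[OF _ var[of 0]]) (auto intro: sum_nonneg)
  then show ?thesis using B0 bilinear_const_nonneg True by (simp add: err_sum_def)
next
  case u: False
  have W0: "0 \<le> W" by (rule order.trans[OF _ var[of 0]]) (auto intro: sum_nonneg)
  have cov0: "A.cov Z (x 0) = 0" for Z
  proof -
    have "A.cov Z (x 0) = (LINT \<omega>|M. 0)"
      unfolding A.cov_def by (rule Bochner_Integration.integral_cong) (auto simp: x0)
    then show ?thesis by simp
  qed
  have elem: "\<bar>A.cov (D i) (D j)\<bar> \<le> B" if "i < N" "j < N" for i j
    by (rule order.trans[OF member_le_sum[of j "{..<N}" "\<lambda>j. \<bar>A.cov (D i) (D j)\<bar>"] row]) (use that in auto)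
  have Dx: "A.cov (D i) (x k) = (\<Sum>j<k. A.cov (D i) (D j))" for i k
  proof (induction k)
    case 0
    show ?case using cov0 by simp
  next
    case (Suc k)
    have Dk: "D k = (\<lambda>\<omega>. x (Suc k) \<omega> - x k \<omega>)" by (simp add: D_def[abs_def])
    have "A.cov (D i) (D k) = A.cov (D i) (x (Suc k)) - A.cov (D i) (x k)"
      by (subst Dk) (intro A.cov_diff_right x_span D_span)
    then show ?case using Suc by simp
  qed
  have Dx_le: "\<bar>A.cov (D i) (x k)\<bar> \<le> B" if "i < N" "k \<le> N" for i k
  proof -
    have "\<bar>A.cov (D i) (x k)\<bar> \<le> (\<Sum>j<k. \<bar>A.cov (D i) (D j)\<bar>)" unfolding Dx by (rule sum_abs)
    also have "\<dots> \<le> (\<Sum>j<N. \<bar>A.cov (D i) (D j)\<bar>)" using that by (intro sum_mono2) auto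
    also have "\<dots> \<le> B" using row that by blast
    finally show ?thesis .
  qed
  have Dmid: "A.cov (D i) (mid k) = (A.cov (D i) (x k) + A.cov (D i) (x (Suc k))) / 2" for i k
  proof -
    have "A.cov (D i) (mid k) = 1/2 * A.cov (D i) (\<lambda>\<omega>. x k \<omega> + x (Suc k) \<omega>)"
      unfolding mid_def[abs_def] by (rule A.cov_cmult_right)
    then show ?thesis by (simp add: A.cov_add_right)
  qed
  have Dmid_le: "\<bar>A.cov (D i) (mid k)\<bar> \<le> B" if "i < N" "k < N" for i k
    using Dx_le[of i k] Dx_le[of i "Suc k"] that unfolding Dmid by auto
  define c where "c i j = A.cov (D i) (\<lambda>\<omega>. mid i \<omega> - mid j \<omega>)" for i j
  have c_split: "A.cov (D k) (\<lambda>\<omega>. mid i \<omega> - mid j \<omega>) = A.cov (D k) (mid i) - A.cov (D k) (mid j)" for i j k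
    by (intro A.cov_diff_right) auto
  have c_le: "\<bar>A.cov (D k) (\<lambda>\<omega>. mid i \<omega> - mid j \<omega>)\<bar> \<le> 2 * B" if "i < N" "j < N" "k < N" for i j k
    using Dmid_le[of k i] Dmid_le[of k j] that unfolding c_split by linarith
  \<comment> \<open>On the diagonal the covariance is half the increment of the variance,
    nonnegative by \<open>mono\<close>. The absolute values therefore telescope to half the variance
    of x N, which is a sum of covariances bounded by W.\<close>
  have sum_diag: "(\<Sum>i<N. \<bar>A.cov (D i) (mid i)\<bar>) \<le> W / 2"
  proof -
    have dm: "A.cov (D i) (mid i) = (A.cov (x (Suc i)) (x (Suc i)) - A.cov (x i) (x i)) / 2" for i
      unfolding Dmid unfolding D_def[abs_def]
      by (simp add: A.cov_diff_left A.cov_commute[of "x (Suc i)" "x i"])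
    have "(\<Sum>i<N. \<bar>A.cov (D i) (mid i)\<bar>) = (\<Sum>i<N. (A.cov (x (Suc i)) (x (Suc i)) - A.cov (x i) (x i)) / 2)"
      using mono by (intro sum.cong) (auto simp: dm)
    also have "\<dots> = (\<Sum>i<N. A.cov (x (Suc i)) (x (Suc i)) - A.cov (x i) (x i)) / 2"
      by (simp add: sum_divide_distrib)
    also have "(\<Sum>i<N. A.cov (x (Suc i)) (x (Suc i)) - A.cov (x i) (x i)) = A.cov (x N) (x N)"
      by (subst sum_lessThan_telescope) (simp add: cov0)
    also have "A.cov (x N) (x N) = (\<Sum>i<N. A.cov (D i) (x N))"
    proof -
      have "(\<Sum>i<N. A.cov (D i) (x N)) = (\<Sum>i<N. A.cov (x (Suc i)) (x N) - A.cov (x i) (x N))"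
        unfolding D_def[abs_def] by (intro sum.cong A.cov_diff_left) auto
      also have "\<dots> = A.cov (x N) (x N) - A.cov (x 0) (x N)"
        by (rule sum_lessThan_telescope)
      finally show ?thesis using cov0[of "x N"] A.cov_commute[of "x 0" "x N"] by simp
    qed
    also have "\<dots> \<le> (\<Sum>i<N. \<bar>A.cov (D i) (x N)\<bar>)" by (intro sum_mono) auto
    also have "\<dots> \<le> W" by (rule var) simp
    finally show ?thesis by (simp add: divide_right_mono)
  qed
  have sum_col: "(\<Sum>i<N. \<bar>A.cov (D i) (mid j)\<bar>) \<le> W" if "j < N" for j
  proof -
    have "(\<Sum>i<N. \<bar>A.cov (D i) (mid j)\<bar>) \<le> (\<Sum>i<N. (\<bar>A.cov (D i) (x j)\<bar> + \<bar>A.cov (D i) (x (Suc j))\<bar>) / 2)"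
      unfolding Dmid by (intro sum_mono) auto
    also have "\<dots> = ((\<Sum>i<N. \<bar>A.cov (D i) (x j)\<bar>) + (\<Sum>i<N. \<bar>A.cov (D i) (x (Suc j))\<bar>)) / 2"
      by (simp add: sum_divide_distrib[symmetric] sum.distrib)
    also have "\<dots> \<le> W" using var[of j] var[of "Suc j"] that by simp
    finally show ?thesis .
  qed
  have sum_c: "(\<Sum>i<N. \<Sum>j<N. \<bar>c i j\<bar>) \<le> 2 * N * W"
  proof -
    have "(\<Sum>i<N. \<Sum>j<N. \<bar>c i j\<bar>) \<le> (\<Sum>i<N. \<Sum>j<N. \<bar>A.cov (D i) (mid i)\<bar> + \<bar>A.cov (D i) (mid j)\<bar>)"
      unfolding c_def c_split by (intro sum_mono) auto
    also have "\<dots> = N * (\<Sum>i<N. \<bar>A.cov (D i) (mid i)\<bar>) + (\<Sum>i<N. \<Sum>j<N. \<bar>A.cov (D i) (mid j)\<bar>)"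
      by (simp add: sum.distrib sum_distrib_left)
    also have "(\<Sum>i<N. \<Sum>j<N. \<bar>A.cov (D i) (mid j)\<bar>) = (\<Sum>j<N. \<Sum>i<N. \<bar>A.cov (D i) (mid j)\<bar>)"
      by (rule sum.swap)
    also have "N * (\<Sum>i<N. \<bar>A.cov (D i) (mid i)\<bar>) + \<dots> \<le> N * W + (\<Sum>j<N. W)"
      using sum_diag W0 by (intro add_mono mult_left_mono sum_mono sum_col) auto
    finally show ?thesis by (simp add: mult_ac)
  qed
  define K where "K = bilinear_const * (2 * u\<^sup>2 * B) ^ (2 * l)"
  have K0: "0 \<le> K" unfolding K_def using bilinear_const_nonneg B0 by simp
  have "(CLINT \<omega>|M. err_sum N u \<omega> * cnj (err_sum N u \<omega>)) = (\<Sum>i<N. \<Sum>j<N. CLINT \<omega>|M. err u i \<omega> * cnj (err u j \<omega>))"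
    unfolding err_sum_def cnj_sum sum_product
    by (simp add: Bochner_Integration.integral_sum err_mult_integrable Bochner_Integration.integrable_sum)
  also have "\<dots> = complex_of_real (\<Sum>i<N. \<Sum>j<N. Q.kap (\<lambda>v. Q.kap (wave_cov u i j v)))"
    by (simp add: expectation_err)
  finally have L2: "(CLINT \<omega>|M. err_sum N u \<omega> * cnj (err_sum N u \<omega>)) = complex_of_real (\<Sum>i<N. \<Sum>j<N. Q.kap (\<lambda>v. Q.kap (wave_cov u i j v)))" .
  have norm2: "err_sum N u \<omega> * cnj (err_sum N u \<omega>) = complex_of_real ((norm (err_sum N u \<omega>))\<^sup>2)" for \<omega>
    by (rule complex_norm_square[symmetric])
  have L2': "(LINT \<omega>|M. (norm (err_sum N u \<omega>))\<^sup>2) = (\<Sum>i<N. \<Sum>j<N. Q.kap (\<lambda>v. Q.kap (wave_cov u i j v)))"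
    using L2 unfolding norm2 integral_complex_of_real of_real_eq_iff .
  have "(\<Sum>i<N. \<Sum>j<N. Q.kap (\<lambda>v. Q.kap (wave_cov u i j v))) \<le> (\<Sum>i<N. \<Sum>j<N. K * (2 * u\<^sup>2 * B * \<bar>c i j\<bar> + \<bar>A.cov (D i) (D j)\<bar>))"
  proof (intro sum_mono)
    fix i j assume ij: "i \<in> {..<N}" "j \<in> {..<N}"
    have "\<bar>Q.kap (\<lambda>v. Q.kap (wave_cov u i j v))\<bar> \<le> K * (2 * u\<^sup>2 * B * \<bar>c i j\<bar> + \<bar>A.cov (D i) (D j)\<bar>)"
      unfolding K_def c_def using ij by (intro expectation_err_bound B u elem c_le) auto
    then show "Q.kap (\<lambda>v. Q.kap (wave_cov u i j v)) \<le> K * (2 * u\<^sup>2 * B * \<bar>c i j\<bar> + \<bar>A.cov (D i) (D j)\<bar>)" by linarith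
  qed
  also have "\<dots> = K * (2 * u\<^sup>2 * B * (\<Sum>i<N. \<Sum>j<N. \<bar>c i j\<bar>) + (\<Sum>i<N. \<Sum>j<N. \<bar>A.cov (D i) (D j)\<bar>))"
    by (simp add: sum_distrib_left sum.distrib distrib_left)
  also have "\<dots> \<le> K * (2 * u\<^sup>2 * B * (2 * N * W) + (\<Sum>i<N. B))"
    using K0 B0 by (intro mult_left_mono add_mono sum_c sum_mono row) auto
  also have "\<dots> = K * (N * B * (1 + 4 * u\<^sup>2 * W))" by (simp add: algebra_simps)
  finally have bd: "(LINT \<omega>|M. (norm (err_sum N u \<omega>))\<^sup>2) \<le> K * (N * B * (1 + 4 * u\<^sup>2 * W))"
    unfolding L2' .
  have i1: "integrable M (\<lambda>\<omega>. norm (err_sum N u \<omega>))" by (intro integrable_norm err_sum_integrable)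
  have i2: "integrable M (\<lambda>\<omega>. (norm (err_sum N u \<omega>))\<^sup>2)"
  proof -
    have "integrable M (\<lambda>\<omega>. err_sum N u \<omega> * cnj (err_sum N u \<omega>))"
      unfolding err_sum_def cnj_sum sum_product
      by (intro Bochner_Integration.integrable_sum err_mult_integrable)
    from integrable_Re[OF this[unfolded norm2]] show ?thesis by simp
  qed
  \<comment> \<open>Nonnegativity of the variance is the passage from the second moment of the norm
    to its mean.\<close>
  have "0 \<le> A.variance (\<lambda>\<omega>. norm (err_sum N u \<omega>))" by (rule A.variance_positive)
  then have "(LINT \<omega>|M. norm (err_sum N u \<omega>))\<^sup>2 \<le> K * (N * B * (1 + 4 * u\<^sup>2 * W))"
    unfolding A.variance_eq[OF i1 i2] using bd by linarith
  then show ?thesis unfolding K_def by (rule real_le_rsqrt)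
qed

end

context gaussian_grid
begin

section \<open>Quadrature errors of smooth functions as superpositions of waves\<close>

definition quad_error :: "(real \<Rightarrow> real) \<Rightarrow> nat \<Rightarrow> 'a \<Rightarrow> real" where
  "quad_error g N \<omega> = (\<Sum>j<N. LINT p|P. D j \<omega> * (g (mid j \<omega> + V p * D j \<omega>) - g (mid j \<omega> + Y p * D j \<omega>)))"

lemma interpolation_bound:
  assumes "\<bar>x j \<omega>\<bar> \<le> R" "\<bar>x (Suc j) \<omega>\<bar> \<le> R" "\<bar>v\<bar> \<le> 1/2"
  shows "\<bar>mid j \<omega> + v * D j \<omega>\<bar> \<le> R"
proof -
  have eq: "mid j \<omega> + v * D j \<omega> = (1/2 - v) * x j \<omega> + (1/2 + v) * x (Suc j) \<omega>"
    unfolding mid_def D_def by (simp add: algebra_simps)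
  have "\<bar>mid j \<omega> + v * D j \<omega>\<bar> \<le> \<bar>(1/2 - v) * x j \<omega>\<bar> + \<bar>(1/2 + v) * x (Suc j) \<omega>\<bar>"
    unfolding eq by (rule abs_triangle_ineq)
  also have "\<dots> = (1/2 - v) * \<bar>x j \<omega>\<bar> + (1/2 + v) * \<bar>x (Suc j) \<omega>\<bar>"
    using assms(3) by (simp add: abs_mult abs_le_iff)
  also have "\<dots> \<le> (1/2 - v) * R + (1/2 + v) * R"
    using assms by (intro add_mono mult_left_mono) (auto simp: abs_le_iff)
  finally show ?thesis by (simp add: algebra_simps)
qed

text \<open>A pathwise identity for paths whose grid values stay in [-R, R]: by convexity all
  evaluation points then lie there too, so g may be replaced by its Fourier integral and the
  integrals exchanged.\<close>

lemma quad_error_fourier: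
  assumes G [measurable]: "G \<in> borel_measurable borel" and Gi: "integrable lborel G"
    and g: "\<And>z. \<bar>z\<bar> \<le> R \<Longrightarrow> complex_of_real (g z) = (CLINT u|lborel. G u * iexp (u * z))"
    and R: "\<And>j. j \<le> N \<Longrightarrow> \<bar>x j \<omega>\<bar> \<le> R"
  shows "complex_of_real (quad_error g N \<omega>) = (CLINT u|lborel. G u * err_sum N u \<omega>)"
proof -
  have Gw: "integrable lborel (\<lambda>u. G u * iexp (u * z))" for z
    by (rule Bochner_Integration.integrable_bound[OF Gi]) (auto simp: norm_mult)
  have one: "complex_of_real (LINT p|P. D j \<omega> * (g (mid j \<omega> + V p * D j \<omega>) - g (mid j \<omega> + Y p * D j \<omega>)))
      = (CLINT u|lborel. G u * err u j \<omega>)" if j: "j < N" for j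
  proof -
    have b: "\<bar>mid j \<omega> + v * D j \<omega>\<bar> \<le> R" if "\<bar>v\<bar> \<le> 1/2" for v
      using j that by (intro interpolation_bound R) auto
    have "(CLINT u|lborel. G u * err u j \<omega>) =
        (CLINT u|lborel. CLINT p|P. G u * (D j \<omega> * (wave u j (V p) \<omega> - wave u j (Y p) \<omega>)))"
      unfolding err_def by simp
    also have "\<dots> = (CLINT p|P. CLINT u|lborel. G u * (D j \<omega> * (wave u j (V p) \<omega> - wave u j (Y p) \<omega>)))"
    proof (rule Fubini_dominated[OF Q.prob_space_axioms lborel.sigma_finite_measure_axioms])
      show "(\<lambda>(p, u). G u * (complex_of_real (D j \<omega>) * (wave u j (V p) \<omega> - wave u j (Y p) \<omega>))) \<in> borel_measurable (P \<Otimes>\<^sub>M lborel)"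
        unfolding wave_def by measurable
      show "integrable lborel (\<lambda>u. norm (G u) * (2 * \<bar>D j \<omega>\<bar>))" using Gi by simp
      show "norm (G u * (complex_of_real (D j \<omega>) * (wave u j (V p) \<omega> - wave u j (Y p) \<omega>))) \<le> norm (G u) * (2 * \<bar>D j \<omega>\<bar>)" for p u
        using norm_triangle_ineq4[of "wave u j (V p) \<omega>" "wave u j (Y p) \<omega>"]
        by (simp add: norm_mult mult.commute[of 2] mult_left_mono)
    qed
    also have "\<dots> = (CLINT p|P. complex_of_real (D j \<omega> * (g (mid j \<omega> + V p * D j \<omega>) - g (mid j \<omega> + Y p * D j \<omega>))))"
    proof (intro Bochner_Integration.integral_cong refl)
      fix p assume p: "p \<in> space P"
      have "(CLINT u|lborel. G u * (D j \<omega> * (wave u j (V p) \<omega> - wave u j (Y p) \<omega>)))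
          = (CLINT u|lborel. D j \<omega> * (G u * wave u j (V p) \<omega> - G u * wave u j (Y p) \<omega>))"
        by (simp add: algebra_simps)
      also have "\<dots> = complex_of_real (D j \<omega>) * ((CLINT u|lborel. G u * wave u j (V p) \<omega>) - (CLINT u|lborel. G u * wave u j (Y p) \<omega>))"
        unfolding wave_def by (subst integral_mult_right_zero, subst Bochner_Integration.integral_diff[OF Gw Gw]) simp
      also have "\<dots> = complex_of_real (D j \<omega>) * (g (mid j \<omega> + V p * D j \<omega>) - g (mid j \<omega> + Y p * D j \<omega>))"
        unfolding wave_def g[OF b[OF Q.V_bound[OF p]], symmetric] g[OF b[OF Q.Y_bound[OF p]], symmetric] by simp
      finally show "(CLINT u|lborel. G u * (D j \<omega> * (wave u j (V p) \<omega> - wave u j (Y p) \<omega>)))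
        = complex_of_real (D j \<omega> * (g (mid j \<omega> + V p * D j \<omega>) - g (mid j \<omega> + Y p * D j \<omega>)))" by simp
    qed
    also have "\<dots> = complex_of_real (LINT p|P. D j \<omega> * (g (mid j \<omega> + V p * D j \<omega>) - g (mid j \<omega> + Y p * D j \<omega>)))"
      by (rule integral_complex_of_real)
    finally show ?thesis by (rule sym)
  qed
  have int: "integrable lborel (\<lambda>u. G u * err u j \<omega>)" for j
  proof (rule Bochner_Integration.integrable_bound)
    show "integrable lborel (\<lambda>u. norm (G u) * (2 * \<bar>D j \<omega>\<bar>))" using Gi by simp
    show "AE u in lborel. norm (G u * err u j \<omega>) \<le> norm (norm (G u) * (2 * \<bar>D j \<omega>\<bar>))"
      using norm_err_le[of _ j \<omega>] by (auto simp: norm_mult abs_mult intro!: mult_left_mono)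
    have "(\<lambda>u. err u j \<omega>) \<in> borel_measurable borel"
      unfolding err_def wave_def by (rule Q.borel_measurable_lebesgue_integral) measurable
    then show "(\<lambda>u. G u * err u j \<omega>) \<in> borel_measurable lborel" by measurable
  qed
  have "complex_of_real (quad_error g N \<omega>) = (\<Sum>j<N. CLINT u|lborel. G u * err u j \<omega>)"
    unfolding quad_error_def of_real_sum by (intro sum.cong one) auto
  also have "\<dots> = (CLINT u|lborel. \<Sum>j<N. G u * err u j \<omega>)"
    by (rule Bochner_Integration.integral_sum[symmetric]) (rule int)
  finally show ?thesis by (simp add: err_sum_def sum_distrib_left)
qed

lemma expectation_fourier_error:
  assumes G [measurable]: "G \<in> borel_measurable borel" and Gi: "integrable lborel G"
  shows "(\<lambda>\<omega>. norm (CLINT u|lborel. G u * err_sum N u \<omega>)) \<in> borel_measurable M"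
    and "integrable M (\<lambda>\<omega>. norm (CLINT u|lborel. G u * err_sum N u \<omega>))"
    and "(LINT \<omega>|M. norm (CLINT u|lborel. G u * err_sum N u \<omega>)) \<le> (LINT u|lborel. norm (G u) * (LINT \<omega>|M. norm (err_sum N u \<omega>)))"
proof -
  interpret LM: pair_sigma_finite lborel M ..
  let ?f = "\<lambda>(u, \<omega>). G u * err_sum N u \<omega>"
  define B where "B = (\<Sum>i<N. A.cov (D i) (D i))"
  have B: "A.cov (D i) (D i) \<le> B" if "i < N" for i
    unfolding B_def using that cov_D_D_nonneg by (intro member_le_sum) auto
  have meas [measurable]: "?f \<in> borel_measurable (lborel \<Otimes>\<^sub>M M)"
    by measurable
  have int: "integrable (lborel \<Otimes>\<^sub>M M) ?f"
  proof (rule LM.Fubini_integrable[OF meas])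
    show "integrable lborel (\<lambda>u. LINT \<omega>|M. norm (?f (u, \<omega>)))"
    proof (rule Bochner_Integration.integrable_bound)
      show "integrable lborel (\<lambda>u. norm (G u) * (2 * real N * sqrt B))" using Gi by simp
      show "AE u in lborel. norm (LINT \<omega>|M. norm (?f (u, \<omega>))) \<le> norm (norm (G u) * (2 * real N * sqrt B))"
      proof (rule AE_I2)
        fix u
        have "norm (LINT \<omega>|M. norm (?f (u, \<omega>))) = norm (G u) * (LINT \<omega>|M. norm (err_sum N u \<omega>))"
          by (simp add: norm_mult)
        also have "\<dots> \<le> norm (G u) * (2 * real N * sqrt B)"
          by (intro mult_left_mono err_sum_trivial_bound B) auto
        also have "\<dots> \<le> norm (norm (G u) * (2 * real N * sqrt B))" by simp
        finally show "norm (LINT \<omega>|M. norm (?f (u, \<omega>))) \<le> norm (norm (G u) * (2 * real N * sqrt B))" .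
      qed
      show "(\<lambda>u. LINT \<omega>|M. norm (?f (u, \<omega>))) \<in> borel_measurable lborel" by measurable
    qed
    show "AE u in lborel. integrable M (\<lambda>\<omega>. ?f (u, \<omega>))"
      by (intro AE_I2) (auto intro!: integrable_mult_right err_sum_integrable)
  qed
  have i1: "integrable M (\<lambda>\<omega>. CLINT u|lborel. G u * err_sum N u \<omega>)"
    using LM.integrable_snd[OF int] by simp
  have intn: "integrable (lborel \<Otimes>\<^sub>M M) (\<lambda>(u, \<omega>). norm (G u * err_sum N u \<omega>))"
    using integrable_norm[OF int] by (simp only: case_prod_unfold)
  have i2: "integrable M (\<lambda>\<omega>. LINT u|lborel. norm (G u * err_sum N u \<omega>))"
    by (rule LM.integrable_snd[OF intn])
  show "(\<lambda>\<omega>. norm (CLINT u|lborel. G u * err_sum N u \<omega>)) \<in> borel_measurable M"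
    using i1 by auto
  show i1': "integrable M (\<lambda>\<omega>. norm (CLINT u|lborel. G u * err_sum N u \<omega>))"
    using i1 by (rule integrable_norm)
  have "(LINT \<omega>|M. norm (CLINT u|lborel. G u * err_sum N u \<omega>)) \<le> (LINT \<omega>|M. LINT u|lborel. norm (G u * err_sum N u \<omega>))"
    by (intro integral_mono i1' i2 integral_norm_bound)
  also have "\<dots> = (LINT u|lborel. LINT \<omega>|M. norm (G u * err_sum N u \<omega>))"
    by (rule LM.Fubini_integral[OF intn])
  finally show "(LINT \<omega>|M. norm (CLINT u|lborel. G u * err_sum N u \<omega>)) \<le> (LINT u|lborel. norm (G u) * (LINT \<omega>|M. norm (err_sum N u \<omega>)))"
    by (simp add: norm_mult)
qed

end

text \<open>Frequencies with \<open>2 u\<^sup>2 B \<le> 1\<close> are controlled by the second moment bound; for the others \<open>n\<close> is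
  at most polynomial in \<open>u\<close>, and the first moment bound is enough.\<close>

lemma fourier_error_tendsto_0:
  fixes N :: "nat \<Rightarrow> nat" and xs :: "nat \<Rightarrow> nat \<Rightarrow> 'a \<Rightarrow> real"
  assumes grid: "\<And>n. gaussian_grid M X P V Y l (xs n)"
    and x0: "\<And>n \<omega>. \<omega> \<in> space M \<Longrightarrow> xs n 0 \<omega> = 0"
    and row: "\<And>n i. 1 \<le> n \<Longrightarrow> i < N n \<Longrightarrow>
      (\<Sum>j<N n. \<bar>gaussian_process.cov M (gaussian_grid.D (xs n) i) (gaussian_grid.D (xs n) j)\<bar>) \<le> b * real n powr (- \<alpha>)"
    and var: "\<And>n k. 1 \<le> n \<Longrightarrow> k \<le> N n \<Longrightarrow>
      (\<Sum>i<N n. \<bar>gaussian_process.cov M (gaussian_grid.D (xs n) i) (xs n k)\<bar>) \<le> W"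
    and mono: "\<And>n i. gaussian_process.cov M (xs n i) (xs n i) \<le> gaussian_process.cov M (xs n (Suc i)) (xs n (Suc i))"
    and N: "\<And>n. real (N n) \<le> T * real n"
    and b: "0 \<le> b" and alpha: "1 / (2 * real l + 1) < \<alpha>"
    and G [measurable]: "G \<in> borel_measurable borel" and C: "0 \<le> C"
    and G_bound: "\<And>u. norm (G u) \<le> C / (1 + u\<^sup>2) ^ (2 * l + 2)"
  shows "(\<lambda>n. LINT \<omega>|M. norm (CLINT u|lborel. G u * gaussian_grid.err_sum P V Y (xs n) (N n) u \<omega>)) \<longlonglongrightarrow> 0"
proof -
  interpret gg: gaussian_grid M X P V Y l "xs n" for n by (rule grid)
  define E where "E n u = (LINT \<omega>|M. norm (gg.err_sum n (N n) u \<omega>))" for n u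
  have E_nonneg: "0 \<le> E n u" for n u unfolding E_def by (intro Bochner_Integration.integral_nonneg) auto
  have W: "0 \<le> W" by (rule order.trans[OF _ var[of 1 0]]) (auto intro: sum_nonneg)
  have T: "0 \<le> T" using order.trans[OF of_nat_0_le_iff N[of 1]] by simp
  have alpha0: "0 < \<alpha>" using alpha by (rule less_trans[rotated]) simp
  have la: "1 < \<alpha> * real (2 * l + 1)" using alpha by (simp add: field_simps)
  define K1 where "K1 = gg.bilinear_const * 4 ^ l * (T * b ^ (2 * l + 1)) * (1 + 4 * W)"
  have K1: "0 \<le> K1" unfolding K1_def using T b W gg.bilinear_const_nonneg by simp
  have pw: "(real n powr (- \<alpha>)) ^ (2 * l + 1) * real n = real n powr (1 - \<alpha> * real (2 * l + 1))" if "1 \<le> n" for n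
  proof -
    have "(real n powr (- \<alpha>)) ^ (2 * l + 1) = real n powr (- \<alpha> * real (2 * l + 1))"
      using that by (subst powr_realpow[symmetric]) (auto simp: powr_powr)
    then show ?thesis using that by (simp add: powr_mult_base mult.commute[of _ "real n"])
  qed
  \<comment> \<open>With N of order n and B = b n^(-\<alpha>) the second moment contains n B^(2l +
    1), that is n^(1 - \<alpha> (2l + 1)); the square root halves the exponent. The factors u^(4l)
    and 1 + 4 u^2 W are absorbed into (1 + u^2)^(2l + 1).\<close>
  have low: "E n u \<le> sqrt K1 * (1 + u\<^sup>2) ^ (2 * l + 1) * real n powr ((1 - \<alpha> * real (2 * l + 1)) / 2)"
    if n: "1 \<le> n" and u: "2 * u\<^sup>2 * (b * real n powr (- \<alpha>)) \<le> 1" for n u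
  proof -
    let ?B = "b * real n powr (- \<alpha>)" and ?y = "1 + u\<^sup>2"
    have y: "1 \<le> ?y" by simp
    have "E n u \<le> sqrt (gg.bilinear_const * (2 * u\<^sup>2 * ?B) ^ (2 * l) * (N n * ?B * (1 + 4 * u\<^sup>2 * W)))"
      unfolding E_def using x0 mono row[OF n] var[OF n] u b by (intro gg.err_sum_bound) auto
    also have "gg.bilinear_const * (2 * u\<^sup>2 * ?B) ^ (2 * l) * (N n * ?B * (1 + 4 * u\<^sup>2 * W))
        \<le> gg.bilinear_const * (2 * ?y * ?B) ^ (2 * l) * (T * n * ?B * ((1 + 4 * W) * ?y))"
    proof (intro mult_mono mult_left_mono power_mono)
      show "real (N n) \<le> T * n" by (rule N)
      have "0 \<le> W + u\<^sup>2" using W by simp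
      then show "1 + 4 * u\<^sup>2 * W \<le> (1 + 4 * W) * ?y" using W by (simp add: algebra_simps)
    qed (use gg.bilinear_const_nonneg b T W in auto)
    also have "\<dots> = gg.bilinear_const * 4 ^ l * (T * b ^ (2 * l + 1)) * (1 + 4 * W) * ?y ^ (2 * l + 1) * ((real n powr (- \<alpha>)) ^ (2 * l + 1) * n)"
    proof -
      have "(2 * z * ?B) ^ (2 * l) = 4 ^ l * z ^ (2 * l) * (b ^ (2 * l) * (real n powr (- \<alpha>)) ^ (2 * l))" for z :: real
        by (simp add: power_mult_distrib power_mult)
      from this[of ?y] show ?thesis by (simp add: mult_ac)
    qed
    also have "\<dots> = K1 * ?y ^ (2 * l + 1) * real n powr (1 - \<alpha> * real (2 * l + 1))"
      unfolding K1_def pw[OF n] ..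
    also have "sqrt \<dots> = sqrt K1 * sqrt (?y ^ (2 * l + 1)) * sqrt (real n powr (1 - \<alpha> * real (2 * l + 1)))"
      by (simp add: real_sqrt_mult)
    also have "sqrt (real n powr (1 - \<alpha> * real (2 * l + 1))) = real n powr ((1 - \<alpha> * real (2 * l + 1)) / 2)"
      by (simp add: powr_half_sqrt[symmetric] powr_powr)
    also have "sqrt K1 * sqrt (?y ^ (2 * l + 1)) * real n powr ((1 - \<alpha> * real (2 * l + 1)) / 2)
        \<le> sqrt K1 * ?y ^ (2 * l + 1) * real n powr ((1 - \<alpha> * real (2 * l + 1)) / 2)"
    proof (intro mult_right_mono mult_left_mono)
      have "1 \<le> ?y ^ (2 * l + 1)" using y by (rule one_le_power)
      then show "sqrt (?y ^ (2 * l + 1)) \<le> ?y ^ (2 * l + 1)"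
        by (intro real_le_lsqrt) (auto simp: power2_eq_square intro: order.trans[OF _ mult_left_mono[of 1]])
    qed (use K1 in auto)
    finally show ?thesis by simp
  qed
  define K2 where "K2 = sqrt K1 + 2 * T * sqrt b * (2 * b) ^ (2 * l + 1)"
  have unif: "E n u \<le> K2 * (1 + u\<^sup>2) ^ (2 * l + 1)" if n: "1 \<le> n" for n u
  proof (cases "2 * u\<^sup>2 * (b * real n powr (- \<alpha>)) \<le> 1")
    case True
    have "E n u \<le> sqrt K1 * (1 + u\<^sup>2) ^ (2 * l + 1) * real n powr ((1 - \<alpha> * real (2 * l + 1)) / 2)"
      by (rule low[OF n True])
    also have "\<dots> \<le> sqrt K1 * (1 + u\<^sup>2) ^ (2 * l + 1) * real n powr 0"
      using la n K1 by (intro mult_left_mono powr_mono) auto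
    also have "\<dots> \<le> K2 * (1 + u\<^sup>2) ^ (2 * l + 1)"
      using n T b by (auto simp: K2_def intro!: mult_right_mono)
    finally show ?thesis .
  next
    case False
    \<comment> \<open>For high frequencies n^\<alpha> is bounded by a multiple of u^2, hence n by a
      multiple of its power 2l + 1, because \<alpha> (2l + 1) > 1. The trivial bound of order n thus
      becomes a bound in u alone.\<close>
    have na: "real n powr \<alpha> \<le> 2 * u\<^sup>2 * b"
    proof -
      have "real n powr \<alpha> * 1 \<le> real n powr \<alpha> * (2 * u\<^sup>2 * (b * real n powr (- \<alpha>)))"
        using False by (intro mult_left_mono) auto
      also have "\<dots> = 2 * u\<^sup>2 * b * (real n powr \<alpha> * real n powr (- \<alpha>))" by (simp add: mult_ac)
      also have "real n powr \<alpha> * real n powr (- \<alpha>) = 1" using n by (simp flip: powr_add)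
      finally show ?thesis by simp
    qed
    have "real n = real n powr 1" using n by simp
    also have "\<dots> \<le> real n powr (\<alpha> * real (2 * l + 1))" using la n by (intro powr_mono) auto
    also have "\<dots> = (real n powr \<alpha>) ^ (2 * l + 1)"
      using n by (subst powr_realpow[symmetric]) (auto simp: powr_powr)
    also have "\<dots> \<le> (2 * u\<^sup>2 * b) ^ (2 * l + 1)" by (intro power_mono na) auto
    also have "\<dots> \<le> (2 * b * (1 + u\<^sup>2)) ^ (2 * l + 1)"
      using b by (intro power_mono) (auto simp: algebra_simps)
    finally have nb: "real n \<le> (2 * b) ^ (2 * l + 1) * (1 + u\<^sup>2) ^ (2 * l + 1)" by (simp only: power_mult_distrib)
    have "E n u \<le> 2 * real (N n) * sqrt (b * real n powr (- \<alpha>))"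
      unfolding E_def
    proof (rule gg.err_sum_trivial_bound)
      fix i assume i: "i < N n"
      have "gg.A.cov (gg.D n i) (gg.D n i) \<le> (\<Sum>j<N n. \<bar>gg.A.cov (gg.D n i) (gg.D n j)\<bar>)"
        using member_le_sum[of i "{..<N n}" "\<lambda>j. \<bar>gg.A.cov (gg.D n i) (gg.D n j)\<bar>"] i by force
      also have "\<dots> \<le> b * real n powr (- \<alpha>)" by (rule row[OF n i])
      finally show "gg.A.cov (gg.D n i) (gg.D n i) \<le> b * real n powr (- \<alpha>)" .
    qed
    also have "\<dots> \<le> 2 * (T * real n) * sqrt (b * 1)"
    proof (intro mult_mono real_sqrt_le_mono mult_left_mono N)
      show "real n powr - \<alpha> \<le> 1" using powr_mono[of "- \<alpha>" 0 "real n"] n alpha0 by simp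
    qed (use b T in auto)
    also have "\<dots> = 2 * T * sqrt b * real n" by simp
    also have "\<dots> \<le> 2 * T * sqrt b * ((2 * b) ^ (2 * l + 1) * (1 + u\<^sup>2) ^ (2 * l + 1))"
      using T b by (intro mult_left_mono nb) auto
    also have "\<dots> = (2 * T * sqrt b * (2 * b) ^ (2 * l + 1)) * (1 + u\<^sup>2) ^ (2 * l + 1)" by (simp only: mult.assoc)
    also have "\<dots> \<le> K2 * (1 + u\<^sup>2) ^ (2 * l + 1)"
      using K1 by (intro mult_right_mono) (auto simp: K2_def)
    finally show ?thesis .
  qed
  \<comment> \<open>The index is shifted since the grid bounds are available for n \<ge> 1
    only.\<close>
  have ptw: "(\<lambda>n. E (Suc n) u) \<longlonglongrightarrow> 0" for u
  proof (rule tendsto_sandwich[of "\<lambda>_. 0"])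
    have "(\<lambda>n. 2 * u\<^sup>2 * (b * real (Suc n) powr (- \<alpha>))) \<longlonglongrightarrow> 2 * u\<^sup>2 * (b * 0)"
      using alpha0 by (intro tendsto_intros tendsto_neg_powr filterlim_compose[OF filterlim_real_sequentially filterlim_Suc]) auto
    then have "\<forall>\<^sub>F n in sequentially. 2 * u\<^sup>2 * (b * real (Suc n) powr (- \<alpha>)) < 1"
      by (intro order_tendstoD) auto
    then show "\<forall>\<^sub>F n in sequentially. E (Suc n) u \<le> sqrt K1 * (1 + u\<^sup>2) ^ (2 * l + 1) * real (Suc n) powr ((1 - \<alpha> * real (2 * l + 1)) / 2)"
      by eventually_elim (rule low, auto)
    have "(\<lambda>n. sqrt K1 * (1 + u\<^sup>2) ^ (2 * l + 1) * real (Suc n) powr ((1 - \<alpha> * real (2 * l + 1)) / 2)) \<longlonglongrightarrow> sqrt K1 * (1 + u\<^sup>2) ^ (2 * l + 1) * 0"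
      using la by (intro tendsto_mult tendsto_const tendsto_neg_powr filterlim_compose[OF filterlim_real_sequentially filterlim_Suc]) auto
    then show "(\<lambda>n. sqrt K1 * (1 + u\<^sup>2) ^ (2 * l + 1) * real (Suc n) powr ((1 - \<alpha> * real (2 * l + 1)) / 2)) \<longlonglongrightarrow> 0" by simp
  qed (auto intro!: always_eventually E_nonneg)
  have E_meas [measurable]: "(\<lambda>u. E n u) \<in> borel_measurable borel" for n
    unfolding E_def
    by (rule gg.A.borel_measurable_lebesgue_integral) measurable
  have Gi: "integrable lborel G"
    by (rule integrable_of_decay[OF G C _ G_bound]) simp
  \<comment> \<open>Weight of order 2l + 2 against growth of order 2l + 1: the remaining 1 / (1 +
    u^2) is the integrable majorant for dominated convergence in u.\<close>
  have cancel: "C / y ^ (2 * l + 2) * (K2 * y ^ (2 * l + 1)) = C * K2 * (1 / y)" if "0 < y" for y :: real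
    using that by (simp add: field_simps)
  have lim: "(\<lambda>n. LINT u|lborel. norm (G u) * E (Suc n) u) \<longlonglongrightarrow> (LINT u::real|lborel. 0)"
  proof (rule integral_dominated_convergence[where f = "\<lambda>u::real. 0::real" and s = "\<lambda>n u. norm (G u) * E (Suc n) u" and w = "\<lambda>u. C * K2 * (1 / (1 + u\<^sup>2))"])
    show "integrable lborel (\<lambda>u. C * K2 * (1 / (1 + u\<^sup>2)))"
      by (intro integrable_mult_right integrable_inverse_one_plus_square)
    show "AE u in lborel. (\<lambda>n. norm (G u) * E (Suc n) u) \<longlonglongrightarrow> 0"
      using tendsto_mult_left[OF ptw] by auto
    show "AE u in lborel. norm (norm (G u) * E (Suc n) u) \<le> C * K2 * (1 / (1 + u\<^sup>2))" for n
    proof (rule AE_I2)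
      fix u :: real
      have pos: "0 < 1 + u\<^sup>2" by (simp add: add_pos_nonneg)
      have "norm (G u) * E (Suc n) u \<le> C / (1 + u\<^sup>2) ^ (2 * l + 2) * (K2 * (1 + u\<^sup>2) ^ (2 * l + 1))"
        using C by (intro mult_mono G_bound unif E_nonneg) auto
      also have "\<dots> = C * K2 * (1 / (1 + u\<^sup>2))"
        by (rule cancel[OF pos])
      finally show "norm (norm (G u) * E (Suc n) u) \<le> C * K2 * (1 / (1 + u\<^sup>2))"
        using E_nonneg by simp
    qed
  qed measurable
  have "(\<lambda>n. LINT \<omega>|M. norm (CLINT u|lborel. G u * gg.err_sum (Suc n) (N (Suc n)) u \<omega>)) \<longlonglongrightarrow> 0"
  proof (rule tendsto_sandwich[of "\<lambda>_. 0"])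
    show "\<forall>\<^sub>F n in sequentially. (LINT \<omega>|M. norm (CLINT u|lborel. G u * gg.err_sum (Suc n) (N (Suc n)) u \<omega>)) \<le> (LINT u|lborel. norm (G u) * E (Suc n) u)"
      unfolding E_def by (intro always_eventually allI gg.expectation_fourier_error(3) G Gi)
    show "(\<lambda>n. LINT u|lborel. norm (G u) * E (Suc n) u) \<longlonglongrightarrow> 0" using lim by simp
  qed (auto intro!: always_eventually Bochner_Integration.integral_nonneg)
  then show ?thesis by (rule LIMSEQ_imp_Suc)
qed

section \<open>Convergence of the Riemann sums\<close>

text \<open>Limits in probability are determined up to null sets; this transfers the formula from
  one version of the integral to every other.\<close>

lemma converges_in_probability_unique:
  assumes "prob_space M" and J: "converges_in_probability M S J" and J': "converges_in_probability M S J'"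
  shows "AE \<omega> in M. J \<omega> = J' \<omega>"
proof -
  interpret prob_space M by fact
  have [measurable]: "\<And>n. S n \<in> borel_measurable M" "J \<in> borel_measurable M" "J' \<in> borel_measurable M"
    using J J' unfolding converges_in_probability_def by auto
  have lim: "(\<lambda>n. prob {\<omega> \<in> space M. \<bar>S n \<omega> - J \<omega>\<bar> > e}) \<longlonglongrightarrow> 0"
    "(\<lambda>n. prob {\<omega> \<in> space M. \<bar>S n \<omega> - J' \<omega>\<bar> > e}) \<longlonglongrightarrow> 0" if "e > 0" for e
    using J J' that unfolding converges_in_probability_def by blast+
  have zero: "prob {\<omega> \<in> space M. \<bar>J \<omega> - J' \<omega>\<bar> > e} = 0" if e: "e > 0" for e
  proof -
    let ?A = "\<lambda>n. {\<omega> \<in> space M. \<bar>S n \<omega> - J \<omega>\<bar> > e / 2}" and ?B = "\<lambda>n. {\<omega> \<in> space M. \<bar>S n \<omega> - J' \<omega>\<bar> > e / 2}"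
    have "(\<lambda>n. prob (?A n) + prob (?B n)) \<longlonglongrightarrow> 0 + 0"
      using e by (intro tendsto_add lim) auto
    moreover have "prob {\<omega> \<in> space M. \<bar>J \<omega> - J' \<omega>\<bar> > e} \<le> prob (?A n) + prob (?B n)" for n
    proof -
      have "prob {\<omega> \<in> space M. \<bar>J \<omega> - J' \<omega>\<bar> > e} \<le> prob (?A n \<union> ?B n)"
      proof (rule finite_measure_mono)
        show "{\<omega> \<in> space M. \<bar>J \<omega> - J' \<omega>\<bar> > e} \<subseteq> ?A n \<union> ?B n"
        proof
          fix \<omega> assume *: "\<omega> \<in> {\<omega> \<in> space M. \<bar>J \<omega> - J' \<omega>\<bar> > e}"
          then have "\<bar>J \<omega> - J' \<omega>\<bar> > e" by simp
          then have "\<bar>S n \<omega> - J \<omega>\<bar> > e / 2 \<or> \<bar>S n \<omega> - J' \<omega>\<bar> > e / 2" by linarith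
          with * show "\<omega> \<in> ?A n \<union> ?B n" by simp
        qed
      qed measurable
      also have "\<dots> \<le> prob (?A n) + prob (?B n)"
        by (rule measure_Un_le) measurable
      finally show ?thesis .
    qed
    ultimately have "prob {\<omega> \<in> space M. \<bar>J \<omega> - J' \<omega>\<bar> > e} \<le> 0"
      by (intro LIMSEQ_le_const) auto
    then show ?thesis using measure_nonneg[of M] by (simp add: antisym)
  qed
  have "AE \<omega> in M. \<forall>k. \<not> \<bar>J \<omega> - J' \<omega>\<bar> > 1 / real (Suc k)"
  proof (subst AE_all_countable, intro allI)
    fix k
    have "{\<omega> \<in> space M. \<bar>J \<omega> - J' \<omega>\<bar> > 1 / real (Suc k)} \<in> null_sets M"
      using zero[of "1 / real (Suc k)"] by (intro null_setsI) (auto simp: emeasure_eq_measure)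
    then show "AE \<omega> in M. \<not> \<bar>J \<omega> - J' \<omega>\<bar> > 1 / real (Suc k)"
      by (rule AE_I') auto
  qed
  then show ?thesis
  proof eventually_elim
    fix \<omega> assume *: "\<forall>k. \<not> \<bar>J \<omega> - J' \<omega>\<bar> > 1 / real (Suc k)"
    show "J \<omega> = J' \<omega>"
    proof (rule ccontr)
      assume "J \<omega> \<noteq> J' \<omega>"
      then have "0 < \<bar>J \<omega> - J' \<omega>\<bar>" by simp
      then obtain k where "1 / real (Suc k) < \<bar>J \<omega> - J' \<omega>\<bar>" using nat_approx_posE by blast
      with * show False by blast
    qed
  qed
qed

text \<open>The functional z s * z t on the path space is measurable and depends on two coordinates
  only, so its integral is determined by the law of the process, to which self-similarity
  applies.\<close>

lemma self_similar_product_moment: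
  assumes "self_similar M \<beta> X" and X: "\<And>t. 0 \<le> t \<Longrightarrow> X t \<in> borel_measurable M"
    and c: "0 < c" and s: "0 \<le> s" and t: "0 \<le> t"
  shows "(\<integral>\<omega>. X (c * s) \<omega> * X (c * t) \<omega> \<partial>M) = c powr (2 * \<beta>) * (\<integral>\<omega>. X s \<omega> * X t \<omega> \<partial>M)"
proof -
  let ?S = "\<Pi>\<^sub>M t\<in>{0::real..}. (borel :: real measure)"
  have law: "(\<integral>z. z s * z t \<partial>process_law M Z) = (\<integral>\<omega>. Z s \<omega> * Z t \<omega> \<partial>M)"
    if Z: "\<And>t. 0 \<le> t \<Longrightarrow> Z t \<in> borel_measurable M" for Z
  proof -
    have "(\<lambda>\<omega>. \<lambda>t\<in>{0..}. Z t \<omega>) \<in> measurable M ?S"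
      using Z by (intro measurable_restrict) auto
    moreover have "(\<lambda>z. z s * z t) \<in> borel_measurable ?S"
      using s t by (intro borel_measurable_times measurable_component_singleton) auto
    ultimately have "(\<integral>z. z s * z t \<partial>process_law M Z) = (\<integral>\<omega>. (\<lambda>t\<in>{0..}. Z t \<omega>) s * (\<lambda>t\<in>{0..}. Z t \<omega>) t \<partial>M)"
      unfolding process_law_def by (rule integral_distr)
    then show ?thesis using s t by simp
  qed
  have "(\<integral>\<omega>. X s \<omega> * X t \<omega> \<partial>M) = (\<integral>z. z s * z t \<partial>process_law M X)"
    by (rule law[symmetric]) (rule X)
  also have "process_law M X = process_law M (\<lambda>t \<omega>. c powr (- \<beta>) * X (c * t) \<omega>)"
    using assms(1) c unfolding self_similar_def by simp
  also have "(\<integral>z. z s * z t \<partial>\<dots>) = (\<integral>\<omega>. (c powr (- \<beta>) * X (c * s) \<omega>) * (c powr (- \<beta>) * X (c * t) \<omega>) \<partial>M)"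
    using X c by (intro law borel_measurable_times borel_measurable_const) auto
  also have "\<dots> = (\<integral>\<omega>. c powr (- 2 * \<beta>) * (X (c * s) \<omega> * X (c * t) \<omega>) \<partial>M)"
  proof -
    have "c powr (- \<beta>) * c powr (- \<beta>) = c powr (- 2 * \<beta>)" by (simp flip: powr_add)
    then have "c powr (- \<beta>) * a * (c powr (- \<beta>) * b) = c powr (- 2 * \<beta>) * (a * b)" for a b
      by (metis mult.assoc mult.commute)
    then show ?thesis by (simp only:)
  qed
  also have "\<dots> = c powr (- 2 * \<beta>) * (\<integral>\<omega>. X (c * s) \<omega> * X (c * t) \<omega> \<partial>M)" by simp
  finally have "c powr (2 * \<beta>) * (\<integral>\<omega>. X s \<omega> * X t \<omega> \<partial>M)
      = (c powr (2 * \<beta>) * c powr (- 2 * \<beta>)) * (\<integral>\<omega>. X (c * s) \<omega> * X (c * t) \<omega> \<partial>M)"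
    by simp
  also have "c powr (2 * \<beta>) * c powr (- 2 * \<beta>) = 1" using c by (simp flip: powr_add)
  finally show ?thesis by simp
qed

section \<open>Moments of the quadrature measure\<close>

lemma prob_measure_unit_intervalD:
  assumes "prob_measure_unit_interval \<nu>"
  shows "prob_space \<nu>" "space \<nu> = {0..1}" "(\<lambda>y. y) \<in> borel_measurable \<nu>"
proof -
  have s: "sets \<nu> = sets (restrict_space borel {0..1})"
    using assms unfolding prob_measure_unit_interval_def by blast
  show "prob_space \<nu>" using assms unfolding prob_measure_unit_interval_def by blast
  show "space \<nu> = {0..1}" using sets_eq_imp_space_eq[OF s] by (simp add: space_restrict_space)
  have "(\<lambda>y. y) \<in> borel_measurable (restrict_space borel {0..1::real})"
    by (rule measurable_restrict_space1) simp
  then show "(\<lambda>y. y) \<in> borel_measurable \<nu>" using measurable_cong_sets[OF s refl] by blast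
qed

text \<open>Since reflection is an involution, preimages under it are images; symmetry on sets
  therefore says that \<nu> equals its push-forward, and the substitution rule applies.\<close>

lemma symmetric_measure_integral:
  fixes F :: "real \<Rightarrow> real"
  assumes \<nu>: "prob_measure_unit_interval \<nu>" and sym: "symmetric_measure \<nu>"
    and F [measurable]: "F \<in> borel_measurable borel"
  shows "(\<integral>y. F (1 - y) \<partial>\<nu>) = (\<integral>y. F y \<partial>\<nu>)"
proof -
  note [measurable] = prob_measure_unit_intervalD(3)[OF \<nu>]
  note sp = prob_measure_unit_intervalD(2)[OF \<nu>]
  have s: "sets \<nu> = sets (restrict_space borel {0..1})"
    using \<nu> unfolding prob_measure_unit_interval_def by blast
  have r: "(\<lambda>y. 1 - y) \<in> measurable \<nu> \<nu>"
  proof -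
    have "(\<lambda>y. 1 - y) \<in> measurable \<nu> (restrict_space borel {0..1})"
      by (rule measurable_restrict_space2) (auto simp: sp)
    then show ?thesis using measurable_cong_sets[OF refl s] by blast
  qed
  have "distr \<nu> \<nu> (\<lambda>y. 1 - y) = \<nu>"
  proof (rule measure_eqI)
    fix A assume "A \<in> sets (distr \<nu> \<nu> (\<lambda>y. 1 - y))"
    then have A: "A \<in> sets \<nu>" by simp
    then have A': "A \<in> sets borel" "A \<subseteq> {0..1}"
      unfolding s by (auto simp: sets_restrict_space_iff)
    have "(\<lambda>y. 1 - y) -` A \<inter> space \<nu> = (\<lambda>y. 1 - y) ` A"
    proof (intro equalityI subsetI)
      fix y assume "y \<in> (\<lambda>y. 1 - y) -` A \<inter> space \<nu>"
      then show "y \<in> (\<lambda>y. 1 - y) ` A" by (intro image_eqI[of _ _ "1 - y"]) auto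
    qed (use A' sp in auto)
    then show "emeasure (distr \<nu> \<nu> (\<lambda>y. 1 - y)) A = emeasure \<nu> A"
      using sym A' A r unfolding symmetric_measure_def by (simp add: emeasure_distr)
  qed simp
  moreover have "(\<integral>y. F y \<partial>distr \<nu> \<nu> (\<lambda>y. 1 - y)) = (\<integral>y. F (1 - y) \<partial>\<nu>)"
    by (rule integral_distr[OF r]) measurable
  ultimately show ?thesis by simp
qed

lemma set_integral_power_shift:
  fixes a :: real
  shows "(LBINT v:{0..1}. (v - a) ^ j) = ((1 - a) ^ Suc j - (- a) ^ Suc j) / real (Suc j)"
proof -
  have "(LBINT v:{0..1}. (v - a) ^ j) = (\<lambda>v. (v - a) ^ Suc j / real (Suc j)) 1 - (\<lambda>v. (v - a) ^ Suc j / real (Suc j)) 0"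
    unfolding set_lebesgue_integral_def
  proof (rule integral_FTC_atLeastAtMost)
    fix v :: real
    have "((\<lambda>v. (v - a) ^ Suc j / real (Suc j)) has_real_derivative (v - a) ^ j) (at v within {0..1})"
      by (auto intro!: derivative_eq_intros simp del: power_Suc of_nat_Suc)
    then show "((\<lambda>v. (v - a) ^ Suc j / real (Suc j)) has_vector_derivative (v - a) ^ j) (at v within {0..1})"
      by (simp add: has_real_derivative_iff_has_vector_derivative)
  qed (auto intro!: continuous_intros)
  then show ?thesis by (simp add: diff_divide_distrib add_divide_distrib)
qed

text \<open>Odd centered moments vanish for both laws by reflection. For even j with 0 < j < 2l the
  raw moment of \<nu> is prescribed to be that of the uniform law; the binomial expansion of y^j
  around 1/2 writes it through centered moments up to order j with leading coefficient 1, so strong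
  induction isolates the j-th.\<close>

lemma centered_moments_agree:
  assumes \<nu>: "prob_measure_unit_interval \<nu>" and sym: "symmetric_measure \<nu>" and mom: "moment_condition \<nu> l"
    and j: "odd j \<or> j < 2 * l"
  shows "(\<integral>y. (y - 1/2) ^ j \<partial>\<nu>) = (LBINT v:{0..1}. (v - 1/2) ^ j)"
proof -
  interpret prob_space \<nu> by (rule prob_measure_unit_intervalD(1)[OF \<nu>])
  note [measurable] = prob_measure_unit_intervalD(3)[OF \<nu>]
  note sp = prob_measure_unit_intervalD(2)[OF \<nu>]
  have odd: "(\<integral>y. (y - 1/2) ^ j \<partial>\<nu>) = (LBINT v:{0..1}. (v - 1/2) ^ j)" if "odd j" for j
  proof -
    have "(\<integral>y. (y - 1/2) ^ j \<partial>\<nu>) = (\<integral>y. ((1 - y) - 1/2) ^ j \<partial>\<nu>)"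
      by (rule symmetric_measure_integral[OF \<nu> sym, symmetric]) measurable
    also have "\<dots> = (\<integral>y. - ((y - 1/2) ^ j) \<partial>\<nu>)"
    proof (intro Bochner_Integration.integral_cong refl)
      fix y :: real
      have "((1 - y) - 1/2) = - (y - 1/2)" by simp
      then show "((1 - y) - 1/2) ^ j = - ((y - 1/2) ^ j)"
        using power_minus_odd[OF that, of "y - 1/2"] by (simp only:)
    qed
    finally have "(\<integral>y. (y - 1/2) ^ j \<partial>\<nu>) = 0" by simp
    moreover have "(LBINT v::real:{0..1}. (v - 1/2) ^ j) = 0"
      unfolding set_integral_power_shift using that power_minus_even[of "Suc j" "1/2 :: real"] by simp
    ultimately show ?thesis by simp
  qed
  have intN: "integrable \<nu> (\<lambda>y. (y - 1/2) ^ k)" for k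
  proof (rule integrable_const_bound[where B = 1])
    show "AE y in \<nu>. norm ((y - 1/2) ^ k) \<le> 1"
      using sp by (intro AE_I2) (auto simp: power_abs intro!: power_le_one)
  qed measurable
  have intL: "set_integrable lborel {0..1} (\<lambda>v::real. (v - 1/2) ^ k)" for k
    by (intro borel_integrable_atLeastAtMost' continuous_intros)
  have "j < 2 * l \<Longrightarrow> (\<integral>y. (y - 1/2) ^ j \<partial>\<nu>) = (LBINT v:{0..1}. (v - 1/2) ^ j)"
  proof (induction j rule: less_induct)
    case (less j)
    show ?case
    proof (cases "odd j \<or> j = 0")
      case True
      then show ?thesis
      proof
        assume "j = 0"
        then show ?thesis using set_integral_power_shift[of "1/2" 0] by (simp add: prob_space)
      qed (rule odd)
    next
      case False
      then obtain i where i: "j = 2 * i" "1 \<le> i" by (auto elim!: evenE)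
      then have il: "i \<in> {1..<l}" using less.prems by auto
      have binom: "y ^ j = (\<Sum>k\<le>j. (real (j choose k) * (1/2) ^ (j - k)) * (y - 1/2) ^ k)" for y :: real
        using binomial_ring[of "y - 1/2" "1/2" j] by (simp add: mult_ac)
      have N: "(\<integral>y. y ^ j \<partial>\<nu>) = (\<Sum>k\<le>j. (real (j choose k) * (1/2) ^ (j - k)) * (\<integral>y. (y - 1/2) ^ k \<partial>\<nu>))"
        unfolding binom by (subst Bochner_Integration.integral_sum) (auto intro!: integrable_mult_right intN)
      have L: "(LBINT v:{0..1}. v ^ j) = (\<Sum>k\<le>j. (real (j choose k) * (1/2) ^ (j - k)) * (LBINT v:{0..1}. (v - 1/2) ^ k))"
      proof -
        have "(LBINT v:{0..1}. v ^ j) = (LBINT v. (\<Sum>k\<le>j. (real (j choose k) * (1/2) ^ (j - k)) * (indicator {0..1} v *\<^sub>R (v - 1/2) ^ k)))"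
          unfolding set_lebesgue_integral_def binom
          by (intro Bochner_Integration.integral_cong refl) (simp add: sum_distrib_left mult_ac)
        also have "\<dots> = (\<Sum>k\<le>j. (real (j choose k) * (1/2) ^ (j - k)) * (LBINT v:{0..1}. (v - 1/2) ^ k))"
          unfolding set_lebesgue_integral_def
          by (subst Bochner_Integration.integral_sum)
            (use intL in \<open>auto intro!: integrable_mult_right simp: set_integrable_def\<close>)
        finally show ?thesis .
      qed
      have "(\<integral>y. y ^ j \<partial>\<nu>) = 1 / (2 * real i + 1)"
        using mom il i unfolding moment_condition_def by simp
      moreover have "(LBINT v:{0..1}. v ^ j) = 1 / (2 * real i + 1)"
        using set_integral_power_shift[of 0 j] i by simp
      ultimately have eq: "(\<integral>y. y ^ j \<partial>\<nu>) = (LBINT v:{0..1}. v ^ j)" by simp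
      have split: "(\<Sum>k\<le>j. c k) = c j + (\<Sum>k<j. c k)" for c :: "nat \<Rightarrow> real"
        by (simp add: lessThan_Suc_atMost[symmetric])
      have "(\<Sum>k<j. (real (j choose k) * (1/2) ^ (j - k)) * (\<integral>y. (y - 1/2) ^ k \<partial>\<nu>))
          = (\<Sum>k<j. (real (j choose k) * (1/2) ^ (j - k)) * (LBINT v:{0..1}. (v - 1/2) ^ k))"
        using less.IH less.prems by (intro sum.cong) auto
      then show ?thesis using eq unfolding N L split by simp
    qed
  qed
  then show ?thesis using odd j by blast
qed

lemma Ck_on_imp_ck:
  assumes "Ck_on k UNIV f" "i + m = k"
  shows "ck m ((deriv ^^ i) f)"
  using assms(2)
proof (induction m arbitrary: i)
  case 0
  then show ?case using assms(1) unfolding Ck_on_def by simp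
next
  case (Suc m)
  have "((deriv ^^ i) f has_real_derivative (deriv ^^ Suc i) f x) (at x)" for x
    using assms(1) Suc.prems unfolding Ck_on_def by (auto simp: DERIV_deriv_iff_real_differentiable)
  moreover have "ck m ((deriv ^^ Suc i) f)" using Suc.prems by (intro Suc.IH) simp
  ultimately show ?case unfolding ck.simps by blast
qed

section \<open>Covariances on the grid of mesh 1 / n\<close>

context gaussian_process
begin

lemma cov_self_similar:
  assumes ss: "self_similar M \<beta> X" and X0: "\<And>\<omega>. \<omega> \<in> space M \<Longrightarrow> X 0 \<omega> = 0"
    and \<phi>: "\<And>x. 1 \<le> x \<Longrightarrow> \<phi> x = (\<integral>\<omega>. X 1 \<omega> * X x \<omega> \<partial>M)" and st: "0 \<le> s" "s \<le> t"
  shows "cov (X s) (X t) = s powr (2 * \<beta>) * \<phi> (t / s)"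
proof (cases "s = 0")
  \<comment> \<open>Here t / s is 0 by convention and \<phi> is evaluated outside its range, but its
    factor \<open>s powr (2 * \<beta>)\<close> is 0.\<close>
  case True
  have "cov (X s) (X t) = (LINT \<omega>|M. 0)"
    unfolding cov_def using True X0 by (intro Bochner_Integration.integral_cong) auto
  then show ?thesis using True by simp
next
  case False
  then have s: "0 < s" using st by simp
  have "(\<integral>\<omega>. X (s * 1) \<omega> * X (s * (t / s)) \<omega> \<partial>M) = s powr (2 * \<beta>) * (\<integral>\<omega>. X 1 \<omega> * X (t / s) \<omega> \<partial>M)"
    using s st by (intro self_similar_product_moment[OF ss] gspan_measurable gspan_base) auto
  then show ?thesis using s st \<phi>[of "t / s"] by (simp add: cov_def)
qed

text \<open>Cauchy-Schwarz, since X x has variance x^(2 \<beta>) \<phi> 1. It is obtained from the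
  arithmetic-geometric inequality with weight x^\<beta>, the ratio of the two standard deviations,
  which makes both halves equal.\<close>

lemma kernel_growth:
  assumes ss: "self_similar M \<beta> X" and X0: "\<And>\<omega>. \<omega> \<in> space M \<Longrightarrow> X 0 \<omega> = 0"
    and \<phi>: "\<And>x. 1 \<le> x \<Longrightarrow> \<phi> x = (\<integral>\<omega>. X 1 \<omega> * X x \<omega> \<partial>M)" and x: "1 \<le> x"
  shows "\<bar>\<phi> x\<bar> \<le> \<phi> 1 * x powr \<beta>"
proof -
  have i: "integrable M (\<lambda>\<omega>. X s \<omega> * X t \<omega>)" if "0 \<le> s" "0 \<le> t" for s t
    using that by (intro gspan_integrable_mult gspan_base)
  have v1: "(\<integral>\<omega>. X 1 \<omega> * X 1 \<omega> \<partial>M) = \<phi> 1" using \<phi>[of 1] by simp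
  have vx: "(\<integral>\<omega>. X x \<omega> * X x \<omega> \<partial>M) = x powr (2 * \<beta>) * \<phi> 1"
    using cov_self_similar[OF ss X0 \<phi>, of x x] x by (simp add: cov_def)
  let ?y = "x powr \<beta>"
  have y: "0 < ?y" using x by simp
  have "\<bar>\<phi> x\<bar> \<le> (\<integral>\<omega>. \<bar>X 1 \<omega> * X x \<omega>\<bar> \<partial>M)"
    unfolding \<phi>[OF x] by (rule integral_abs_bound)
  also have "\<dots> \<le> (\<integral>\<omega>. 1/2 * (?y * (X 1 \<omega> * X 1 \<omega>) + 1 / ?y * (X x \<omega> * X x \<omega>)) \<partial>M)"
  proof (rule integral_mono)
    show "integrable M (\<lambda>\<omega>. \<bar>X 1 \<omega> * X x \<omega>\<bar>)" using i[of 1 x] x by simp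
    show "integrable M (\<lambda>\<omega>. 1/2 * (?y * (X 1 \<omega> * X 1 \<omega>) + 1 / ?y * (X x \<omega> * X x \<omega>)))"
      using i[of 1 1] i[of x x] x by (intro integrable_mult_right Bochner_Integration.integrable_add) auto
    fix \<omega>
    define a b where "a = \<bar>X 1 \<omega>\<bar>" and "b = \<bar>X x \<omega>\<bar>"
    have "0 \<le> (?y * a - b)\<^sup>2 / (2 * ?y)" using y by simp
    also have "\<dots> = 1/2 * (?y * (a * a) + 1 / ?y * (b * b)) - a * b"
      using y by (simp add: power2_eq_square field_simps)
    finally show "\<bar>X 1 \<omega> * X x \<omega>\<bar> \<le> 1/2 * (?y * (X 1 \<omega> * X 1 \<omega>) + 1 / ?y * (X x \<omega> * X x \<omega>))"
      by (simp add: a_def b_def abs_mult)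
  qed
  also have "\<dots> = 1/2 * (?y * \<phi> 1 + 1 / ?y * (x powr (2 * \<beta>) * \<phi> 1))"
    using i[of 1 1] i[of x x] x v1 vx by simp
  also have "x powr (2 * \<beta>) = ?y * ?y" by (simp flip: powr_add)
  also have "1/2 * (?y * \<phi> 1 + 1 / ?y * (?y * ?y * \<phi> 1)) = \<phi> 1 * ?y"
    using y by (simp add: field_simps)
  finally show ?thesis .
qed

lemma cov_increment:
  "cov (increment X n i) (increment X n j) =
    cov (X (real (Suc i) / n)) (X (real (Suc j) / n)) - cov (X (real (Suc i) / n)) (X (real j / n))
    - cov (X (real i / n)) (X (real (Suc j) / n)) + cov (X (real i / n)) (X (real j / n))"
  "cov (increment X n i) (X (real k / n)) = cov (X (real (Suc i) / n)) (X (real k / n)) - cov (X (real i / n)) (X (real k / n))"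
proof -
  have X: "X (real m / n) \<in> gspan" for m by (intro gspan_base) simp
  have e: "increment X n m = (\<lambda>\<omega>. X (real (Suc m) / n) \<omega> - X (real m / n) \<omega>)" for m
    by (rule ext) (simp add: increment_def)
  show "cov (increment X n i) (X (real k / n)) = cov (X (real (Suc i) / n)) (X (real k / n)) - cov (X (real i / n)) (X (real k / n))"
    unfolding e by (intro cov_diff_left X)
  show "cov (increment X n i) (increment X n j) =
    cov (X (real (Suc i) / n)) (X (real (Suc j) / n)) - cov (X (real (Suc i) / n)) (X (real j / n))
    - cov (X (real i / n)) (X (real (Suc j) / n)) + cov (X (real i / n)) (X (real j / n))"
    unfolding e by (simp only: cov_diff_left cov_diff_right gspan_diff X)
qed

text \<open>The scaling factor n^(-2 \<beta>) times the p-th power of N \<le> n t is of order n^(p -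
  2 \<beta>). Row sums have p = 2 \<beta> - \<alpha> and decay like n^(-\<alpha>); the variation has
  p = 2 \<beta>, so W is independent of n.\<close>

lemma grid_covariance_bounds:
  assumes K: "selfsimilar_kernel \<phi> \<phi>1 \<phi>2 \<alpha> \<beta> \<theta> C"
    and cov: "\<And>s t. 0 \<le> s \<Longrightarrow> s \<le> t \<Longrightarrow> cov (X s) (X t) = s powr (2 * \<beta>) * \<phi> (t / s)"
    and t: "0 \<le> t"
  obtains b W where "0 \<le> b"
    "\<And>n i. 1 \<le> n \<Longrightarrow> i < nat \<lfloor>real n * t\<rfloor> \<Longrightarrow>
      (\<Sum>j<nat \<lfloor>real n * t\<rfloor>. \<bar>cov (increment X n i) (increment X n j)\<bar>) \<le> b * real n powr (- \<alpha>)"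
    "\<And>n k. 1 \<le> n \<Longrightarrow> k \<le> nat \<lfloor>real n * t\<rfloor> \<Longrightarrow>
      (\<Sum>i<nat \<lfloor>real n * t\<rfloor>. \<bar>cov (increment X n i) (X (real k / n))\<bar>) \<le> W"
proof -
  interpret K: selfsimilar_kernel \<phi> \<phi>1 \<phi>2 \<alpha> \<beta> \<theta> C by (rule K)
  have ker: "cov (X (real i / n)) (X (real j / n)) = n powr (- (2 * \<beta>)) * K.ker i j" if n: "1 \<le> n" for n i j :: nat
  proof -
    have le: "cov (X (real i / n)) (X (real j / n)) = n powr (- (2 * \<beta>)) * (real i powr (2 * \<beta>) * \<phi> (real j / real i))"
      if "i \<le> j" for i j :: nat
    proof -
      have "cov (X (real i / n)) (X (real j / n)) = (real i / n) powr (2 * \<beta>) * \<phi> ((real j / n) / (real i / n))"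
        using that n by (intro cov divide_right_mono) auto
      also have "(real j / n) / (real i / n) = real j / real i" using n by simp
      finally show ?thesis by (simp add: powr_divide powr_minus_divide)
    qed
    show ?thesis
    proof (cases "i \<le> j")
      case True
      then show ?thesis using le[OF True] by (simp add: K.ker_def)
    next
      case False
      then show ?thesis using le[of j i] cov_commute[of "X (real i / n)"] by (simp add: K.ker_def)
    qed
  qed
  let ?N = "\<lambda>n. nat \<lfloor>real n * t\<rfloor>"
  have N: "real (?N n) \<le> n * t" for n using t by simp
  have pow: "n powr (- (2 * \<beta>)) * real (?N n) powr p \<le> t powr p * n powr (p - 2 * \<beta>)" if "1 \<le> n" "0 \<le> p" for n :: nat and p
  proof -
    have "real (?N n) powr p \<le> (n * t) powr p" using N that by (intro powr_mono2) auto
    then have "n powr (- (2 * \<beta>)) * real (?N n) powr p \<le> n powr (- (2 * \<beta>)) * (n powr p * t powr p)"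
      by (intro mult_left_mono) (auto simp: powr_mult)
    also have "\<dots> = t powr p * (n powr p * n powr (- (2 * \<beta>)))" by (simp add: mult_ac)
    also have "n powr p * n powr (- (2 * \<beta>)) = n powr (p - 2 * \<beta>)" by (simp flip: powr_add)
    finally show ?thesis .
  qed
  define c where "c = C + 2 * C / \<beta> + 5 * C / \<alpha>"
  have c: "0 \<le> c" unfolding c_def using K.C_nonneg K.alpha K.beta by simp
  show thesis
  proof (rule that[of "K.row_const * t powr (2 * \<beta> - \<alpha>)" "c * t powr (2 * \<beta>)"])
    show "0 \<le> K.row_const * t powr (2 * \<beta> - \<alpha>)" using K.row_const_nonneg by simp
    fix n :: nat assume n: "1 \<le> n"
    {
      fix i assume i: "i < ?N n"
      have "(\<Sum>j<?N n. \<bar>cov (increment X n i) (increment X n j)\<bar>) = (\<Sum>j<?N n. n powr (- (2 * \<beta>)) * \<bar>K.dker i j\<bar>)"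
      proof (intro sum.cong refl)
        fix j
        have "cov (increment X n i) (increment X n j) = n powr (- (2 * \<beta>)) * K.dker i j"
          unfolding cov_increment ker[OF n] K.dker_def by (simp only: right_diff_distrib distrib_left)
        then show "\<bar>cov (increment X n i) (increment X n j)\<bar> = n powr (- (2 * \<beta>)) * \<bar>K.dker i j\<bar>"
          by (simp add: abs_mult)
      qed
      also have "\<dots> = n powr (- (2 * \<beta>)) * (\<Sum>j<?N n. \<bar>K.dker i j\<bar>)" by (simp add: sum_distrib_left)
      also have "\<dots> \<le> n powr (- (2 * \<beta>)) * (K.row_const * ?N n powr (2 * \<beta> - \<alpha>))"
        by (intro mult_left_mono K.dker_row_sum i) simp
      also have "\<dots> = K.row_const * (n powr (- (2 * \<beta>)) * ?N n powr (2 * \<beta> - \<alpha>))" by (simp add: mult_ac)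
      also have "\<dots> \<le> K.row_const * (t powr (2 * \<beta> - \<alpha>) * n powr (2 * \<beta> - \<alpha> - 2 * \<beta>))"
        using K.beta n by (intro mult_left_mono pow K.row_const_nonneg) auto
      finally show "(\<Sum>j<?N n. \<bar>cov (increment X n i) (increment X n j)\<bar>) \<le> K.row_const * t powr (2 * \<beta> - \<alpha>) * n powr (- \<alpha>)"
        by simp
    next
      fix k assume k: "k \<le> ?N n"
      have "(\<Sum>i<?N n. \<bar>cov (increment X n i) (X (real k / n))\<bar>) = (\<Sum>i<?N n. n powr (- (2 * \<beta>)) * \<bar>K.ker (Suc i) k - K.ker i k\<bar>)"
      proof (intro sum.cong refl)
        fix i
        have "cov (increment X n i) (X (real k / n)) = n powr (- (2 * \<beta>)) * (K.ker (Suc i) k - K.ker i k)"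
          unfolding cov_increment ker[OF n] by (simp only: right_diff_distrib)
        then show "\<bar>cov (increment X n i) (X (real k / n))\<bar> = n powr (- (2 * \<beta>)) * \<bar>K.ker (Suc i) k - K.ker i k\<bar>"
          by (simp add: abs_mult)
      qed
      also have "\<dots> = n powr (- (2 * \<beta>)) * (\<Sum>i<?N n. \<bar>K.ker (Suc i) k - K.ker i k\<bar>)" by (simp add: sum_distrib_left)
      also have "\<dots> \<le> n powr (- (2 * \<beta>)) * (c * ?N n powr (2 * \<beta>))"
        unfolding c_def by (intro mult_left_mono K.ker_variation k) simp
      also have "\<dots> = c * (n powr (- (2 * \<beta>)) * ?N n powr (2 * \<beta>))" by (simp add: mult_ac)
      also have "\<dots> \<le> c * (t powr (2 * \<beta>) * n powr (2 * \<beta> - 2 * \<beta>))"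
        using K.beta n c by (intro mult_left_mono pow) auto
      finally show "(\<Sum>i<?N n. \<bar>cov (increment X n i) (X (real k / n))\<bar>) \<le> c * t powr (2 * \<beta>)"
        using n by simp
    }
  qed
qed

end

section \<open>Comparison of the rule \<nu> with the uniform law\<close>

abbreviation unit_lborel :: "real measure" where
  "unit_lborel \<equiv> restrict_space lborel {0..1}"

lemma prob_space_unit_lborel: "prob_space unit_lborel"
  by (rule prob_spaceI) (simp add: emeasure_restrict_space space_restrict_space)

lemma unit_product_integral:
  fixes F :: "real \<Rightarrow> real"
  assumes \<nu>: "prob_measure_unit_interval \<nu>"
    and F [measurable]: "F \<in> borel_measurable borel" and B: "\<And>z. z \<in> {0..1} \<Longrightarrow> \<bar>F z\<bar> \<le> B"
  shows "integrable (\<nu> \<Otimes>\<^sub>M unit_lborel) (\<lambda>p. F (snd p))" "integrable (\<nu> \<Otimes>\<^sub>M unit_lborel) (\<lambda>p. F (fst p))"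
    and "(\<integral>p. F (snd p) \<partial>(\<nu> \<Otimes>\<^sub>M unit_lborel)) = (LBINT v:{0..1}. F v)"
    and "(\<integral>p. F (fst p) \<partial>(\<nu> \<Otimes>\<^sub>M unit_lborel)) = (\<integral>y. F y \<partial>\<nu>)"
proof -
  interpret N: prob_space \<nu> by (rule prob_measure_unit_intervalD(1)[OF \<nu>])
  interpret U: prob_space unit_lborel by (rule prob_space_unit_lborel)
  interpret P: pair_prob_space \<nu> unit_lborel ..
  note sp = prob_measure_unit_intervalD(2)[OF \<nu>]
  have [measurable]: "(\<lambda>p. fst p) \<in> borel_measurable (\<nu> \<Otimes>\<^sub>M unit_lborel)"
    by (rule measurable_compose[OF measurable_fst prob_measure_unit_intervalD(3)[OF \<nu>]])
  have "(\<lambda>v. v) \<in> borel_measurable unit_lborel"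
    by (rule measurable_restrict_space1) simp
  then have [measurable]: "(\<lambda>p. snd p) \<in> borel_measurable (\<nu> \<Otimes>\<^sub>M unit_lborel)"
    by (rule measurable_compose[OF measurable_snd])
  have in01: "fst p \<in> {0..1}" "snd p \<in> {0..1}" if "p \<in> space (\<nu> \<Otimes>\<^sub>M unit_lborel)" for p
    using that sp by (auto simp: space_pair_measure space_restrict_space)
  show i1: "integrable (\<nu> \<Otimes>\<^sub>M unit_lborel) (\<lambda>p. F (snd p))"
    by (rule P.integrable_const_bound[where B = B]) (use B in01 in auto)
  show i2: "integrable (\<nu> \<Otimes>\<^sub>M unit_lborel) (\<lambda>p. F (fst p))"
    by (rule P.integrable_const_bound[where B = B]) (use B in01 in auto)
  show "(\<integral>p. F (snd p) \<partial>(\<nu> \<Otimes>\<^sub>M unit_lborel)) = (LBINT v:{0..1}. F v)"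
    using P.integral_fst'[OF i1]
    by (simp add: N.prob_space integral_restrict_space set_lebesgue_integral_def)
  show "(\<integral>p. F (fst p) \<partial>(\<nu> \<Otimes>\<^sub>M unit_lborel)) = (\<integral>y. F y \<partial>\<nu>)"
    using P.integral_fst'[OF i2] U.prob_space by simp
qed

text \<open>The product space carries a point of law \<nu> and a uniform point at once. The
  functional sees only the marginals, so independence is a convenient choice of coupling.\<close>

lemma moment_matching_product:
  assumes \<nu>: "prob_measure_unit_interval \<nu>" and sym: "symmetric_measure \<nu>" and mom: "moment_condition \<nu> l"
  shows "moment_matching (\<nu> \<Otimes>\<^sub>M unit_lborel) (\<lambda>p. snd p - 1/2) (\<lambda>p. fst p - 1/2) l"
proof -
  interpret N: prob_space \<nu> by (rule prob_measure_unit_intervalD(1)[OF \<nu>])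
  interpret U: prob_space unit_lborel by (rule prob_space_unit_lborel)
  interpret P: pair_prob_space \<nu> unit_lborel ..
  note sp = prob_measure_unit_intervalD(2)[OF \<nu>]
  have [measurable]: "(\<lambda>p. fst p) \<in> borel_measurable (\<nu> \<Otimes>\<^sub>M unit_lborel)"
    by (rule measurable_compose[OF measurable_fst prob_measure_unit_intervalD(3)[OF \<nu>]])
  have "(\<lambda>v. v) \<in> borel_measurable unit_lborel"
    by (rule measurable_restrict_space1) simp
  then have [measurable]: "(\<lambda>p. snd p) \<in> borel_measurable (\<nu> \<Otimes>\<^sub>M unit_lborel)"
    by (rule measurable_compose[OF measurable_snd])
  show ?thesis
  proof
    fix j assume j: "odd j \<or> j < 2 * l"
    have b: "\<bar>(z - 1/2) ^ j\<bar> \<le> 1" if "z \<in> {0..1::real}" for z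
      using that by (auto simp: power_abs intro!: power_le_one)
    show "(\<integral>p. (snd p - 1/2) ^ j - (fst p - 1/2) ^ j \<partial>(\<nu> \<Otimes>\<^sub>M unit_lborel)) = 0"
      using unit_product_integral[OF \<nu>, of "\<lambda>z. (z - 1/2) ^ j" 1] b centered_moments_agree[OF \<nu> sym mom j]
      by simp
  qed (auto simp: space_pair_measure space_restrict_space sp abs_if)
qed

text \<open>By the fundamental theorem of calculus the uniform average of g along the segment, times
  its length, is the exact increment of f; what remains is the error of the rule \<nu>.\<close>

lemma newton_cotes_error:
  fixes f g :: "real \<Rightarrow> real"
  assumes \<nu>: "prob_measure_unit_interval \<nu>"
    and f: "\<And>x. (f has_real_derivative g x) (at x)" and g: "continuous_on UNIV g"
  shows "(\<integral>p. (b - a) * (g (a + snd p * (b - a)) - g (a + fst p * (b - a))) \<partial>(\<nu> \<Otimes>\<^sub>M unit_lborel))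
    = f b - f a - (\<integral>y. g (a + y * (b - a)) * (b - a) \<partial>\<nu>)"
proof -
  let ?F = "\<lambda>z. g (a + z * (b - a)) * (b - a)"
  have c: "continuous_on UNIV ?F"
    by (intro continuous_intros continuous_on_compose2[OF g]) auto
  then have m: "?F \<in> borel_measurable borel" by (rule borel_measurable_continuous_onI)
  have "compact (?F ` {0..1})"
    by (intro compact_continuous_image continuous_on_subset[OF c]) auto
  then have "bounded (?F ` {0..1})" by (rule compact_imp_bounded)
  then obtain B where "\<forall>y\<in>?F ` {0..1}. norm y \<le> B" unfolding bounded_iff by blast
  then have B: "\<And>z. z \<in> {0..1} \<Longrightarrow> \<bar>?F z\<bar> \<le> B" by simp
  note I = unit_product_integral(1,2)[OF \<nu> m B]
  have I3: "(\<integral>p. ?F (snd p) \<partial>(\<nu> \<Otimes>\<^sub>M unit_lborel)) = (LBINT v:{0..1}. ?F v)"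
    by (rule unit_product_integral(3)[OF \<nu> m B])
  have I4: "(\<integral>p. ?F (fst p) \<partial>(\<nu> \<Otimes>\<^sub>M unit_lborel)) = (\<integral>y. ?F y \<partial>\<nu>)"
    by (rule unit_product_integral(4)[OF \<nu> m B])
  have "(LBINT v:{0..1}. ?F v) = (\<lambda>v. f (a + v * (b - a))) 1 - (\<lambda>v. f (a + v * (b - a))) 0"
    unfolding set_lebesgue_integral_def
  proof (rule integral_FTC_atLeastAtMost)
    fix v :: real
    have "((\<lambda>v. f (a + v * (b - a))) has_real_derivative g (a + v * (b - a)) * (b - a)) (at v within {0..1})"
      by (rule DERIV_chain2[OF f]) (auto intro!: derivative_eq_intros)
    then show "((\<lambda>v. f (a + v * (b - a))) has_vector_derivative ?F v) (at v within {0..1})"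
      by (simp add: has_real_derivative_iff_has_vector_derivative)
  qed (auto intro!: continuous_on_subset[OF c])
  then have ftc: "(LBINT v:{0..1}. ?F v) = f b - f a" by simp
  have "(\<integral>p. (b - a) * (g (a + snd p * (b - a)) - g (a + fst p * (b - a))) \<partial>(\<nu> \<Otimes>\<^sub>M unit_lborel))
      = (\<integral>p. ?F (snd p) - ?F (fst p) \<partial>(\<nu> \<Otimes>\<^sub>M unit_lborel))"
    by (intro Bochner_Integration.integral_cong refl) (simp add: algebra_simps)
  also have "\<dots> = (\<integral>p. ?F (snd p) \<partial>(\<nu> \<Otimes>\<^sub>M unit_lborel)) - (\<integral>p. ?F (fst p) \<partial>(\<nu> \<Otimes>\<^sub>M unit_lborel))"
    by (rule Bochner_Integration.integral_diff[OF I])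
  also have "\<dots> = (LBINT v:{0..1}. ?F v) - (\<integral>y. ?F y \<partial>\<nu>)"
    by (rule arg_cong2[where f = "(-)", OF I3 I4])
  finally show ?thesis unfolding ftc .
qed

lemma (in prob_space) pointwise_imp_in_probability:
  assumes Y [measurable]: "\<And>n. Y n \<in> borel_measurable M"
    and lim: "\<And>\<omega>. \<omega> \<in> space M \<Longrightarrow> (\<lambda>n. Y n \<omega>) \<longlonglongrightarrow> 0" and e: "0 < (e::real)"
  shows "(\<lambda>n. prob {\<omega> \<in> space M. \<bar>Y n \<omega>\<bar> > e}) \<longlonglongrightarrow> 0"
proof -
  let ?A = "\<lambda>n. {\<omega> \<in> space M. \<bar>Y n \<omega>\<bar> > e}"
  have "(\<lambda>n. \<integral>\<omega>. indicator (?A n) \<omega> \<partial>M) \<longlonglongrightarrow> (\<integral>\<omega>. (0::real) \<partial>M)"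
  proof (rule integral_dominated_convergence[where w = "\<lambda>_. 1" and f = "\<lambda>_. 0" and s = "\<lambda>n. indicator (?A n)"])
    show "AE \<omega> in M. (\<lambda>n. indicator (?A n) \<omega> :: real) \<longlonglongrightarrow> 0"
    proof (rule AE_I2)
      fix \<omega> assume w: "\<omega> \<in> space M"
      have "\<forall>\<^sub>F n in sequentially. \<bar>Y n \<omega>\<bar> < e"
        using order_tendstoD(2)[OF tendsto_rabs[OF lim[OF w]], of e] e by simp
      then have "\<forall>\<^sub>F n in sequentially. indicator (?A n) \<omega> = (0::real)"
        by eventually_elim (simp add: indicator_def)
      then show "(\<lambda>n. indicator (?A n) \<omega> :: real) \<longlonglongrightarrow> 0" by (rule tendsto_eventually)
    qed
  qed (auto simp: indicator_def)
  moreover have "(\<integral>\<omega>. indicator (?A n) \<omega> \<partial>M) = prob (?A n)" for n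
    by simp
  ultimately show ?thesis by simp
qed

text \<open>Only rational times enter the Riemann sums, so a countable supremum suffices here.\<close>

lemma (in prob_space) continuous_process_localization:
  fixes X :: "real \<Rightarrow> 'a \<Rightarrow> real"
  assumes X: "\<And>s. 0 \<le> s \<Longrightarrow> X s \<in> borel_measurable M"
    and cont: "\<And>\<omega>. \<omega> \<in> space M \<Longrightarrow> continuous_on {0..} (\<lambda>s. X s \<omega>)" and e: "0 < e"
  obtains R A where "0 < R" "A \<in> sets M" "prob A < e"
    "\<And>\<omega> q. \<omega> \<in> space M - A \<Longrightarrow> q \<in> \<rat> \<Longrightarrow> 0 \<le> q \<Longrightarrow> q \<le> t \<Longrightarrow> \<bar>X q \<omega>\<bar> \<le> R"
proof -
  define A where "A k = (\<Union>q\<in>\<rat> \<inter> {0..t}. {\<omega> \<in> space M. \<bar>X q \<omega>\<bar> > real (Suc k)})" for k :: nat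
  have A: "A k \<in> sets M" for k
    unfolding A_def
  proof (rule sets.countable_UN')
    show "countable (\<rat> \<inter> {0..t})" using countable_rat by (rule countable_Int1)
    show "(\<lambda>q. {\<omega> \<in> space M. \<bar>X q \<omega>\<bar> > real (Suc k)}) ` (\<rat> \<inter> {0..t}) \<subseteq> sets M"
    proof (rule image_subsetI)
      fix q assume "q \<in> \<rat> \<inter> {0..t}"
      then have [measurable]: "X q \<in> borel_measurable M" by (intro X) simp
      show "{\<omega> \<in> space M. \<bar>X q \<omega>\<bar> > real (Suc k)} \<in> sets M" by measurable
    qed
  qed
  have "(\<Inter>k. A k) = {}"
  proof (intro equalityI subsetI)
    fix \<omega> assume w: "\<omega> \<in> (\<Inter>k. A k)"
    then have "\<omega> \<in> A 0" by blast
    then have "\<omega> \<in> space M" by (auto simp: A_def)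
    then have "compact ((\<lambda>s. X s \<omega>) ` {0..t})"
      by (intro compact_continuous_image continuous_on_subset[OF cont]) auto
    then have "bounded ((\<lambda>s. X s \<omega>) ` {0..t})" by (rule compact_imp_bounded)
    then obtain B where "\<forall>y\<in>(\<lambda>s. X s \<omega>) ` {0..t}. norm y \<le> B" unfolding bounded_iff by blast
    then have B: "\<And>s. s \<in> {0..t} \<Longrightarrow> \<bar>X s \<omega>\<bar> \<le> B" by simp
    obtain k where "B \<le> real (Suc k)" using real_arch_simple[of B] by (metis le_Suc_eq order.refl of_nat_le_iff order.trans)
    moreover have "\<omega> \<in> A k" using w by blast
    ultimately show "\<omega> \<in> {}" using B by (force simp: A_def)
  qed simp
  moreover have "decseq A"
    unfolding decseq_def A_def by (auto intro: order.strict_trans1[rotated])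
  ultimately have "(\<lambda>k. prob (A k)) \<longlonglongrightarrow> 0"
    using finite_Lim_measure_decseq[of A] A by auto
  then have "\<forall>\<^sub>F k in sequentially. prob (A k) < e" using e by (rule order_tendstoD)
  then obtain k where k: "prob (A k) < e" by (auto simp: eventually_sequentially)
  show thesis
  proof (rule that[of "real (Suc k)" "A k"])
    show "\<bar>X q \<omega>\<bar> \<le> real (Suc k)" if "\<omega> \<in> space M - A k" "q \<in> \<rat>" "0 \<le> q" "q \<le> t" for \<omega> q
      using that by (force simp: A_def)
  qed (use A k in auto)
qed

text \<open>The increments of f telescope up to the last grid time not exceeding t, so the formula
  ends there and not at t itself.\<close>

lemma quad_error_eq:
  fixes X :: "real \<Rightarrow> 'a \<Rightarrow> real" and f g :: "real \<Rightarrow> real"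
  assumes \<nu>: "prob_measure_unit_interval \<nu>"
    and grid: "gaussian_grid M X (\<nu> \<Otimes>\<^sub>M unit_lborel) (\<lambda>p. snd p - 1/2) (\<lambda>p. fst p - 1/2) l (\<lambda>j. X (real j / real n))"
    and f: "\<And>x. (f has_real_derivative g x) (at x)" and g: "continuous_on UNIV g"
  shows "gaussian_grid.quad_error (\<nu> \<Otimes>\<^sub>M unit_lborel) (\<lambda>p. snd p - 1/2) (\<lambda>p. fst p - 1/2)
      (\<lambda>j. X (real j / real n)) g (nat \<lfloor>real n * t\<rfloor>) \<omega>
    = f (X (real (nat \<lfloor>real n * t\<rfloor>) / real n) \<omega>) - f (X 0 \<omega>) - nu_sum \<nu> g X t n \<omega>"
proof -
  interpret gg: gaussian_grid M X "\<nu> \<Otimes>\<^sub>M unit_lborel" "\<lambda>p. snd p - 1/2" "\<lambda>p. fst p - 1/2" l "\<lambda>j. X (real j / real n)"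
    by (rule grid)
  let ?x = "\<lambda>j. X (real j / real n) \<omega>"
  have D: "gg.D j \<omega> = ?x (Suc j) - ?x j" for j by (simp add: gg.D_def)
  have pt: "gg.mid j \<omega> + (v - 1/2) * gg.D j \<omega> = ?x j + v * (?x (Suc j) - ?x j)" for j v
    by (simp add: gg.mid_def gg.D_def field_simps)
  have inc: "increment X n j \<omega> = ?x (Suc j) - ?x j" for j by (simp add: increment_def)
  have tele: "(\<Sum>j<k. f (?x (Suc j)) - f (?x j)) = f (?x k) - f (?x 0)" for k
    by (rule sum_lessThan_telescope)
  have "gg.quad_error g (nat \<lfloor>real n * t\<rfloor>) \<omega>
      = (\<Sum>j<nat \<lfloor>real n * t\<rfloor>. (f (?x (Suc j)) - f (?x j)) - (\<integral>y. g (?x j + y * (?x (Suc j) - ?x j)) * (?x (Suc j) - ?x j) \<partial>\<nu>))"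
    unfolding gg.quad_error_def pt unfolding D newton_cotes_error[OF \<nu> f g] ..
  also have "\<dots> = f (?x (nat \<lfloor>real n * t\<rfloor>)) - f (?x 0) - nu_sum \<nu> g X t n \<omega>"
    unfolding nu_sum_def inc sum_subtractf[of "\<lambda>j. f (?x (Suc j)) - f (?x j)"] tele ..
  finally show ?thesis by simp
qed

lemma nu_sum_measurable:
  assumes \<nu>: "prob_measure_unit_interval \<nu>"
    and X: "\<And>s. 0 \<le> s \<Longrightarrow> X s \<in> borel_measurable M" and g: "continuous_on UNIV g"
  shows "nu_sum \<nu> g X t n \<in> borel_measurable M"
proof -
  interpret N: prob_space \<nu> by (rule prob_measure_unit_intervalD(1)[OF \<nu>])
  have [measurable]: "(\<lambda>p. snd p) \<in> borel_measurable (M \<Otimes>\<^sub>M \<nu>)"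
    by (rule measurable_compose[OF measurable_snd prob_measure_unit_intervalD(3)[OF \<nu>]])
  have [measurable]: "g \<in> borel_measurable borel" using g by (rule borel_measurable_continuous_onI)
  have [measurable]: "X (real j / real n) \<in> borel_measurable M" for j by (intro X) simp
  have [measurable]: "increment X n j \<in> borel_measurable M" for j
  proof -
    have "increment X n j = (\<lambda>\<omega>. X (real (Suc j) / real n) \<omega> - X (real j / real n) \<omega>)"
      by (rule ext) (simp add: increment_def)
    then show ?thesis by (simp only:) measurable
  qed
  have "(\<lambda>\<omega>. \<integral>y. g (X (real j / real n) \<omega> + y * increment X n j \<omega>) * increment X n j \<omega> \<partial>\<nu>) \<in> borel_measurable M" for j
    by (rule N.borel_measurable_lebesgue_integral) (simp add: case_prod_beta)
  then show ?thesis unfolding nu_sum_def[abs_def] by measurable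
qed

theorem theorem1p6:
  fixes M :: "'a measure" and X :: "real \<Rightarrow> 'a \<Rightarrow> real" and \<nu> :: "real measure"
    and l :: nat and \<alpha> \<beta> lam C1 C2 \<theta> :: real and \<phi> \<psi> f :: "real \<Rightarrow> real"
  assumes "prob_measure_unit_interval \<nu>"
    and "symmetric_measure \<nu>"
    and "associated_integer \<nu> l"
    and "1 / (2 * real l + 1) < \<alpha>" and "\<alpha> < 1"
    and "0 < \<beta>" and "\<beta> \<le> 1/2" and "\<alpha> \<le> 2 * \<beta>"
    and "prob_space M"
    and "\<And>\<omega>. \<omega> \<in> space M \<Longrightarrow> X 0 \<omega> = 0"
    and "centered_gaussian_process M X"
    and "\<And>\<omega>. \<omega> \<in> space M \<Longrightarrow> continuous_on {0..} (\<lambda>t. X t \<omega>)"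
    and "self_similar M \<beta> X"
    and "\<And>x. x \<ge> 1 \<Longrightarrow> \<phi> x = (\<integral>\<omega>. X 1 \<omega> * X x \<omega> \<partial>M)"
    and "continuous_on {1..} \<phi>"
    and "Ck_on 2 {1<..} \<phi>"
    and "lam > 0"
    and "\<And>x. x \<ge> 1 \<Longrightarrow> \<psi> x = \<phi> x + lam * (x - 1) powr \<alpha>"
    and "\<And>x. x \<in> {1<..2} \<Longrightarrow> \<psi> differentiable at x"
    and "bounded (deriv \<psi> ` {1<..2})"
    and "C1 > 0" and "C2 > 0" and "1 < \<theta>" and "\<theta> \<le> 2"
    and "\<And>x. x > 1 \<Longrightarrow> \<bar>(deriv ^^ 2) \<phi> x\<bar> \<le>
           C1 * indicator {1<..2} x * (x - 1) powr (\<alpha> - 2)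
           + C2 * indicator {2<..} x * x powr (- \<theta> - 1)"
    and "Ck_on (8 * l + 2) UNIV f"
  shows "\<forall>t\<ge>0. (\<exists>J. has_nu_symmetric_integral M \<nu> (deriv f) X t J) \<and>
           (\<forall>J. has_nu_symmetric_integral M \<nu> (deriv f) X t J \<longrightarrow>
              (AE \<omega> in M. f (X t \<omega>) = f 0 + J \<omega>))"
proof -
  note \<nu> = assms(1) and sym = assms(2) and ai = assms(3) and alpha = assms(4) and beta = assms(6-8)
    and X0 = assms(10) and paths = assms(12) and ss = assms(13) and \<phi>_eq = assms(14)
  interpret gaussian_process M X
    using assms(9,11) by (simp add: gaussian_process_def gaussian_process_axioms_def)
  have l: "1 \<le> l" and mom: "moment_condition \<nu> l"
    using ai unfolding associated_integer_def by auto
  have alpha0: "0 < \<alpha>" using alpha by (rule less_trans[rotated]) simp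
  have X_meas [measurable]: "X s \<in> borel_measurable M" if "0 \<le> s" for s
    using gspan_measurable[OF gspan_base[OF that]] .
  define g where "g = deriv f"
  have f: "(f has_real_derivative g x) (at x)" for x
    using assms(26)[unfolded Ck_on_def, THEN conjunct1, rule_format, of 0 x]
    by (simp add: g_def DERIV_deriv_iff_real_differentiable)
  have "ck (8 * l + 1) ((deriv ^^ 1) f)" by (rule Ck_on_imp_ck[OF assms(26)]) simp
  then have "ck (8 * l + 1) g" by (simp add: g_def)
  \<comment> \<open>Decay of order 2l + 2 in 1 + u^2 costs 2 (2l + 2) derivatives of g, which is at
    most 8l + 1 because l \<ge> 1.\<close>
  then have ckg: "ck (2 * (2 * l + 2)) g" by (rule ck_le) (use l in simp)
  have g: "continuous_on UNIV g" using ckg by (rule ck_imp_continuous)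
  have fc: "continuous_on UNIV f"
    by (intro continuous_at_imp_continuous_on ballI) (rule DERIV_continuous[OF f])
  have [measurable]: "f \<in> borel_measurable borel" using fc by (rule borel_measurable_continuous_onI)
  obtain C where K: "selfsimilar_kernel \<phi> (deriv \<phi>) (deriv (deriv \<phi>)) \<alpha> \<beta> \<theta> C"
    using selfsimilar_kernel_exists[OF alpha0 assms(5) beta assms(23) assms(15,16) _ assms(21,22,25), of "\<phi> 1"]
      kernel_growth[OF ss X0 \<phi>_eq] by blast
  note cov_eq = cov_self_similar[OF ss X0 \<phi>_eq]
  let ?P = "\<nu> \<Otimes>\<^sub>M unit_lborel"
  let ?V = "\<lambda>p::real \<times> real. snd p - 1/2" and ?Y = "\<lambda>p::real \<times> real. fst p - 1/2"
  let ?x = "\<lambda>n j. X (real j / real n)"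
  have grid: "gaussian_grid M X ?P ?V ?Y l (?x n)" for n
    unfolding gaussian_grid_def gaussian_grid_axioms_def
    by (intro conjI gaussian_process_axioms moment_matching_product[OF \<nu> sym mom] allI gspan_base) simp
  interpret gg: gaussian_grid M X ?P ?V ?Y l "?x n" for n by (rule grid)
  have D_eq: "gg.D n i = increment X n i" for n i
    by (rule ext) (simp add: gg.D_def increment_def)
  have mono: "cov (?x n i) (?x n i) \<le> cov (?x n (Suc i)) (?x n (Suc i))" for n i
  proof -
    have \<phi>1: "0 \<le> \<phi> 1" unfolding \<phi>_eq[of 1, simplified] by (intro Bochner_Integration.integral_nonneg) simp
    have v: "cov (?x n j) (?x n j) = (real j / n) powr (2 * \<beta>) * \<phi> 1" for j
      using cov_eq[of "real j / n" "real j / n"] by (cases "real j / n = 0") auto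
    show ?thesis unfolding v
      using beta by (intro mult_right_mono powr_mono2 divide_right_mono \<phi>1) auto
  qed
  have conv: "converges_in_probability M (nu_sum \<nu> g X t) (\<lambda>\<omega>. f (X t \<omega>) - f 0)" if t: "0 \<le> t" for t
    unfolding converges_in_probability_def
  proof (intro conjI allI impI)
    show S_meas: "nu_sum \<nu> g X t n \<in> borel_measurable M" for n
      by (intro nu_sum_measurable \<nu> X_meas g)
    have Xt [measurable]: "X t \<in> borel_measurable M" using t by (rule X_meas)
    show "(\<lambda>\<omega>. f (X t \<omega>) - f 0) \<in> borel_measurable M" by measurable
    let ?N = "\<lambda>n. nat \<lfloor>real n * t\<rfloor>"
    obtain b W where b: "0 \<le> b"
      and row: "\<And>n i. 1 \<le> n \<Longrightarrow> i < ?N n \<Longrightarrow>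
        (\<Sum>j<?N n. \<bar>cov (increment X n i) (increment X n j)\<bar>) \<le> b * real n powr (- \<alpha>)"
      and var: "\<And>n k. 1 \<le> n \<Longrightarrow> k \<le> ?N n \<Longrightarrow>
        (\<Sum>i<?N n. \<bar>cov (increment X n i) (X (real k / n))\<bar>) \<le> W"
      by (rule grid_covariance_bounds[OF K cov_eq t]) auto
    have N: "real (?N n) \<le> t * real n" for n using t by (simp add: mult.commute)
    \<comment> \<open>The boundary term between the last grid time and t; it vanishes along every
      path by continuity.\<close>
    define rest where "rest n \<omega> = f (X t \<omega>) - f (X (real (?N n) / real n) \<omega>)" for n \<omega>
    have rest_meas [measurable]: "rest n \<in> borel_measurable M" for n
    proof -
      have [measurable]: "X (real (?N n) / real n) \<in> borel_measurable M" by (intro X_meas) simp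
      show ?thesis unfolding rest_def by measurable
    qed
    have rest_lim: "(\<lambda>n. rest n \<omega>) \<longlonglongrightarrow> 0" if w: "\<omega> \<in> space M" for \<omega>
    proof -
      have "(\<lambda>n. real (?N n) / real n) \<longlonglongrightarrow> t"
      proof (rule tendsto_sandwich[of "\<lambda>n. t - 1 / real n" _ _ "\<lambda>_. t"])
        show "\<forall>\<^sub>F n in sequentially. t - 1 / real n \<le> real (?N n) / real n"
          using eventually_gt_at_top[of "0::nat"]
        proof eventually_elim
          case (elim n)
          have "real n * t - 1 \<le> real (?N n)" using t by linarith
          then have "(real n * t - 1) / n \<le> real (?N n) / n" by (rule divide_right_mono) simp
          then show ?case using elim by (simp add: diff_divide_distrib)
        qed
        show "\<forall>\<^sub>F n in sequentially. real (?N n) / real n \<le> t"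
          using eventually_gt_at_top[of "0::nat"]
          by eventually_elim (use N in \<open>simp add: divide_le_eq\<close>)
        show "(\<lambda>n. t - 1 / real n) \<longlonglongrightarrow> t"
          using tendsto_diff[OF tendsto_const lim_1_over_n, of t] by simp
      qed simp
      then have "(\<lambda>n. X (real (?N n) / real n) \<omega>) \<longlonglongrightarrow> X t \<omega>"
        by (rule continuous_on_tendsto_compose[OF paths[OF w]]) (use t in auto)
      then have "(\<lambda>n. f (X (real (?N n) / real n) \<omega>)) \<longlonglongrightarrow> f (X t \<omega>)"
        using continuous_on_tendsto_compose[OF fc] by simp
      then show ?thesis unfolding rest_def using tendsto_diff[OF tendsto_const, of _ "f (X t \<omega>)" _ "f (X t \<omega>)"] by simp
    qed
    have split: "nu_sum \<nu> g X t n \<omega> - (f (X t \<omega>) - f 0) = - rest n \<omega> - gg.quad_error n g (?N n) \<omega>"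
      if "\<omega> \<in> space M" for n \<omega>
      using quad_error_eq[OF \<nu> grid f g, of n t \<omega>] X0[OF that] by (simp add: rest_def)
    fix e :: real assume e: "0 < e"
    let ?B = "\<lambda>n. {\<omega> \<in> space M. \<bar>nu_sum \<nu> g X t n \<omega> - (f (X t \<omega>) - f 0)\<bar> > e}"
    show "(\<lambda>n. prob (?B n)) \<longlonglongrightarrow> 0"
    proof (rule LIMSEQ_I)
      fix r :: real assume r: "0 < r"
      \<comment> \<open>The localization precedes the Fourier representation: R, and with it G,
        depends on r but not on n, so n may tend to infinity with G fixed.\<close>
      obtain R A where R: "0 < R" and A [measurable]: "A \<in> sets M" and PA: "prob A < r / 3"
        and loc: "\<And>\<omega> q. \<omega> \<in> space M - A \<Longrightarrow> q \<in> \<rat> \<Longrightarrow> 0 \<le> q \<Longrightarrow> q \<le> t \<Longrightarrow> \<bar>X q \<omega>\<bar> \<le> R"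
        by (rule continuous_process_localization[of X "r / 3" t]) (use X_meas paths r in auto)
      have "1 \<le> 2 * l + 2" by simp
      then obtain G Cg where G: "G \<in> borel_measurable borel" "Cg \<ge> 0" "\<And>u. norm (G u) \<le> Cg / (1 + u\<^sup>2) ^ (2 * l + 2)"
        and rep: "\<And>x. \<bar>x\<bar> \<le> R \<Longrightarrow> complex_of_real (g x) = (CLINT u|lborel. G u * iexp (u * x))"
        using fourier_representation[OF ckg _ R] by blast
      have Gi: "integrable lborel G"
        by (rule integrable_of_decay[OF G(1,2) _ G(3)]) simp
      \<comment> \<open>Z is defined on the whole space and coincides with the absolute quadrature
        error off A only. Its expectation is thus taken without truncation, and the Gaussian
        formulas remain applicable.\<close>
      define Z where "Z n \<omega> = norm (CLINT u|lborel. G u * gg.err_sum n (?N n) u \<omega>)" for n \<omega>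
      have Z_meas [measurable]: "Z n \<in> borel_measurable M" and Z_int: "integrable M (Z n)" for n
        unfolding Z_def using gg.expectation_fourier_error[OF G(1) Gi] by blast+
      have Z_nonneg: "0 \<le> Z n \<omega>" for n \<omega>
        by (simp add: Z_def)
      have Z_lim: "(\<lambda>n. expectation (Z n)) \<longlonglongrightarrow> 0"
        unfolding Z_def
      proof (rule fourier_error_tendsto_0[OF grid _ _ _ mono N b alpha G])
        show "X (real 0 / real n) \<omega> = 0" if "\<omega> \<in> space M" for n \<omega> using X0[OF that] by simp
      qed (use row var in \<open>simp_all add: D_eq\<close>)
      have quad: "\<bar>gg.quad_error n g (?N n) \<omega>\<bar> = Z n \<omega>" if w: "\<omega> \<in> space M - A" for n \<omega>
      proof -
        have "\<bar>X (real j / real n) \<omega>\<bar> \<le> R" if "j \<le> ?N n" for j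
        proof (rule loc[OF w])
          show "real j / real n \<in> \<rat>" by simp
          show "real j / real n \<le> t"
          proof (cases "n = 0")
            case False
            have "real j \<le> t * real n" using order.trans[OF _ N[of n], of "real j"] that by simp
            then show ?thesis using False by (simp add: divide_le_eq)
          qed (use t in simp)
        qed simp
        from gg.quad_error_fourier[OF G(1) Gi rep this]
        have "complex_of_real (gg.quad_error n g (?N n) \<omega>) = (CLINT u|lborel. G u * gg.err_sum n (?N n) u \<omega>)" .
        from arg_cong[OF this, of norm] show ?thesis unfolding Z_def norm_of_real .
      qed
      \<comment> \<open>A deviation beyond e needs a large boundary term, a path in A, or a large Z;
        the last event is handled by the Markov inequality.\<close>
      have bound: "prob (?B n) \<le> prob {\<omega> \<in> space M. \<bar>rest n \<omega>\<bar> > e / 2} + prob A + expectation (Z n) / (e / 2)" for n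
      proof -
        have "prob (?B n) \<le> prob (({\<omega> \<in> space M. \<bar>rest n \<omega>\<bar> > e / 2} \<union> A) \<union> {\<omega> \<in> space M. Z n \<omega> \<ge> e / 2})"
        proof (rule finite_measure_mono)
          show "?B n \<subseteq> ({\<omega> \<in> space M. \<bar>rest n \<omega>\<bar> > e / 2} \<union> A) \<union> {\<omega> \<in> space M. Z n \<omega> \<ge> e / 2}"
          proof
            fix \<omega> assume "\<omega> \<in> ?B n"
            then have w: "\<omega> \<in> space M" and "\<bar>- rest n \<omega> - gg.quad_error n g (?N n) \<omega>\<bar> > e"
              using split[of \<omega> n] by auto
            then have *: "\<bar>rest n \<omega>\<bar> > e / 2 \<or> \<bar>gg.quad_error n g (?N n) \<omega>\<bar> \<ge> e / 2" by linarith
            show "\<omega> \<in> ({\<omega> \<in> space M. \<bar>rest n \<omega>\<bar> > e / 2} \<union> A) \<union> {\<omega> \<in> space M. Z n \<omega> \<ge> e / 2}"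
            proof (cases "\<omega> \<in> A")
              case False
              then have "\<bar>gg.quad_error n g (?N n) \<omega>\<bar> = Z n \<omega>" using w by (intro quad) simp
              then show ?thesis using * w by auto
            qed simp
          qed
        qed measurable
        also have "\<dots> \<le> prob ({\<omega> \<in> space M. \<bar>rest n \<omega>\<bar> > e / 2} \<union> A) + prob {\<omega> \<in> space M. Z n \<omega> \<ge> e / 2}"
          by (rule measure_Un_le) measurable
        also have "prob ({\<omega> \<in> space M. \<bar>rest n \<omega>\<bar> > e / 2} \<union> A) \<le> prob {\<omega> \<in> space M. \<bar>rest n \<omega>\<bar> > e / 2} + prob A"
          by (rule measure_Un_le) measurable
        also have "prob {\<omega> \<in> space M. Z n \<omega> \<ge> e / 2} \<le> expectation (Z n) / (e / 2)"
          using integral_Markov_inequality_measure[of M "Z n" "{}" "e / 2"] Z_int e Z_nonneg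
          by simp
        finally show ?thesis by simp
      qed
      have "(\<lambda>n. prob {\<omega> \<in> space M. \<bar>rest n \<omega>\<bar> > e / 2}) \<longlonglongrightarrow> 0"
        by (rule pointwise_imp_in_probability) (use rest_lim e in auto)
      then have ev1: "\<forall>\<^sub>F n in sequentially. prob {\<omega> \<in> space M. \<bar>rest n \<omega>\<bar> > e / 2} < r / 3"
        by (rule order_tendstoD) (use r in simp)
      have "(\<lambda>n. expectation (Z n) / (e / 2)) \<longlonglongrightarrow> 0 / (e / 2)"
        using e by (intro tendsto_divide Z_lim tendsto_const) simp
      then have ev2: "\<forall>\<^sub>F n in sequentially. expectation (Z n) / (e / 2) < r / 3"
        by (intro order_tendstoD) (use r in auto)
      have "\<forall>\<^sub>F n in sequentially. norm (prob (?B n) - 0) < r"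
        using ev1 ev2
      proof eventually_elim
        case (elim n)
        show ?case using bound[of n] elim PA measure_nonneg[of M "?B n"] by simp
      qed
      then show "\<exists>no. \<forall>n\<ge>no. norm (prob (?B n) - 0) < r"
        by (simp add: eventually_sequentially)
    qed
  qed
  show ?thesis
  proof (intro allI impI)
    fix t :: real assume "0 \<le> t"
    note c = conv[OF this]
    have "AE \<omega> in M. f (X t \<omega>) = f 0 + J \<omega>" if "has_nu_symmetric_integral M \<nu> (deriv f) X t J" for J
      using converges_in_probability_unique[OF prob_space_axioms c, of J] that
      unfolding has_nu_symmetric_integral_def g_def by (auto simp: algebra_simps)
    then show "(\<exists>J. has_nu_symmetric_integral M \<nu> (deriv f) X t J) \<and>
           (\<forall>J. has_nu_symmetric_integral M \<nu> (deriv f) X t J \<longrightarrow> (AE \<omega> in M. f (X t \<omega>) = f 0 + J \<omega>))"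
      using c unfolding has_nu_symmetric_integral_def g_def by blast
  qed
qed

end
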